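(* Let $(R, \mathfrak{m})$ be a local Cohen-Macaulay ring of dimension $d>0$ with infinite residue field, and let $I$ be an $\mathfrak{m}$-primary ideal of $R$. Then the multiplicity $f_0$ of the special fiber ring $\mathcal{F}$ of $I$ satisfies $$f_0 \leq e_1 - e_0 + \lambda(R/I) + \mu(I) - d + 1.$$
   Context: Local rings are Noetherian. $\lambda(\cdot)$ denotes length and $\mu(\cdot)$ minimal number of generators. The special fiber ring of $I$ is $\mathcal{F}=\mathcal{F}(I)=\bigoplus_{m\ge 0} I^m/\mathfrak{m}I^m = R[It]\otimes_R R/\mathfrak{m}$. Since $I$ is $\mathfrak m$-primary, $\dim\mathcal{F}=d$; for $m\gg 0$, $\mu(I^m)$ is a polynomial in $m$ of degree $d-1$, and the multiplicity $f_0=f_0(I)$ of $\mathcal{F}$ is its normalized leading coefficient, i.e. $\mu(I^m)=f_0\binom{m+d-1}{d-1}+(\text{terms of lower degree in } m)$ for $m\gg0$. The integers $e_0=e_0(I)$, $e_1=e_1(I)$ are the first two Hilbert coefficients of $I$: for $m\gg 0$, $\lambda(R/I^m)=e_0\binom{m+d-1}{d}-e_1\binom{m+d-2}{d-1}+\cdots+(-1)^d e_d$. *)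

theory Defs
  imports "HOL-Algebra.Ring_Divisibility" "HOL-Algebra.Ideal_Product" "HOL-Algebra.Module"
    "HOL-Library.Extended_Nat"
begin

section \<open>Local rings, dimension and depth\<close>

locale noetherian_local_ring = noetherian_ring R + cring R + maximalideal \<mm> R
  for R (structure) and \<mm> +
  assumes maximal_unique: "maximalideal M R \<Longrightarrow> M = \<mm>"

text \<open>The supremum of the lengths \<open>n\<close> of chains \<open>P 0 \<subset> P 1 \<subset> \<dots> \<subset> P n\<close> of prime ideals.\<close>

definition krull_dim :: "('a, 'b) ring_scheme \<Rightarrow> enat" where
  "krull_dim R = Sup {enat n | n. \<exists>P :: nat \<Rightarrow> 'a set.
     (\<forall>i\<le>n. primeideal (P i) R) \<and> (\<forall>i<n. P i \<subset> P (Suc i))}"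

text \<open>Each \<open>xs ! i\<close> is a nonzerodivisor modulo the ideal generated by its predecessors, and the
  whole sequence generates a proper ideal.\<close>

definition regular_sequence :: "('a, 'b) ring_scheme \<Rightarrow> 'a list \<Rightarrow> bool" where
  "regular_sequence R xs \<longleftrightarrow>
     set xs \<subseteq> carrier R \<and>
     Idl\<^bsub>R\<^esub> (set xs) \<noteq> carrier R \<and>
     (\<forall>i<length xs. \<forall>a\<in>carrier R.
        xs ! i \<otimes>\<^bsub>R\<^esub> a \<in> Idl\<^bsub>R\<^esub> (set (take i xs)) \<longrightarrow> a \<in> Idl\<^bsub>R\<^esub> (set (take i xs)))"

definition depth :: "('a, 'b) ring_scheme \<Rightarrow> 'a set \<Rightarrow> enat" where
  "depth R \<mm> = Sup {enat (length xs) | xs. regular_sequence R xs \<and> set xs \<subseteq> \<mm>}"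

locale cohen_macaulay_local_ring = noetherian_local_ring +
  assumes depth_eq_dim: "depth R \<mm> = krull_dim R"

section \<open>Primary ideals\<close>

definition ideal_radical :: "('a, 'b) ring_scheme \<Rightarrow> 'a set \<Rightarrow> 'a set" where
  "ideal_radical R I = {x \<in> carrier R. \<exists>n::nat. x [^]\<^bsub>R\<^esub> n \<in> I}"

locale primary_ideal = ideal I R + cring R for I and R (structure) +
  assumes I_notcarr: "carrier R \<noteq> I"
    and I_primary: "\<lbrakk>a \<in> carrier R; b \<in> carrier R; a \<otimes> b \<in> I\<rbrakk>
      \<Longrightarrow> a \<in> I \<or> (\<exists>n::nat. b [^] n \<in> I)"

definition primary_to :: "('a, 'b) ring_scheme \<Rightarrow> 'a set \<Rightarrow> 'a set \<Rightarrow> bool" where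
  "primary_to R P I \<longleftrightarrow> primary_ideal I R \<and> ideal_radical R I = P"

section \<open>Length and minimal number of generators\<close>

text \<open>The supremum of the lengths of strict chains of submodules.\<close>

definition module_length :: "('a, 'c) ring_scheme \<Rightarrow> ('a, 'b, 'd) module_scheme \<Rightarrow> enat" where
  "module_length R M = Sup {enat n | n. \<exists>N :: nat \<Rightarrow> 'b set.
     (\<forall>i\<le>n. submodule (N i) R M) \<and> (\<forall>i<n. N i \<subset> N (Suc i))}"

text \<open>The cyclic \<open>R\<close>-module \<open>R/I\<close>: the quotient ring with scalars acting through \<open>R \<rightarrow> R/I\<close>.\<close>

definition quot_module :: "('a, 'b) ring_scheme \<Rightarrow> 'a set \<Rightarrow> ('a, 'a set) module" where
  "quot_module R I =
     \<lparr>carrier = carrier (R Quot I), mult = mult (R Quot I), one = one (R Quot I),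
      zero = zero (R Quot I), add = add (R Quot I),
      smult = (\<lambda>r X. (I +>\<^bsub>R\<^esub> r) \<otimes>\<^bsub>R Quot I\<^esub> X)\<rparr>"

text \<open>\<open>\<lambda>(R/I)\<close>. Only meaningful when \<open>R/I\<close> has finite length, as for the powers of an
  \<open>\<mm>\<close>-primary ideal.\<close>

definition colength :: "('a, 'b) ring_scheme \<Rightarrow> 'a set \<Rightarrow> nat" where
  "colength R I = the_enat (module_length R (quot_module R I))"

definition min_gens :: "('a, 'b) ring_scheme \<Rightarrow> 'a set \<Rightarrow> nat" where
  "min_gens R I = (LEAST n. \<exists>A \<subseteq> carrier R. finite A \<and> card A = n \<and> I = Idl\<^bsub>R\<^esub> A)"

abbreviation ideal_power :: "('a, 'b) ring_scheme \<Rightarrow> 'a set \<Rightarrow> nat \<Rightarrow> 'a set" where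
  "ideal_power R I n \<equiv> I [^]\<^bsub>ideals_set R\<^esub> n"

section \<open>Hilbert coefficients and the multiplicity of the special fiber ring\<close>

text \<open>The coefficients \<open>e\<^sub>0, \<dots>, e\<^sub>d\<close> of the Hilbert-Samuel polynomial of an \<open>\<mm>\<close>-primary ideal \<open>I\<close>
  of a ring of dimension \<open>d\<close>, with respect to the basis
  \<open>m \<mapsto> (m + d - 1 - i choose d - i)\<close>. The entries beyond \<open>d\<close> are set to zero to make the
  sequence unique.\<close>

definition hilbert_coeff :: "('a, 'b) ring_scheme \<Rightarrow> nat \<Rightarrow> 'a set \<Rightarrow> nat \<Rightarrow> int" where
  "hilbert_coeff R d I = (THE e :: nat \<Rightarrow> int.
     (\<forall>i>d. e i = 0) \<and>
     (\<forall>\<^sub>F m in sequentially. int (colength R (ideal_power R I m)) =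
        (\<Sum>i\<le>d. (- 1) ^ i * e i * int ((m + d - 1 - i) choose (d - i)))))"

text \<open>The special fiber ring of \<open>I\<close> is \<open>F = \<Oplus>\<^sub>m I\<^sup>m / \<mm> I\<^sup>m\<close>; the dimension of its degree \<open>m\<close>
  component over \<open>R/\<mm>\<close> is \<open>\<mu>(I\<^sup>m)\<close> (Nakayama), so its Hilbert function is \<open>m \<mapsto> \<mu>(I\<^sup>m)\<close>. Its
  multiplicity is the normalized leading coefficient of the corresponding polynomial of degree
  \<open>d - 1\<close>; the sum with coefficients \<open>c\<close> is the part of lower degree.\<close>

definition special_fiber_multiplicity :: "('a, 'b) ring_scheme \<Rightarrow> nat \<Rightarrow> 'a set \<Rightarrow> int" where
  "special_fiber_multiplicity R d I = (THE f :: int. \<exists>c :: nat \<Rightarrow> rat.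
     \<forall>\<^sub>F m in sequentially. of_nat (min_gens R (ideal_power R I m)) =
       of_int f * of_nat ((m + d - 1) choose (d - 1)) + (\<Sum>i<d - 1. c i * of_nat m ^ i))"

end

(* The fiber ring and the Hilbert function of R/I^m are compared with the powers of an ideal
   J = (x_1, ..., x_d) generated by general elements of I. Since x_1, ..., x_d can be completed to
   n = mu(I) generators of I, the ideal J^m I = J^(m+1) + J^m (y_1, ..., y_(n-d)) has at most
   mu(J^(m+1)) + (n - d) mu(J^m) generators, and the remaining generators of I^(m+1) number at most
   the length of I^(m+1)/J^m I. The colength of J^m I is at most
   l(R/J) C(m+d-1,d) + l(R/I) C(m+d-1,d-1), so comparing leading coefficients gives the bound as
   soon as l(R/J) <= e_0. The latter holds when the x_i form a superficial regular sequence: killing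
   a superficial nonzerodivisor lowers the Hilbert function by one difference, up to a constant.
   In the family x_u = a_1 + u a_2 + ... + u^(n-1) a_n any n members with distinct residues u
   generate I (Vandermonde), and a Noetherian induction shows that all but finitely many x_u are
   nonzerodivisors modulo a given ideal (respectively superficial). Lexicographically leading monomials
   reduce eventual polynomiality of the Hilbert functions and the Noetherian property of the Rees
   algebra to Dickson's lemma. *)

theory Submission
  imports Defs Complex_Main "HOL-Library.List_Lexorder" "HOL-Library.Infinite_Set"
begin

section \<open>Monotone functions of exponent vectors\<close>

text \<open>Every summand of the bound is a coefficient of degree d-1 in one inequality for mu(I^m)
  + l(R/I^m) with m = k+1: J^m contributes 1, the products of J^k with the n-d extra generators
  contribute n-d, the passage from J^k to J^k I contributes l(R/I), the shift from k back to m in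
  l(R/J^k) contributes -e_0, and the coefficient -e_1 of l(R/I^m) changes side. The terms of degree
  d must cancel first; this is what l(R/J) <= e_0, and hence the superficial choice of the x_i, is
  for. Polynomiality is at first known only with a degree bounded through the number of generators
  of I; comparison with the powers of J, whose colengths grow at most like m^d, cuts the degree
  down. Neither R/I^m nor the Rees algebra is handled as an object of its own: lengths are computed
  in the lattice of ideals of R by means of strictly decreasing functions, and a homogeneous ideal
  of the Rees algebra is a family of ideals of R indexed by the degree.\<close>

lemma nat_seq_incseq_subseq:
  fixes f :: "nat \<Rightarrow> nat"
  obtains \<phi> where "strict_mono \<phi>" "\<And>i. f (\<phi> i) \<le> f (\<phi> (Suc i))"
proof -
  obtain \<psi> :: "nat \<Rightarrow> nat" where \<psi>: "strict_mono \<psi>" "monoseq (\<lambda>n. f (\<psi> n))"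
    using seq_monosub by blast
  show ?thesis
  proof (cases "\<forall>m n. m \<le> n \<longrightarrow> f (\<psi> m) \<le> f (\<psi> n)")
    case True
    then show ?thesis using that[OF \<psi>(1)] by simp
  next
    case False
    then have dec: "f (\<psi> n) \<le> f (\<psi> m)" if "m \<le> n" for m n
      using \<psi>(2) that unfolding monoseq_def by blast
    obtain N where N: "\<And>n. f (\<psi> N) \<le> f (\<psi> n)"
      using ex_has_least_nat[of "\<lambda>_. True" 0 "\<lambda>n. f (\<psi> n)"] by auto
    have eq: "f (\<psi> (N + i)) = f (\<psi> N)" for i
      using N[of "N + i"] dec[of N "N + i"] by simp
    have "strict_mono (\<lambda>i. \<psi> (N + i))"
      using \<psi>(1) by (simp add: strict_mono_def)
    then show ?thesis using that[of "\<lambda>i. \<psi> (N + i)"] eq by (metis order_refl)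
  qed
qed

text \<open>Dickson's lemma as an increasing subsequence: first make the heads increase, then refine
  so that the tails do; refining preserves the monotonicity of the heads.\<close>

lemma dickson_subseq:
  fixes \<alpha> :: "nat \<Rightarrow> nat list"
  assumes "\<And>i. length (\<alpha> i) = n"
  obtains \<phi> where "strict_mono \<phi>" "\<And>i. list_all2 (\<le>) (\<alpha> (\<phi> i)) (\<alpha> (\<phi> (Suc i)))"
  using assms
proof (induction n arbitrary: \<alpha> thesis)
  case 0
  have "strict_mono (\<lambda>i::nat. i)" by (simp add: strict_mono_def)
  then show ?case using 0 by simp
next
  case (Suc n)
  obtain \<phi> where \<phi>: "strict_mono \<phi>" "\<And>i. hd (\<alpha> (\<phi> i)) \<le> hd (\<alpha> (\<phi> (Suc i)))"
    using nat_seq_incseq_subseq[of "\<lambda>i. hd (\<alpha> i)"] by auto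
  have "length (tl (\<alpha> (\<phi> i))) = n" for i using Suc.prems(2) by simp
  then obtain \<psi> where \<psi>: "strict_mono \<psi>"
    "\<And>i. list_all2 (\<le>) (tl (\<alpha> (\<phi> (\<psi> i)))) (tl (\<alpha> (\<phi> (\<psi> (Suc i)))))"
    using Suc.IH[of "\<lambda>i. tl (\<alpha> (\<phi> i))"] by metis
  have hdm: "hd (\<alpha> (\<phi> i)) \<le> hd (\<alpha> (\<phi> j))" if "i \<le> j" for i j
    using that by (rule lift_Suc_mono_le[of "\<lambda>i. hd (\<alpha> (\<phi> i))", OF \<phi>(2)])
  have "list_all2 (\<le>) (\<alpha> (\<phi> (\<psi> i))) (\<alpha> (\<phi> (\<psi> (Suc i))))" for i
  proof -
    have "\<alpha> k = hd (\<alpha> k) # tl (\<alpha> k)" for k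
      using Suc.prems(2)[of k] by (metis length_0_conv list.collapse nat.distinct(1))
    moreover have "\<psi> i \<le> \<psi> (Suc i)" using \<psi>(1) by (simp add: strict_mono_leD)
    ultimately show ?thesis using \<psi>(2) hdm by (metis list_all2_Cons)
  qed
  then show ?case
    using Suc.prems(1)[of "\<lambda>i. \<phi> (\<psi> i)"] \<phi>(1) \<psi>(1) by (simp add: strict_mono_def)
qed

text \<open>The stage k is uniform in \<alpha>. A failure would give infinitely many stages with a
  strict jump at some exponent; Dickson selects jumps at increasing exponents, and these assemble
  into a strictly increasing chain in \<open>\<S>\<close>, contrary to \<open>acc\<close>. It serves
  rays of naturals and leading coefficient ideals alike.\<close>

lemma monotone_exponent_families_stabilize:
  fixes G :: "nat \<Rightarrow> nat list \<Rightarrow> 'b set"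
  assumes acc: "\<And>A. (\<And>i::nat. A i \<in> \<S>) \<Longrightarrow> (\<And>i. A i \<subseteq> A (Suc i)) \<Longrightarrow> \<exists>k. A (Suc k) = A k"
    and mem: "\<And>t \<alpha>. length \<alpha> = n \<Longrightarrow> G t \<alpha> \<in> \<S>"
    and mono1: "\<And>t \<alpha>. length \<alpha> = n \<Longrightarrow> G t \<alpha> \<subseteq> G (Suc t) \<alpha>"
    and mono2: "\<And>t \<alpha> \<beta>. length \<alpha> = n \<Longrightarrow> list_all2 (\<le>) \<alpha> \<beta> \<Longrightarrow> G t \<alpha> \<subseteq> G t \<beta>"
  shows "\<exists>k. \<forall>t\<ge>k. \<forall>\<alpha>. length \<alpha> = n \<longrightarrow> G t \<alpha> = G k \<alpha>"
proof (rule ccontr)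
  assume neg: "\<not> ?thesis"
  have mono1': "G s \<alpha> \<subseteq> G t \<alpha>" if "s \<le> t" "length \<alpha> = n" for s t \<alpha>
    using that(1) by (rule lift_Suc_mono_le[of "\<lambda>i. G i \<alpha>", OF mono1[OF that(2)]])
  have "\<exists>j\<ge>k. \<exists>\<alpha>. length \<alpha> = n \<and> G (Suc j) \<alpha> \<noteq> G j \<alpha>" for k
  proof (rule ccontr)
    assume a: "\<not> ?thesis"
    have "G t \<alpha> = G k \<alpha>" if "length \<alpha> = n" "k \<le> t" for t \<alpha>
      using that(2) by (induction rule: dec_induct) (use a that(1) in auto)
    with neg show False by blast
  qed
  then have "infinite {j. \<exists>\<alpha>. length \<alpha> = n \<and> G (Suc j) \<alpha> \<noteq> G j \<alpha>}"
    unfolding Infinite_Set.infinite_nat_iff_unbounded_le by blast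
  then obtain \<psi> :: "nat \<Rightarrow> nat" where \<psi>: "strict_mono \<psi>"
    "\<And>i. \<psi> i \<in> {j. \<exists>\<alpha>. length \<alpha> = n \<and> G (Suc j) \<alpha> \<noteq> G j \<alpha>}"
    using infinite_enumerate by blast
  then have "\<forall>i. \<exists>\<alpha>. length \<alpha> = n \<and> G (Suc (\<psi> i)) \<alpha> \<noteq> G (\<psi> i) \<alpha>" by blast
  then obtain \<alpha> where \<alpha>: "\<And>i. length (\<alpha> i) = n" "\<And>i. G (Suc (\<psi> i)) (\<alpha> i) \<noteq> G (\<psi> i) (\<alpha> i)"
    by metis
  obtain \<phi> where \<phi>: "strict_mono \<phi>" "\<And>i. list_all2 (\<le>) (\<alpha> (\<phi> i)) (\<alpha> (\<phi> (Suc i)))"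
    using dickson_subseq[of \<alpha> n, OF \<alpha>(1)] by blast
  define A where "A i = G (\<psi> (\<phi> i)) (\<alpha> (\<phi> i))" for i
  \<comment> \<open>The jump at the exponent \<open>\<alpha> (\<phi> i)\<close> from stage
    \<open>\<psi> (\<phi> i)\<close> to its successor fits between \<open>A i\<close> and
    \<open>A (Suc i)\<close>, which makes the inclusion strict.\<close>
  have less: "A i \<subset> A (Suc i)" for i
  proof -
    have "\<psi> (\<phi> i) < \<psi> (\<phi> (Suc i))" using \<psi>(1) \<phi>(1) by (simp add: strict_mono_def)
    then have "G (Suc (\<psi> (\<phi> i))) (\<alpha> (\<phi> i)) \<subseteq> G (\<psi> (\<phi> (Suc i))) (\<alpha> (\<phi> i))"
      using mono1' \<alpha>(1) by (simp add: Suc_leI)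
    also have "\<dots> \<subseteq> A (Suc i)" unfolding A_def using mono2 \<alpha>(1) \<phi>(2) by blast
    finally have "G (Suc (\<psi> (\<phi> i))) (\<alpha> (\<phi> i)) \<subseteq> A (Suc i)" .
    moreover have "A i \<subset> G (Suc (\<psi> (\<phi> i))) (\<alpha> (\<phi> i))"
      unfolding A_def using mono1 \<alpha> by blast
    ultimately show ?thesis by blast
  qed
  have "A i \<in> \<S>" for i unfolding A_def using mem \<alpha>(1) by blast
  then obtain k where "A (Suc k) = A k" using acc[of A] less by blast
  then show False using less by blast
qed

text \<open>Agreement for large arguments with a polynomial of degree less than n, encoded by the
  vanishing of the n-th difference. In this form the induction over the number of variables becomes
  a statement about first differences.\<close>

primrec ev_poly :: "nat \<Rightarrow> (nat \<Rightarrow> int) \<Rightarrow> bool" where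
  "ev_poly 0 f \<longleftrightarrow> (\<forall>\<^sub>F m in sequentially. f m = 0)"
| "ev_poly (Suc n) f \<longleftrightarrow> ev_poly n (\<lambda>m. f (Suc m) - f m)"

lemma ev_poly_cong:
  assumes "\<forall>\<^sub>F m in sequentially. f m = g m" "ev_poly n f"
  shows "ev_poly n g"
  using assms
proof (induction n arbitrary: f g)
  case 0
  then have "\<forall>\<^sub>F m in sequentially. f m = 0" by simp
  with 0(1) have "\<forall>\<^sub>F m in sequentially. g m = 0" by eventually_elim simp
  then show ?case by simp
next
  case (Suc n)
  have "\<forall>\<^sub>F m in sequentially. f (Suc m) = g (Suc m)"
    using Suc.prems(1) eventually_sequentially_Suc[of "\<lambda>m. f m = g m"] by blast
  with Suc.prems(1) have "\<forall>\<^sub>F m in sequentially. f (Suc m) - f m = g (Suc m) - g m"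
    by eventually_elim simp
  then show ?case using Suc.IH Suc.prems(2) by simp
qed

lemma ev_poly_zero: "ev_poly n (\<lambda>m. 0)"
  by (induction n) auto

lemma ev_poly_add: "ev_poly n f \<Longrightarrow> ev_poly n g \<Longrightarrow> ev_poly n (\<lambda>m. f m + g m)"
proof (induction n arbitrary: f g)
  case 0
  then have "\<forall>\<^sub>F m in sequentially. f m = 0" "\<forall>\<^sub>F m in sequentially. g m = 0" by simp_all
  then have "\<forall>\<^sub>F m in sequentially. f m + g m = 0" by eventually_elim simp
  then show ?case by simp
next
  case (Suc n)
  then show ?case
    using Suc.IH[of "\<lambda>m. f (Suc m) - f m" "\<lambda>m. g (Suc m) - g m"] by (simp add: algebra_simps)
qed

lemma ev_poly_uminus: "ev_poly n f \<Longrightarrow> ev_poly n (\<lambda>m. - f m)"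
proof (induction n arbitrary: f)
  case (Suc n)
  then show ?case using Suc.IH[of "\<lambda>m. f (Suc m) - f m"] by (simp add: algebra_simps)
qed simp

lemma ev_poly_diff: "ev_poly n f \<Longrightarrow> ev_poly n g \<Longrightarrow> ev_poly n (\<lambda>m. f m - g m)"
  using ev_poly_add[OF _ ev_poly_uminus] by simp

lemma ev_poly_sum:
  "finite A \<Longrightarrow> (\<And>t. t \<in> A \<Longrightarrow> ev_poly n (f t)) \<Longrightarrow> ev_poly n (\<lambda>m. \<Sum>t\<in>A. f t m)"
  by (induction A rule: finite_induct) (auto intro: ev_poly_zero ev_poly_add)

lemma ev_poly_Suc_arg: "ev_poly n f \<Longrightarrow> ev_poly n (\<lambda>m. f (Suc m))"
  by (induction n arbitrary: f)
    (auto simp: eventually_sequentially_Suc[of "\<lambda>m. _ m = 0"])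

text \<open>Truncated subtraction differs from a true shift only for m < t, which eventual
  statements do not see.\<close>

lemma ev_poly_diff_arg:
  assumes "ev_poly n f" shows "ev_poly n (\<lambda>m. f (m - t))"
  using assms
proof (induction n arbitrary: f)
  case 0
  then obtain N where "\<And>m. m \<ge> N \<Longrightarrow> f m = 0" by (auto simp: eventually_sequentially)
  then have "\<forall>m\<ge>N + t. f (m - t) = 0" by simp
  then show ?case unfolding ev_poly.simps eventually_sequentially by blast
next
  case (Suc n)
  have ev: "\<forall>\<^sub>F m in sequentially. f (Suc (m - t)) - f (m - t) = f (Suc m - t) - f (m - t)"
    using eventually_ge_at_top[of t] by eventually_elim (simp add: Suc_diff_le)
  show ?case using ev_poly_cong[OF ev] Suc.IH[of "\<lambda>m. f (Suc m) - f m"] Suc.prems by simp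
qed

section \<open>Sums over the monomials of a given degree\<close>

definition exponents :: "nat \<Rightarrow> nat \<Rightarrow> nat list set" where
  "exponents n m = {\<alpha>. length \<alpha> = n \<and> sum_list \<alpha> = m}"

lemma exponents_0: "exponents 0 m = (if m = 0 then {[]} else {})"
  by (auto simp: exponents_def)

lemma exponents_Suc: "exponents (Suc n) m = (\<Union>t\<le>m. (#) t ` exponents n (m - t))"
proof (intro subset_antisym subsetI)
  fix \<alpha> assume "\<alpha> \<in> exponents (Suc n) m"
  then obtain t \<beta> where "\<alpha> = t # \<beta>" "length \<beta> = n" "m = t + sum_list \<beta>"
    by (auto simp: exponents_def length_Suc_conv)
  then show "\<alpha> \<in> (\<Union>t\<le>m. (#) t ` exponents n (m - t))"
    by (intro UN_I[of t]) (auto simp: exponents_def)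
qed (auto simp: exponents_def)

lemma finite_exponents: "finite (exponents n m)"
proof (induction n arbitrary: m)
  case 0
  show ?case by (simp add: exponents_0)
next
  case (Suc n)
  then show ?case by (simp add: exponents_Suc)
qed

lemma sum_exponents_Suc:
  "(\<Sum>\<alpha>\<in>exponents (Suc n) m. h \<alpha>) = (\<Sum>t\<le>m. \<Sum>\<alpha>\<in>exponents n (m - t). h (t # \<alpha>))"
proof -
  have "(\<Sum>\<alpha>\<in>exponents (Suc n) m. h \<alpha>) = (\<Sum>t\<le>m. \<Sum>\<alpha>\<in>(#) t ` exponents n (m - t). h \<alpha>)"
    unfolding exponents_Suc by (rule sum.UNION_disjoint) (auto simp: finite_exponents)
  then show ?thesis by (simp add: sum.reindex)
qed

text \<open>Split off the first exponent t. By Dickson the functions \<open>h (t # _)\<close>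
  coincide from some T on, so in the first difference of the sum only finitely many t survive, and
  each is governed by the case of n variables. This is the Hilbert polynomial argument with an
  order-reversing function in the place of a monomial ideal.\<close>

lemma ev_poly_sum_exponents:
  fixes h :: "nat list \<Rightarrow> nat"
  assumes "\<And>\<alpha> \<beta>. length \<alpha> = n \<Longrightarrow> list_all2 (\<le>) \<alpha> \<beta> \<Longrightarrow> h \<beta> \<le> h \<alpha>"
  shows "ev_poly n (\<lambda>m. \<Sum>\<alpha>\<in>exponents n m. int (h \<alpha>))"
  using assms
proof (induction n arbitrary: h)
  case 0
  have "\<forall>\<^sub>F m in sequentially. (\<Sum>\<alpha>\<in>exponents 0 m. int (h \<alpha>)) = 0"
    using eventually_gt_at_top[of 0] by eventually_elim (simp add: exponents_0)
  then show ?case by simp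
next
  case (Suc n)
  have anti1: "h (Suc t # \<alpha>) \<le> h (t # \<alpha>)" if "length \<alpha> = n" for t \<alpha>
    using Suc.prems[of "t # \<alpha>" "Suc t # \<alpha>"] that by (simp add: list.rel_refl)
  have anti2: "h (t # \<beta>) \<le> h (t # \<alpha>)" if "length \<alpha> = n" "list_all2 (\<le>) \<alpha> \<beta>" for t \<alpha> \<beta>
    using Suc.prems[of "t # \<alpha>" "t # \<beta>"] that by simp
  \<comment> \<open>Rays turn the decreasing values of \<open>h\<close> into increasing sets; their
    chains stop because a sequence of naturals attains a least value.\<close>
  have "\<exists>k. \<forall>t\<ge>k. \<forall>\<alpha>. length \<alpha> = n \<longrightarrow> {h (t # \<alpha>)..} = {h (k # \<alpha>)..}"
  proof (rule monotone_exponent_families_stabilize[where \<S> = "range atLeast"])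
    fix A :: "nat \<Rightarrow> nat set"
    assume A: "\<And>i. A i \<in> range atLeast" "\<And>i. A i \<subseteq> A (Suc i)"
    then have "\<forall>i. \<exists>a. A i = {a..}" by blast
    then obtain a where a: "\<And>i. A i = {a i..}" by metis
    obtain k where "\<And>i. a k \<le> a i"
      using ex_has_least_nat[of "\<lambda>_. True" 0 a] by auto
    then show "\<exists>k. A (Suc k) = A k" using A(2)[of k] a by (metis atLeast_subset_iff subset_antisym)
  qed (auto simp: anti1 anti2)
  then obtain T where T: "\<And>t \<alpha>. t \<ge> T \<Longrightarrow> length \<alpha> = n \<Longrightarrow> h (t # \<alpha>) = h (T # \<alpha>)"
    by (metis atLeast_eq_iff)
  define H where "H t m = (\<Sum>\<alpha>\<in>exponents n m. int (h (t # \<alpha>)))" for t m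
  have H: "ev_poly n (H t)" for t unfolding H_def by (rule Suc.IH) (use anti2 in blast)
  have HT: "H t m = H T m" if "t \<ge> T" for t m
    unfolding H_def using T[OF that] by (intro sum.cong) (auto simp: exponents_def)
  define S where "S m = (\<Sum>\<alpha>\<in>exponents (Suc n) m. int (h \<alpha>))" for m
  have S: "S m = (\<Sum>t\<le>m. H t (m - t))" for m
    unfolding S_def H_def by (rule sum_exponents_Suc)
  \<comment> \<open>The term t + 1 of degree m + 1 is matched with the term t of degree m; the
    unmatched term t = 0 is \<open>H 0 (Suc m)\<close>.\<close>
  have ev: "\<forall>\<^sub>F m in sequentially.
      H 0 (Suc m) + (\<Sum>t<T. H (Suc t) (m - t) - H t (m - t)) = S (Suc m) - S m"
    using eventually_ge_at_top[of T]
  proof eventually_elim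
    case (elim m)
    have "S (Suc m) = H 0 (Suc m) + (\<Sum>t\<le>m. H (Suc t) (m - t))"
      unfolding S by (subst sum.atMost_Suc_shift) simp
    then have "S (Suc m) - S m = H 0 (Suc m) + (\<Sum>t\<le>m. H (Suc t) (m - t) - H t (m - t))"
      unfolding S by (simp add: sum_subtractf)
    also have "(\<Sum>t\<le>m. H (Suc t) (m - t) - H t (m - t)) = (\<Sum>t<T. H (Suc t) (m - t) - H t (m - t))"
    proof (rule sum.mono_neutral_right)
      show "\<forall>t\<in>{..m} - {..<T}. H (Suc t) (m - t) - H t (m - t) = 0"
      proof
        fix t assume "t \<in> {..m} - {..<T}"
        then have "t \<ge> T" "Suc t \<ge> T" by auto
        then show "H (Suc t) (m - t) - H t (m - t) = 0" by (metis HT diff_self)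
      qed
    qed (use elim in auto)
    finally show ?case by simp
  qed
  have "ev_poly n (\<lambda>m. S (Suc m) - S m)"
  proof (rule ev_poly_cong[OF ev])
    have "ev_poly n (\<lambda>m. \<Sum>t<T. H (Suc t) (m - t) - H t (m - t))"
      by (rule ev_poly_sum, simp, rule ev_poly_diff) (rule ev_poly_diff_arg[OF H])+
    then show "ev_poly n (\<lambda>m. H 0 (Suc m) + (\<Sum>t<T. H (Suc t) (m - t) - H t (m - t)))"
      by (rule ev_poly_add[OF ev_poly_Suc_arg[OF H]])
  qed
  then show ?case unfolding S_def by simp
qed

section \<open>Eventually polynomial functions\<close>

text \<open>The basis of the Hilbert-Samuel polynomial: \<open>hbinom (d - i) m\<close> is the
  binomial that goes with e_i. For m > 0 it counts the monomials of degree less than m in j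
  variables.\<close>

definition hbinom :: "nat \<Rightarrow> nat \<Rightarrow> nat" where
  "hbinom j m = (m + j - 1) choose j"

lemma hbinom_0 [simp]: "hbinom 0 m = 1"
  by (simp add: hbinom_def)

lemma hbinom_Suc_Suc: "hbinom (Suc j) (Suc m) = hbinom (Suc j) m + hbinom j (Suc m)"
  by (simp add: hbinom_def)

lemma hbinom_Suc_0: "hbinom (Suc j) 0 = 0"
  by (simp add: hbinom_def)

lemma card_exponents: "card (exponents (Suc j) m) = hbinom j (Suc m)"
proof (induction j arbitrary: m)
  case 0
  have "exponents (Suc 0) m = {[m]}" by (auto simp: exponents_def length_Suc_conv)
  then show ?case by simp
next
  case (Suc j)
  have "card (exponents (Suc (Suc j)) m) = (\<Sum>t\<le>m. card (exponents (Suc j) (m - t)))"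
    using sum_exponents_Suc[of "\<lambda>_. 1 :: nat" "Suc j" m] by simp
  also have "\<dots> = (\<Sum>t\<le>m. hbinom j (Suc t))" unfolding Suc
    by (rule sum.reindex_bij_witness[of _ "\<lambda>t. m - t" "\<lambda>t. m - t"]) auto
  also have "\<dots> = hbinom (Suc j) (Suc m)"
    by (induction m) (simp_all add: hbinom_Suc_Suc hbinom_Suc_0)
  finally show ?case .
qed

lemma hbinom_Suc: "real (hbinom (Suc j) m) = real (hbinom j m) * (real m + real j) / real (Suc j)"
proof (cases "m + j")
  case (Suc k)
  have "Suc k * (k choose j) = (Suc k choose Suc j) * Suc j"
    by (rule Suc_times_binomial_eq)
  then have "real (Suc k) * real (k choose j) = real (Suc k choose Suc j) * real (Suc j)"
    by (metis of_nat_mult)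
  moreover have "hbinom (Suc j) m = Suc k choose Suc j" "hbinom j m = k choose j"
    "real m + real j = real (Suc k)"
    using Suc by (auto simp: hbinom_def simp flip: of_nat_add)
  ultimately show ?thesis by (simp add: field_simps del: of_nat_Suc)
qed (simp add: hbinom_def)

lemma hbinom_asymp: "(\<lambda>m. real (hbinom j m) / real m ^ j) \<longlonglongrightarrow> 1 / fact j"
proof (induction j)
  case (Suc j)
  have "(\<lambda>m. (real m + real j) / real m) \<longlonglongrightarrow> 1"
  proof -
    have "(\<lambda>m. 1 + real j * inverse (real m)) \<longlonglongrightarrow> 1 + real j * 0"
      by (intro tendsto_intros lim_inverse_n)
    moreover have "\<forall>\<^sub>F m in sequentially. 1 + real j * inverse (real m) = (real m + real j) / real m"
      using eventually_gt_at_top[of 0] by eventually_elim (simp add: field_simps)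
    ultimately show ?thesis by (simp add: filterlim_cong)
  qed
  then have "(\<lambda>m. (real (hbinom j m) / real m ^ j) * ((real m + real j) / real m) / real (Suc j))
      \<longlonglongrightarrow> (1 / fact j) * 1 / real (Suc j)"
    by (intro tendsto_intros Suc.IH) auto
  moreover have "real (hbinom (Suc j) m) / real m ^ Suc j =
      (real (hbinom j m) / real m ^ j) * ((real m + real j) / real m) / real (Suc j)" for m
    unfolding hbinom_Suc by (simp add: field_simps)
  ultimately show ?case by (simp add: mult.commute)
qed simp

lemma hbinom_asymp_less:
  assumes "j < k" shows "(\<lambda>m. real (hbinom j m) / real m ^ k) \<longlonglongrightarrow> 0"
proof -
  have "(\<lambda>m. real (hbinom j m) / real m ^ j * inverse (real m) ^ (k - j)) \<longlonglongrightarrow> 1 / fact j * 0 ^ (k - j)"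
    by (intro tendsto_intros hbinom_asymp lim_inverse_n)
  moreover have "real (hbinom j m) / real m ^ j * inverse (real m) ^ (k - j) = real (hbinom j m) / real m ^ k" for m
  proof -
    have "k = j + (k - j)" using assms by simp
    then have "real m ^ k = real m ^ j * real m ^ (k - j)" by (metis power_add)
    then show ?thesis by (simp add: field_simps power_inverse)
  qed
  ultimately show ?thesis using assms by (simp add: power_0_left)
qed

lemma hbinom_sum_asymp:
  fixes e :: "nat \<Rightarrow> int"
  assumes "\<forall>\<^sub>F m in sequentially. f m = (\<Sum>j\<le>D. e j * int (hbinom j m))"
  shows "(\<lambda>m. real_of_int (f m) / real m ^ D) \<longlonglongrightarrow> real_of_int (e D) / fact D"
proof -
  have "(\<lambda>m. (\<Sum>j<D. e j * (real (hbinom j m) / real m ^ D)) + e D * (real (hbinom D m) / real m ^ D))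
      \<longlonglongrightarrow> (\<Sum>j<D. real_of_int (e j) * 0) + real_of_int (e D) * (1 / fact D)"
    by (intro tendsto_add tendsto_sum tendsto_mult tendsto_const hbinom_asymp hbinom_asymp_less) auto
  moreover have "\<forall>\<^sub>F m in sequentially.
      (\<Sum>j<D. e j * (real (hbinom j m) / real m ^ D)) + e D * (real (hbinom D m) / real m ^ D) = f m / real m ^ D"
    using assms
    by eventually_elim
      (simp add: sum_divide_distrib add_divide_distrib lessThan_Suc_atMost[symmetric])
  ultimately show ?thesis by (simp add: filterlim_cong)
qed

text \<open>Newton's expansion with integer coefficients: the coefficients of the difference move up
  by one degree, and what remains is eventually constant and becomes the coefficient of degree
  0.\<close>

lemma ev_poly_expansion:
  "ev_poly D f \<Longrightarrow> \<exists>e. \<forall>\<^sub>F m in sequentially. f m = (\<Sum>j<D. e j * int (hbinom j m))"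
proof (induction D arbitrary: f)
  case (Suc D)
  \<comment> \<open>The rule \<open>hbinom_Suc_Suc\<close> describes a backward difference in this
    basis, hence the difference of \<open>f\<close> is expanded at m - 1.\<close>
  have "ev_poly D (\<lambda>m. f (Suc (m - 1)) - f (m - 1))"
    using ev_poly_diff_arg[where f = "\<lambda>m. f (Suc m) - f m"] Suc.prems by simp
  then obtain e where e: "\<forall>\<^sub>F m in sequentially. f (Suc (m - 1)) - f (m - 1) = (\<Sum>j<D. e j * int (hbinom j m))"
    using Suc.IH by blast
  define g where "g m = f m - (\<Sum>j<D. e j * int (hbinom (Suc j) m))" for m
  have "\<forall>\<^sub>F m in sequentially. f (Suc m) - f m = (\<Sum>j<D. e j * int (hbinom j (Suc m)))"
    using e eventually_sequentially_Suc[of "\<lambda>m. f (Suc (m - 1)) - f (m - 1) = (\<Sum>j<D. e j * int (hbinom j m))"]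
    by simp
  then have "\<forall>\<^sub>F m in sequentially. g (Suc m) = g m"
    by eventually_elim (simp add: g_def hbinom_Suc_Suc algebra_simps sum.distrib)
  then obtain N where N: "\<And>m. m \<ge> N \<Longrightarrow> g (Suc m) = g m"
    unfolding eventually_sequentially by blast
  have const: "g m = g N" if "m \<ge> N" for m
    using that by (induction rule: dec_induct) (use N in auto)
  define e' where "e' j = (case j of 0 \<Rightarrow> g N | Suc i \<Rightarrow> e i)" for j
  have "f m = (\<Sum>j<Suc D. e' j * int (hbinom j m))" if "m \<ge> N" for m
    using const[OF that] by (subst sum.lessThan_Suc_shift) (simp add: e'_def g_def)
  then show ?case unfolding eventually_sequentially by blast
qed simp

lemma hbinom_sum_unique:
  fixes e e' :: "nat \<Rightarrow> int"
  assumes "\<forall>\<^sub>F m in sequentially. f m = (\<Sum>j\<le>D. e j * int (hbinom j m))"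
    and "\<forall>\<^sub>F m in sequentially. f m = (\<Sum>j\<le>D. e' j * int (hbinom j m))"
    and "j \<le> D"
  shows "e j = e' j"
  using assms
proof (induction D arbitrary: f)
  case 0
  have "\<forall>\<^sub>F m in sequentially. e 0 = e' 0" using 0(1,2) by eventually_elim simp
  then show ?case using 0 by simp
next
  case (Suc D)
  have "real_of_int (e (Suc D)) / fact (Suc D) = real_of_int (e' (Suc D)) / fact (Suc D)"
    using LIMSEQ_unique[OF hbinom_sum_asymp[OF Suc.prems(1)] hbinom_sum_asymp[OF Suc.prems(2)]] .
  then have eq: "e (Suc D) = e' (Suc D)" by (simp del: fact_Suc)
  have 1: "\<forall>\<^sub>F m in sequentially. f m - e (Suc D) * int (hbinom (Suc D) m) = (\<Sum>j\<le>D. e j * int (hbinom j m))"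
    using Suc.prems(1) by eventually_elim simp
  have 2: "\<forall>\<^sub>F m in sequentially. f m - e (Suc D) * int (hbinom (Suc D) m) = (\<Sum>j\<le>D. e' j * int (hbinom j m))"
    using Suc.prems(2) by eventually_elim (simp add: eq)
  show ?case using Suc.IH[OF 1 2] Suc.prems(3) eq by (cases "j = Suc D") auto
qed

lemma hbinom_sum_truncate_tendsto:
  fixes e :: "nat \<Rightarrow> int"
  assumes "\<forall>\<^sub>F m in sequentially. f m = (\<Sum>j<N. e j * int (hbinom j m))"
    and lim: "\<And>k. d < k \<Longrightarrow> (\<lambda>m. real_of_int (f m) / real m ^ k) \<longlonglongrightarrow> 0"
  shows "\<exists>e'. \<forall>\<^sub>F m in sequentially. f m = (\<Sum>j\<le>d. e' j * int (hbinom j m))"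
  using assms(1)
proof (induction N)
  case 0
  then show ?case by (intro exI[of _ "\<lambda>_. 0"]) simp
next
  case (Suc N)
  show ?case
  proof (cases "N \<le> d")
    case True
    have "(\<Sum>j<Suc N. e j * int (hbinom j m)) = (\<Sum>j\<le>d. (if j \<le> N then e j else 0) * int (hbinom j m))" for m
      using True by (intro sum.mono_neutral_cong_left) auto
    then show ?thesis using Suc.prems by (intro exI[of _ "\<lambda>j. if j \<le> N then e j else 0"]) simp
  next
    case False
    have "(\<lambda>m. real_of_int (f m) / real m ^ N) \<longlonglongrightarrow> real_of_int (e N) / fact N"
      by (rule hbinom_sum_asymp) (use Suc.prems in \<open>simp add: lessThan_Suc_atMost\<close>)
    moreover have "(\<lambda>m. real_of_int (f m) / real m ^ N) \<longlonglongrightarrow> 0" using lim[of N] False by simp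
    ultimately have "real_of_int (e N) / fact N = 0" by (rule LIMSEQ_unique)
    then show ?thesis using Suc by simp
  qed
qed

lemma hbinom_sum_truncate:
  fixes e :: "nat \<Rightarrow> int"
  assumes "\<forall>\<^sub>F m in sequentially. f m = (\<Sum>j<N. e j * int (hbinom j m))"
    and bound: "\<And>m. \<bar>real_of_int (f m)\<bar> \<le> C * real (hbinom d m)"
  shows "\<exists>e'. \<forall>\<^sub>F m in sequentially. f m = (\<Sum>j\<le>d. e' j * int (hbinom j m))"
proof (rule hbinom_sum_truncate_tendsto[OF assms(1)])
  fix k assume "d < k"
  then have "(\<lambda>m. C * (real (hbinom d m) / real m ^ k)) \<longlonglongrightarrow> C * 0"
    by (intro tendsto_mult tendsto_const hbinom_asymp_less)
  then have lim: "(\<lambda>m. C * (real (hbinom d m) / real m ^ k)) \<longlonglongrightarrow> 0" by simp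
  have le: "norm (real_of_int (f m) / real m ^ k) \<le> C * (real (hbinom d m) / real m ^ k)" for m
    using divide_right_mono[OF bound[of m], of "real m ^ k"] by simp
  have "(\<lambda>m. norm (real_of_int (f m) / real m ^ k)) \<longlonglongrightarrow> 0"
    by (rule tendsto_sandwich[OF always_eventually always_eventually tendsto_const lim]) (use le in simp_all)
  then show "(\<lambda>m. real_of_int (f m) / real m ^ k) \<longlonglongrightarrow> 0"
    by (rule tendsto_norm_zero_cancel)
qed

text \<open>The definition of \<open>special_fiber_multiplicity\<close> writes the part of lower
  degree in powers of m with rational coefficients; this is the change of basis, by the recursion
  that multiplies by (m + j) / (j + 1).\<close>

lemma hbinom_eq_poly:
  "\<exists>c :: nat \<Rightarrow> rat. \<forall>m. of_nat (hbinom j m) = (\<Sum>i<Suc j. c i * of_nat m ^ i)"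
proof (induction j)
  case 0
  show ?case by (intro exI[of _ "\<lambda>_. 1"]) simp
next
  case (Suc j)
  then obtain c :: "nat \<Rightarrow> rat" where c: "\<And>m. of_nat (hbinom j m) = (\<Sum>i<Suc j. c i * of_nat m ^ i)" by blast
  \<comment> \<open>Coefficients of j times and of m times the polynomial given by \<open>c\<close>:
    the first list is padded by a zero at the top, the second is shifted up by one degree.\<close>
  define c1 where "c1 i = (if i < Suc j then of_nat j * c i else 0)" for i
  define c2 where "c2 i = (case i of 0 \<Rightarrow> 0 | Suc k \<Rightarrow> c k)" for i
  have "of_nat (hbinom (Suc j) m) = (\<Sum>i<Suc (Suc j). (c1 i + c2 i) / of_nat (Suc j) * of_nat m ^ i)" for m
  proof -
    have "real (hbinom (Suc j) m) * real (Suc j) = real (hbinom j m) * real (m + j)"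
      unfolding hbinom_Suc by simp
    then have "hbinom (Suc j) m * Suc j = hbinom j m * (m + j)"
      by (metis of_nat_eq_iff of_nat_mult)
    then have "(of_nat (hbinom (Suc j) m) :: rat) * of_nat (Suc j) = of_nat (hbinom j m) * of_nat (m + j)"
      by (metis of_nat_mult)
    moreover have "(of_nat j :: rat) * of_nat (hbinom j m) = (\<Sum>i<Suc (Suc j). c1 i * of_nat m ^ i)"
    proof -
      have "(\<Sum>i<Suc (Suc j). c1 i * of_nat m ^ i) = (\<Sum>i<Suc j. c1 i * of_nat m ^ i)"
        by (subst sum.lessThan_Suc) (simp add: c1_def)
      also have "\<dots> = (\<Sum>i<Suc j. of_nat j * (c i * of_nat m ^ i))"
        by (rule sum.cong) (auto simp: c1_def)
      finally show ?thesis unfolding c by (simp only: sum_distrib_left)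
    qed
    moreover have "(of_nat m :: rat) * of_nat (hbinom j m) = (\<Sum>i<Suc (Suc j). c2 i * of_nat m ^ i)"
      unfolding c sum_distrib_left
      by (subst sum.lessThan_Suc_shift[of _ "Suc j"]) (simp add: c2_def mult_ac del: sum.lessThan_Suc)
    ultimately have "(of_nat (hbinom (Suc j) m) :: rat) * of_nat (Suc j)
        = (\<Sum>i<Suc (Suc j). c1 i * of_nat m ^ i) + (\<Sum>i<Suc (Suc j). c2 i * of_nat m ^ i)"
      by (simp add: algebra_simps del: sum.lessThan_Suc)
    then have "(of_nat (hbinom (Suc j) m) :: rat)
        = ((\<Sum>i<Suc (Suc j). c1 i * of_nat m ^ i) + (\<Sum>i<Suc (Suc j). c2 i * of_nat m ^ i)) / of_nat (Suc j)"
      by (simp add: eq_divide_eq del: of_nat_Suc sum.lessThan_Suc)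
    also have "\<dots> = (\<Sum>i<Suc (Suc j). (c1 i + c2 i) / of_nat (Suc j) * of_nat m ^ i)"
      unfolding sum.distrib[symmetric] sum_divide_distrib by (rule sum.cong) (auto simp: field_simps)
    finally show ?thesis .
  qed
  then show ?case by (intro exI[of _ "\<lambda>i. (c1 i + c2 i) / of_nat (Suc j)"]) blast
qed

text \<open>Among commuting maps of which any n jointly detect membership in N, almost all do so
  alone. Choose a set S of the largest size k for which the joint preimage \<open>W S\<close> still
  exceeds N. A map outside S that is bad for N is bad for \<open>W S\<close> as well, since
  otherwise S could be enlarged; \<open>W S\<close> is strictly larger and inherits the hypotheses,
  so the ascending chain condition allows induction. Applied to multiplication on R and, degree by
  degree, on the Rees algebra.\<close>

lemma cofinite_regular:
  fixes \<phi> :: "'u \<Rightarrow> 'x \<Rightarrow> 'x" and \<L> :: "'x set set"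
  assumes wf: "wf {(M, N). M \<in> \<L> \<and> N \<in> \<L> \<and> N \<subset> M}"
    and sub: "\<And>N. N \<in> \<L> \<Longrightarrow> N \<subseteq> X"
    and pre: "\<And>N S. N \<in> \<L> \<Longrightarrow> S \<subseteq> U \<Longrightarrow> finite S \<Longrightarrow> S \<noteq> {} \<Longrightarrow> {z \<in> X. \<forall>u\<in>S. \<phi> u z \<in> N} \<in> \<L>"
    and stable: "\<And>N u z. N \<in> \<L> \<Longrightarrow> u \<in> U \<Longrightarrow> z \<in> N \<Longrightarrow> \<phi> u z \<in> N"
    and X: "\<And>u z. u \<in> U \<Longrightarrow> z \<in> X \<Longrightarrow> \<phi> u z \<in> X"
    and comm: "\<And>u v z. u \<in> U \<Longrightarrow> v \<in> U \<Longrightarrow> z \<in> X \<Longrightarrow> \<phi> u (\<phi> v z) = \<phi> v (\<phi> u z)"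
    and N: "N \<in> \<L>"
    and sat: "\<And>S z. S \<subseteq> U \<Longrightarrow> card S = n \<Longrightarrow> finite S \<Longrightarrow> z \<in> X \<Longrightarrow> \<forall>u\<in>S. \<phi> u z \<in> N \<Longrightarrow> z \<in> N"
  shows "finite {u \<in> U. \<exists>z\<in>X - N. \<phi> u z \<in> N}"
  using wf N sat
proof (induction N rule: wf_induct_rule)
  case (less N)
  define W where "W S = {z \<in> X. \<forall>u\<in>S. \<phi> u z \<in> N}" for S
  define bad where "bad M = {u \<in> U. \<exists>z\<in>X - M. \<phi> u z \<in> M}" for M
  show ?case
  proof (cases "bad N = {}")
    case True
    then show ?thesis unfolding bad_def by (metis finite.emptyI)
  next
    case False
    define P where "P k \<longleftrightarrow> (\<exists>S. S \<subseteq> U \<and> finite S \<and> S \<noteq> {} \<and> card S = k \<and> \<not> W S \<subseteq> N)" for k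
    obtain u where "u \<in> bad N" using False by blast
    then have P1: "P 1" unfolding P_def bad_def W_def by (intro exI[of _ "{u}"]) auto
    \<comment> \<open>By \<open>sat\<close> no joint preimage of n or more maps exceeds N, so the
      admissible sizes are bounded and a largest one exists.\<close>
    have Pn: "k < n" if Pk: "P k" for k
    proof (rule ccontr)
      assume "\<not> k < n"
      then obtain S S' where S: "S \<subseteq> U" "finite S" "\<not> W S \<subseteq> N" and S': "S' \<subseteq> S" "card S' = n"
        using Pk unfolding P_def by (metis not_less obtain_subset_with_card_n)
      have "W S \<subseteq> W S'" using S'(1) unfolding W_def by blast
      moreover have "W S' \<subseteq> N"
        using less.prems(2)[of S'] S S' finite_subset[OF S'(1)] unfolding W_def by auto
      ultimately show False using S(3) by blast
    qed
    define k where "k = (GREATEST k. P k)"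
    have "P k" unfolding k_def using P1 Pn by (metis GreatestI_nat less_imp_le)
    have kmax: "j \<le> k" if "P j" for j
      unfolding k_def using that Pn by (metis Greatest_le_nat less_imp_le)
    obtain S where S: "S \<subseteq> U" "finite S" "S \<noteq> {}" "card S = k" "\<not> W S \<subseteq> N"
      using \<open>P k\<close> unfolding P_def by blast
    have WL: "W S \<in> \<L>" unfolding W_def using pre less.prems(1) S by blast
    have NW: "N \<subset> W S"
      using S stable[OF less.prems(1)] sub[OF less.prems(1)] unfolding W_def by blast
    have fin: "finite (bad (W S))"
      unfolding bad_def
    proof (rule less.IH)
      show "(W S, N) \<in> {(M, N). M \<in> \<L> \<and> N \<in> \<L> \<and> N \<subset> M}" using WL NW less.prems(1) by simp
      fix T z assume T: "T \<subseteq> U" "card T = n" "finite T" and z: "z \<in> X" "\<forall>v\<in>T. \<phi> v z \<in> W S"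
      \<comment> \<open>Commutation transports the detection property from N to
        \<open>W S\<close>.\<close>
      have "\<phi> u z \<in> N" if u: "u \<in> S" for u
      proof (rule less.prems(2)[OF T])
        show "\<phi> u z \<in> X" using X u S(1) z(1) by blast
        show "\<forall>v\<in>T. \<phi> v (\<phi> u z) \<in> N"
        proof
          fix v assume v: "v \<in> T"
          then have "\<phi> u (\<phi> v z) \<in> N" using z(2) u unfolding W_def by blast
          moreover have "\<phi> u (\<phi> v z) = \<phi> v (\<phi> u z)" using comm u v S(1) T(1) z(1) by blast
          ultimately show "\<phi> v (\<phi> u z) \<in> N" by simp
        qed
      qed
      then show "z \<in> W S" unfolding W_def using z(1) by blast
    qed (rule WL)
    have "bad N \<subseteq> bad (W S) \<union> S"
    proof
      fix u assume "u \<in> bad N"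
      then obtain z where z: "u \<in> U" "z \<in> X" "z \<notin> N" "\<phi> u z \<in> N" unfolding bad_def by blast
      show "u \<in> bad (W S) \<union> S"
      proof (cases "u \<in> S")
        case False
        have "z \<notin> W S"
        proof
          assume "z \<in> W S"
          then have "z \<in> W (insert u S)" using z unfolding W_def by blast
          then have "P (Suc k)"
            unfolding P_def using S z False by (intro exI[of _ "insert u S"]) auto
          then show False using kmax by fastforce
        qed
        then show ?thesis using z NW unfolding bad_def by blast
      qed blast
    qed
    then have "finite (bad N)" using fin S(2) finite_subset by blast
    then show ?thesis unfolding bad_def .
  qed
qed

section \<open>Growth orders and leading coefficients\<close>

lemma hbinom_sum_asymp_less:
  fixes e :: "nat \<Rightarrow> int"
  assumes "\<forall>\<^sub>F m in sequentially. f m = (\<Sum>j<D. e j * int (hbinom j m))" "D \<le> N"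
  shows "(\<lambda>m. real_of_int (f m) / real m ^ N) \<longlonglongrightarrow> 0"
proof -
  have "(\<lambda>m. \<Sum>j<D. real_of_int (e j) * (real (hbinom j m) / real m ^ N)) \<longlonglongrightarrow> (\<Sum>j<D. real_of_int (e j) * 0)"
    by (intro tendsto_sum tendsto_mult tendsto_const hbinom_asymp_less) (use assms(2) in auto)
  moreover have "\<forall>\<^sub>F m in sequentially.
      (\<Sum>j<D. real_of_int (e j) * (real (hbinom j m) / real m ^ N)) = real_of_int (f m) / real m ^ N"
    using assms(1) by eventually_elim (simp add: sum_divide_distrib)
  ultimately show ?thesis by (simp add: filterlim_cong)
qed

lemma ev_poly_hbinom: "ev_poly (Suc i) (\<lambda>m. int (hbinom i m))"
proof (induction i)
  case (Suc i)
  have eq: "int (hbinom (Suc i) (Suc m)) - int (hbinom (Suc i) m) = int (hbinom i (Suc m))" for m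
    by (simp add: hbinom_Suc_Suc)
  show ?case by (subst ev_poly.simps(2)) (simp only: eq, rule ev_poly_Suc_arg[OF Suc])
qed simp

lemma ev_poly_mono: "ev_poly n f \<Longrightarrow> n \<le> k \<Longrightarrow> ev_poly k f"
proof (induction n arbitrary: f k)
  case 0
  then have "\<forall>\<^sub>F m in sequentially. f m = 0" by simp
  then have f: "\<forall>\<^sub>F m in sequentially. 0 = f m" by eventually_elim simp
  show ?case by (rule ev_poly_cong[OF f ev_poly_zero])
next
  case (Suc n)
  then show ?case by (cases k) auto
qed

lemma ev_poly_cmult: "ev_poly n f \<Longrightarrow> ev_poly n (\<lambda>m. a * f m)"
proof (induction n arbitrary: f)
  case 0
  then have "\<forall>\<^sub>F m in sequentially. f m = 0" by simp
  then show ?case unfolding ev_poly.simps by eventually_elim simp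
next
  case (Suc n)
  then show ?case using Suc.IH[of "\<lambda>m. f (Suc m) - f m"] by (simp add: right_diff_distrib)
qed

lemma ev_poly_hbinom_sum:
  fixes e :: "nat \<Rightarrow> int"
  assumes "\<forall>\<^sub>F m in sequentially. f m = (\<Sum>j\<le>d. e j * int (hbinom j m))"
  shows "ev_poly (Suc d) f"
proof (rule ev_poly_cong)
  show "\<forall>\<^sub>F m in sequentially. (\<Sum>j\<le>d. e j * int (hbinom j m)) = f m"
    using assms by eventually_elim simp
  have "ev_poly (Suc d) (\<lambda>m. e j * int (hbinom j m))" if "j \<in> {..d}" for j
    using that by (intro ev_poly_cmult ev_poly_mono[OF ev_poly_hbinom]) auto
  then show "ev_poly (Suc d) (\<lambda>m. \<Sum>j\<le>d. e j * int (hbinom j m))"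
    by (intro ev_poly_sum) auto
qed

lemma hbinom_Suc_arg: "hbinom j (Suc m) = (\<Sum>i\<le>j. hbinom i m)"
  by (induction j) (simp_all add: hbinom_Suc_Suc)

lemma leading_coeff_nonneg:
  fixes e :: "nat \<Rightarrow> int"
  assumes "\<forall>\<^sub>F m in sequentially. 0 \<le> (\<Sum>j\<le>D. e j * int (hbinom j m))"
  shows "0 \<le> e D"
proof -
  have "(\<lambda>m. real_of_int (\<Sum>j\<le>D. e j * int (hbinom j m)) / real m ^ D) \<longlonglongrightarrow> real_of_int (e D) / fact D"
    by (rule hbinom_sum_asymp) simp
  moreover have "\<forall>\<^sub>F m in sequentially. 0 \<le> real_of_int (\<Sum>j\<le>D. e j * int (hbinom j m)) / real m ^ D"
    using assms by eventually_elim (simp only: of_int_0_le_iff zero_le_divide_iff, simp)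
  ultimately have "0 \<le> real_of_int (e D) / fact D" by (intro tendsto_lowerbound) auto
  then have "0 \<le> real_of_int (e D) / fact D * fact D" by (rule mult_nonneg_nonneg) simp
  then show ?thesis by simp
qed

text \<open>Evaluates the definite description once some expansion is at hand. The index i counts
  from the top degree, so reversal and sign give e_i = (-1)^i g_(d-i); uniqueness comes from that of
  the expansion together with the zeros beyond d.\<close>

lemma hilbert_coeff_eq:
  fixes R :: "('a, 'b) ring_scheme"
  assumes g: "\<forall>\<^sub>F m in sequentially. int (colength R (ideal_power R I m)) = (\<Sum>j\<le>d. g j * int (hbinom j m))"
    and i: "i \<le> d"
  shows "hilbert_coeff R d I i = (- 1) ^ i * g (d - i)"
proof -
  have reindex: "(\<Sum>i\<le>d. (- 1) ^ i * e i * int ((m + d - 1 - i) choose (d - i)))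
      = (\<Sum>j\<le>d. ((- 1) ^ (d - j) * e (d - j)) * int (hbinom j m))" for e :: "nat \<Rightarrow> int" and m
  proof (rule sum.reindex_bij_witness[of _ "\<lambda>j. d - j" "\<lambda>i. d - i"])
    fix i assume "i \<in> {..d}"
    then have "m + (d - i) - 1 = m + d - 1 - i" "d - (d - i) = i" by auto
    then show "(- 1) ^ (d - (d - i)) * e (d - (d - i)) * int (hbinom (d - i) m)
      = (- 1) ^ i * e i * int ((m + d - 1 - i) choose (d - i))"
      unfolding hbinom_def by simp
  qed auto
  define e where "e i = (if i \<le> d then (- 1) ^ i * g (d - i) else 0)" for i
  have sq: "(- 1) ^ k * ((- 1) ^ k * x) = x" for k and x :: int
    by (simp flip: mult.assoc power_mult_distrib)
  have "hilbert_coeff R d I = e"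
    unfolding hilbert_coeff_def
  proof (rule the_equality)
    have "(\<Sum>i\<le>d. (- 1) ^ i * e i * int ((m + d - 1 - i) choose (d - i))) = (\<Sum>j\<le>d. g j * int (hbinom j m))" for m
      unfolding reindex by (rule sum.cong) (auto simp: e_def sq)
    then show "(\<forall>i>d. e i = 0) \<and> (\<forall>\<^sub>F m in sequentially. int (colength R (ideal_power R I m)) =
        (\<Sum>i\<le>d. (- 1) ^ i * e i * int ((m + d - 1 - i) choose (d - i))))"
      using g by (simp add: e_def)
    fix e' assume e': "(\<forall>i>d. e' i = 0) \<and> (\<forall>\<^sub>F m in sequentially. int (colength R (ideal_power R I m)) =
        (\<Sum>i\<le>d. (- 1) ^ i * e' i * int ((m + d - 1 - i) choose (d - i))))"
    then have g': "\<forall>\<^sub>F m in sequentially. int (colength R (ideal_power R I m)) =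
        (\<Sum>j\<le>d. ((- 1) ^ (d - j) * e' (d - j)) * int (hbinom j m))"
      unfolding reindex by blast
    show "e' = e"
    proof
      fix i
      show "e' i = e i"
      proof (cases "i \<le> d")
        case True
        then have "g (d - i) = (- 1) ^ i * e' i"
          using hbinom_sum_unique[OF g g', of "d - i"] by simp
        then show ?thesis using True by (simp add: e_def sq)
      qed (use e' in \<open>simp add: e_def\<close>)
    qed
  qed
  then show ?thesis using i by (simp add: e_def)
qed

text \<open>The definition uses C(m+d-1, d-1), which for d = j + 1 is
  \<open>hbinom j (Suc m)\<close>, one step ahead of the basis. As this is the sum of all
  \<open>hbinom i m\<close> with i \<le> j, the change leaves the top coefficient alone and replaces
  f_i by f_i - f_j below it.\<close>

lemma special_fiber_multiplicity_eq:
  fixes R :: "('a, 'b) ring_scheme"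
  assumes f: "\<forall>\<^sub>F m in sequentially. int (min_gens R (ideal_power R I m)) = (\<Sum>i\<le>j. f i * int (hbinom i m))"
  shows "special_fiber_multiplicity R (Suc j) I = f j"
proof -
  have choose: "(m + Suc j - 1) choose (Suc j - 1) = hbinom j (Suc m)" for m
    by (simp add: hbinom_def)
  have "\<forall>i. \<exists>c :: nat \<Rightarrow> rat. \<forall>m. of_nat (hbinom i m) = (\<Sum>l<Suc i. c l * of_nat m ^ l)"
    using hbinom_eq_poly by blast
  then obtain p :: "nat \<Rightarrow> nat \<Rightarrow> rat" where p: "\<And>i m. of_nat (hbinom i m) = (\<Sum>l<Suc i. p i l * of_nat m ^ l)"
    by metis
  define c :: "nat \<Rightarrow> rat" where "c l = (\<Sum>i<j. if l \<le> i then of_int (f i - f j) * p i l else 0)" for l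
  have c: "(\<Sum>l<j. c l * of_nat m ^ l) = (\<Sum>i<j. of_int (f i - f j) * of_nat (hbinom i m))" for m
  proof -
    have "(\<Sum>i<j. of_int (f i - f j) * of_nat (hbinom i m))
        = (\<Sum>i<j. \<Sum>l<j. (if l \<le> i then of_int (f i - f j) * p i l else 0) * of_nat m ^ l)"
    proof (rule sum.cong[OF refl])
      fix i assume i: "i \<in> {..<j}"
      have "of_int (f i - f j) * of_nat (hbinom i m) = (\<Sum>l<Suc i. of_int (f i - f j) * p i l * of_nat m ^ l)"
        unfolding p by (simp only: sum_distrib_left mult.assoc)
      also have "\<dots> = (\<Sum>l<j. (if l \<le> i then of_int (f i - f j) * p i l else 0) * of_nat m ^ l)"
        by (rule sum.mono_neutral_cong_left) (use i in auto)
      finally show "of_int (f i - f j) * of_nat (hbinom i m)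
        = (\<Sum>l<j. (if l \<le> i then of_int (f i - f j) * p i l else 0) * of_nat m ^ l)" .
    qed
    also have "\<dots> = (\<Sum>l<j. c l * of_nat m ^ l)"
      unfolding c_def sum_distrib_right by (rule sum.swap)
    finally show ?thesis ..
  qed
  show ?thesis
    unfolding special_fiber_multiplicity_def choose
  proof (rule the_equality)
    have "\<forall>\<^sub>F m in sequentially. (of_nat (min_gens R (ideal_power R I m)) :: rat) =
        of_int (f j) * of_nat (hbinom j (Suc m)) + (\<Sum>l<Suc j - 1. c l * of_nat m ^ l)"
      using f
    proof eventually_elim
      case (elim m)
      have "(of_nat (min_gens R (ideal_power R I m)) :: rat) = of_int (\<Sum>i\<le>j. f i * int (hbinom i m))"
        unfolding elim[symmetric] by simp
      also have "\<dots> = of_int (f j) * of_nat (hbinom j (Suc m)) + (\<Sum>i<j. of_int (f i - f j) * of_nat (hbinom i m))"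
        unfolding hbinom_Suc_arg lessThan_Suc_atMost[symmetric]
        by (simp add: sum_distrib_left algebra_simps sum_subtractf)
      finally show ?case using c by simp
    qed
    then show "\<exists>c :: nat \<Rightarrow> rat. \<forall>\<^sub>F m in sequentially. of_nat (min_gens R (ideal_power R I m)) =
        of_int (f j) * of_nat (hbinom j (Suc m)) + (\<Sum>i<Suc j - 1. c i * of_nat m ^ i)" by blast
    fix f' assume "\<exists>c :: nat \<Rightarrow> rat. \<forall>\<^sub>F m in sequentially. of_nat (min_gens R (ideal_power R I m)) =
        of_int f' * of_nat (hbinom j (Suc m)) + (\<Sum>i<Suc j - 1. c i * of_nat m ^ i)"
    then obtain c' :: "nat \<Rightarrow> rat" where c': "\<forall>\<^sub>F m in sequentially. of_nat (min_gens R (ideal_power R I m)) =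
        of_int f' * of_nat (hbinom j (Suc m)) + (\<Sum>i<j. c' i * of_nat m ^ i)" by auto
    \<comment> \<open>Uniqueness: f_j and any competitor are both j! times the limit of mu(I^m) /
      m^j, the lower powers of m being negligible.\<close>
    have lim1: "(\<lambda>m. real_of_int (int (min_gens R (ideal_power R I m))) / real m ^ j) \<longlonglongrightarrow> real_of_int (f j) / fact j"
      by (rule hbinom_sum_asymp[OF f])
    have "\<forall>\<^sub>F m in sequentially. int (hbinom j (Suc m)) = (\<Sum>i\<le>j. 1 * int (hbinom i m))"
      by (simp add: hbinom_Suc_arg)
    then have "(\<lambda>m. real_of_int (int (hbinom j (Suc m))) / real m ^ j) \<longlonglongrightarrow> real_of_int 1 / fact j"
      by (rule hbinom_sum_asymp)
    then have "(\<lambda>m. f' * (real (hbinom j (Suc m)) / real m ^ j) + (\<Sum>i<j. of_rat (c' i) * inverse (real m) ^ (j - i)))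
        \<longlonglongrightarrow> f' * (1 / fact j) + (\<Sum>i<j. of_rat (c' i) * 0 ^ (j - i))"
      by (intro tendsto_add tendsto_mult tendsto_const tendsto_sum tendsto_power lim_inverse_n) simp
    moreover have "(\<Sum>i<j. of_rat (c' i) * 0 ^ (j - i)) = (0 :: real)" by (intro sum.neutral) (auto simp: power_0_left)
    moreover have "\<forall>\<^sub>F m in sequentially.
        f' * (real (hbinom j (Suc m)) / real m ^ j) + (\<Sum>i<j. of_rat (c' i) * inverse (real m) ^ (j - i))
        = real_of_int (int (min_gens R (ideal_power R I m))) / real m ^ j"
      using c' eventually_gt_at_top[of 0]
    proof eventually_elim
      case (elim m)
      have "real_of_int (int (min_gens R (ideal_power R I m))) = of_rat (of_nat (min_gens R (ideal_power R I m)))"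
        by simp
      also have "\<dots> = f' * real (hbinom j (Suc m)) + (\<Sum>i<j. of_rat (c' i) * real m ^ i)"
        unfolding elim(1) by (simp add: of_rat_add of_rat_mult of_rat_sum of_rat_power)
      finally have eq: "real_of_int (int (min_gens R (ideal_power R I m)))
        = f' * real (hbinom j (Suc m)) + (\<Sum>i<j. of_rat (c' i) * real m ^ i)" .
      have "of_rat (c' i) * inverse (real m) ^ (j - i) = of_rat (c' i) * real m ^ i / real m ^ j" if "i < j" for i
      proof -
        have "real m ^ j = real m ^ i * real m ^ (j - i)" using that by (simp flip: power_add)
        then show ?thesis using elim(2) by (simp add: power_inverse field_simps)
      qed
      then show ?case unfolding eq add_divide_distrib sum_divide_distrib by simp
    qed
    ultimately have lim2: "(\<lambda>m. real_of_int (int (min_gens R (ideal_power R I m))) / real m ^ j) \<longlonglongrightarrow> f' * (1 / fact j)"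
      by (simp add: filterlim_cong)
    show "f' = f j" using LIMSEQ_unique[OF lim1 lim2] by simp
  qed
qed

section \<open>Ideals and colength\<close>

no_notation Sum_Type.Plus (infixr \<open><+>\<close> 65)

context cring
begin

lemma ideal_intro:
  assumes "A \<subseteq> carrier R" "\<zero> \<in> A" "\<And>a b. a \<in> A \<Longrightarrow> b \<in> A \<Longrightarrow> a \<oplus> b \<in> A"
    and mult: "\<And>r a. r \<in> carrier R \<Longrightarrow> a \<in> A \<Longrightarrow> r \<otimes> a \<in> A"
  shows "ideal A R"
proof (rule idealI[OF ring_axioms])
  show "subgroup A (add_monoid R)"
  proof (rule add.subgroupI)
    fix a assume "a \<in> A"
    then have "(\<ominus> \<one>) \<otimes> a \<in> A" "a \<in> carrier R" using mult assms(1) by auto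
    then show "\<ominus> a \<in> A" by (simp add: l_minus)
  qed (use assms in auto)
  show "a \<otimes> x \<in> A" if "a \<in> A" "x \<in> carrier R" for a x
    using mult[OF that(2,1)] assms(1) that m_comm by (metis subsetD)
qed (rule mult)

lemma ideal_closed:
  assumes "ideal A R"
  shows "A \<subseteq> carrier R" "\<zero> \<in> A" "a \<in> A \<Longrightarrow> a \<in> carrier R" "a \<in> A \<Longrightarrow> b \<in> A \<Longrightarrow> a \<oplus> b \<in> A"
    "a \<in> A \<Longrightarrow> b \<in> A \<Longrightarrow> a \<ominus> b \<in> A" "a \<in> A \<Longrightarrow> \<ominus> a \<in> A"
    "r \<in> carrier R \<Longrightarrow> a \<in> A \<Longrightarrow> r \<otimes> a \<in> A" "r \<in> carrier R \<Longrightarrow> a \<in> A \<Longrightarrow> a \<otimes> r \<in> A"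
proof -
  interpret ideal A R by fact
  show "A \<subseteq> carrier R" "\<zero> \<in> A" "a \<in> A \<Longrightarrow> a \<in> carrier R" "a \<in> A \<Longrightarrow> b \<in> A \<Longrightarrow> a \<oplus> b \<in> A"
    "a \<in> A \<Longrightarrow> b \<in> A \<Longrightarrow> a \<ominus> b \<in> A" "a \<in> A \<Longrightarrow> \<ominus> a \<in> A"
    "r \<in> carrier R \<Longrightarrow> a \<in> A \<Longrightarrow> r \<otimes> a \<in> A" "r \<in> carrier R \<Longrightarrow> a \<in> A \<Longrightarrow> a \<otimes> r \<in> A"
    by (auto simp: a_minus_def I_l_closed I_r_closed)
qed

lemma ideal_eq_carrier: "ideal A R \<Longrightarrow> \<one> \<in> A \<Longrightarrow> A = carrier R"
  using ideal.one_imp_carrier by blast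

lemma mem_sum_iff: "z \<in> A <+> B \<longleftrightarrow> (\<exists>a\<in>A. \<exists>b\<in>B. z = a \<oplus> b)"
  by (auto simp: set_add_def')

lemma sum_upper1: "ideal A R \<Longrightarrow> ideal B R \<Longrightarrow> A \<subseteq> A <+> B"
  unfolding subset_iff mem_sum_iff by (metis ideal_closed(2,3) r_zero)

lemma sum_upper2: "ideal A R \<Longrightarrow> ideal B R \<Longrightarrow> B \<subseteq> A <+> B"
  unfolding subset_iff mem_sum_iff by (metis ideal_closed(2,3) l_zero)

lemma sum_least: "ideal C R \<Longrightarrow> A \<subseteq> C \<Longrightarrow> B \<subseteq> C \<Longrightarrow> A <+> B \<subseteq> C"
  unfolding subset_iff mem_sum_iff by (metis ideal_closed(4))

lemma sum_mono: "A \<subseteq> A' \<Longrightarrow> B \<subseteq> B' \<Longrightarrow> A <+> B \<subseteq> A' <+> B'"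
  unfolding subset_iff mem_sum_iff by blast

lemma sum_absorb: "ideal A R \<Longrightarrow> ideal B R \<Longrightarrow> B \<subseteq> A \<Longrightarrow> A <+> B = A"
  by (intro equalityI sum_least sum_upper1) auto

lemma sum_comm: "ideal A R \<Longrightarrow> ideal B R \<Longrightarrow> A <+> B = B <+> A"
  by (intro equalityI sum_least sum_upper1 sum_upper2 add_ideals)

lemma sum_assoc:
  assumes "ideal A R" "ideal B R" "ideal C R"
  shows "(A <+> B) <+> C = A <+> (B <+> C)"
  using assms by (intro add.set_mult_assoc[folded set_add_def]) (auto dest: ideal_closed(1))

lemma PIdl_least: "ideal A R \<Longrightarrow> x \<in> A \<Longrightarrow> PIdl x \<subseteq> A"
  by (rule cgenideal_minimal)

lemma mem_sum_PIdl_iff: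
  "z \<in> A <+> PIdl x \<longleftrightarrow> (\<exists>a\<in>A. \<exists>r\<in>carrier R. z = a \<oplus> r \<otimes> x)"
  unfolding mem_sum_iff cgenideal_def by blast

lemma ideal_sum_PIdl: "ideal A R \<Longrightarrow> x \<in> carrier R \<Longrightarrow> ideal (A <+> PIdl x) R"
  by (intro add_ideals cgenideal_ideal)

lemma sum_PIdl_upper:
  assumes "ideal A R" "x \<in> carrier R"
  shows "A \<subseteq> A <+> PIdl x" "x \<in> A <+> PIdl x"
  using sum_upper1[of A "PIdl x"] sum_upper2[of A "PIdl x"] cgenideal_self[of x] cgenideal_ideal assms
  by auto

lemma sum_PIdl_least: "ideal C R \<Longrightarrow> A \<subseteq> C \<Longrightarrow> x \<in> C \<Longrightarrow> A <+> PIdl x \<subseteq> C"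
  by (intro sum_least PIdl_least)

lemma Idl_insert:
  assumes "S \<subseteq> carrier R" "x \<in> carrier R"
  shows "Idl (insert x S) = Idl S <+> PIdl x"
proof
  have i: "ideal (Idl S) R" "S \<subseteq> Idl S" using assms genideal_ideal genideal_self by auto
  show "Idl (insert x S) \<subseteq> Idl S <+> PIdl x"
    using sum_PIdl_upper[OF i(1) assms(2)] i(2) by (intro genideal_minimal ideal_sum_PIdl i assms) auto
  have "insert x S \<subseteq> Idl (insert x S)" by (rule genideal_self) (use assms in auto)
  moreover have "Idl S \<subseteq> Idl (insert x S)" by (rule subset_Idl_subset) (use assms in auto)
  ultimately have "x \<in> Idl (insert x S)" "Idl S \<subseteq> Idl (insert x S)" by auto
  then show "Idl S <+> PIdl x \<subseteq> Idl (insert x S)"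
    using assms by (intro sum_PIdl_least genideal_ideal) auto
qed

lemma Idl_empty: "Idl {} = {\<zero>}"
proof
  show "Idl {} \<subseteq> {\<zero>}" by (intro genideal_minimal zeroideal) auto
  show "{\<zero>} \<subseteq> Idl {}" using ideal_closed(2)[OF genideal_ideal, of "{}"] by auto
qed

lemma prod_least:
  assumes "ideal C R" "\<And>a b. a \<in> A \<Longrightarrow> b \<in> B \<Longrightarrow> a \<otimes> b \<in> C"
  shows "A \<cdot> B \<subseteq> C"
proof
  fix z assume "z \<in> A \<cdot> B"
  then show "z \<in> C"
    by (induction rule: ideal_prod.induct) (use assms ideal_closed(4)[OF assms(1)] in auto)
qed

lemma prod_mono: "A \<subseteq> A' \<Longrightarrow> B \<subseteq> B' \<Longrightarrow> A \<cdot> B \<subseteq> A' \<cdot> B'"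
proof
  fix z assume *: "A \<subseteq> A'" "B \<subseteq> B'" "z \<in> A \<cdot> B"
  from *(3) show "z \<in> A' \<cdot> B'"
    by (induction rule: ideal_prod.induct) (use *(1,2) in \<open>auto intro: ideal_prod.intros\<close>)
qed

lemma prod_subset1: "ideal A R \<Longrightarrow> ideal B R \<Longrightarrow> A \<cdot> B \<subseteq> A"
  using ideal_prod_inter by blast

lemma prod_subset2: "ideal A R \<Longrightarrow> ideal B R \<Longrightarrow> A \<cdot> B \<subseteq> B"
  using ideal_prod_inter by blast

lemma mem_prod_PIdl:
  assumes M: "ideal M R" and x: "x \<in> carrier R" and z: "z \<in> M \<cdot> (PIdl x)"
  shows "\<exists>r\<in>M. z = r \<otimes> x"
  using z
proof (induction rule: ideal_prod.induct)
  case (prod i j)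
  then obtain s where s: "s \<in> carrier R" "j = s \<otimes> x" unfolding cgenideal_def by blast
  have "i \<otimes> j = (i \<otimes> s) \<otimes> x" using s x ideal_closed(3)[OF M prod(1)] by (simp add: m_assoc)
  then show ?case using ideal_closed(8)[OF M s(1) prod(1)] by blast
next
  case (sum p q)
  then obtain r s where rs: "r \<in> M" "p = r \<otimes> x" "s \<in> M" "q = s \<otimes> x" by blast
  then have "p \<oplus> q = (r \<oplus> s) \<otimes> x" using x ideal_closed(3)[OF M] by (simp add: l_distr)
  then show ?case using ideal_closed(4)[OF M rs(1,3)] by blast
qed

definition colon :: "'a set \<Rightarrow> 'a \<Rightarrow> 'a set" where
  "colon A x = {r \<in> carrier R. r \<otimes> x \<in> A}"

lemma ideal_colon:
  assumes "ideal A R" "x \<in> carrier R"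
  shows "ideal (colon A x) R"
proof (rule ideal_intro)
  show "a \<oplus> b \<in> colon A x" if "a \<in> colon A x" "b \<in> colon A x" for a b
    using that assms ideal_closed(4)[OF assms(1)] by (auto simp: colon_def l_distr)
  show "r \<otimes> a \<in> colon A x" if "r \<in> carrier R" "a \<in> colon A x" for a r
    using that assms ideal_closed(7)[OF assms(1)] by (auto simp: colon_def m_assoc)
qed (use assms ideal_closed(2) in \<open>auto simp: colon_def\<close>)

text \<open>Covers both kinds of ideals needed for general elements: those cut out by several
  multipliers, and the elements that a whole power of I carries into B.\<close>

lemma ideal_multipliers:
  assumes A: "ideal A R" and B: "ideal B R" and P: "P \<subseteq> carrier R"
  shows "ideal {z \<in> A. \<forall>p\<in>P. p \<otimes> z \<in> B} R"
proof (rule ideal_intro)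
  note cl = ideal_closed(3)[OF A] subsetD[OF P]
  show "{z \<in> A. \<forall>p\<in>P. p \<otimes> z \<in> B} \<subseteq> carrier R" using cl by blast
  show "\<zero> \<in> {z \<in> A. \<forall>p\<in>P. p \<otimes> z \<in> B}"
    using cl ideal_closed(2)[OF A] ideal_closed(2)[OF B] by simp
  show "a \<oplus> b \<in> {z \<in> A. \<forall>p\<in>P. p \<otimes> z \<in> B}"
    if "a \<in> {z \<in> A. \<forall>p\<in>P. p \<otimes> z \<in> B}" "b \<in> {z \<in> A. \<forall>p\<in>P. p \<otimes> z \<in> B}" for a b
    using that cl ideal_closed(4)[OF A] ideal_closed(4)[OF B] by (simp add: r_distr)
  show "r \<otimes> a \<in> {z \<in> A. \<forall>p\<in>P. p \<otimes> z \<in> B}"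
    if "r \<in> carrier R" and a: "a \<in> {z \<in> A. \<forall>p\<in>P. p \<otimes> z \<in> B}" for r a
  proof -
    have "p \<otimes> (r \<otimes> a) = r \<otimes> (p \<otimes> a)" if "p \<in> P" for p
      using m_lcomm[of p r a] that \<open>r \<in> carrier R\<close> a cl by blast
    then show ?thesis using a ideal_closed(7)[OF A \<open>r \<in> carrier R\<close>] ideal_closed(7)[OF B \<open>r \<in> carrier R\<close>] by simp
  qed
qed

lemma colon_upper: "ideal A R \<Longrightarrow> x \<in> carrier R \<Longrightarrow> A \<subseteq> colon A x"
  using ideal_closed by (auto simp: colon_def)

lemma colon_mono: "A \<subseteq> B \<Longrightarrow> colon A x \<subseteq> colon B x"
  by (auto simp: colon_def)

lemma colon_eq_carrier_iff: "ideal A R \<Longrightarrow> x \<in> carrier R \<Longrightarrow> colon A x = carrier R \<longleftrightarrow> x \<in> A"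
proof
  assume a: "ideal A R" "x \<in> carrier R" "colon A x = carrier R"
  then have "\<one> \<in> colon A x" by simp
  then show "x \<in> A" using a by (simp add: colon_def)
qed (auto simp: colon_def ideal_closed)

text \<open>By the correspondence theorem this is the length of R/A; with chains of ideals of R,
  later computations need no quotient modules.\<close>

definition ideal_chain_length :: "'a set \<Rightarrow> enat" where
  "ideal_chain_length A = Sup {enat n | n. \<exists>N :: nat \<Rightarrow> 'a set.
     (\<forall>i\<le>n. ideal (N i) R \<and> A \<subseteq> N i) \<and> (\<forall>i<n. N i \<subset> N (Suc i))}"

text \<open>Image and preimage under R \<rightarrow> R/A translate chains into chains. Images stay
  strict because the ideals contain A, preimages because the projection is surjective.\<close>

lemma module_length_quot_module:
  assumes A: "ideal A R"
  shows "module_length R (quot_module R A) = ideal_chain_length A"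
proof -
  interpret A: ideal A R by fact
  interpret h: ring_hom_ring R "R Quot A" "(+>) A" by (rule A.rcos_ring_hom_ring)
  define Q where "Q = quot_module R A"
  have Q: "carrier Q = carrier (R Quot A)" "add Q = add (R Quot A)" "zero Q = zero (R Quot A)"
    "smult Q = (\<lambda>r X. (A +> r) \<otimes>\<^bsub>R Quot A\<^esub> X)"
    by (simp_all add: Q_def quot_module_def)
  have carr: "carrier (R Quot A) = (+>) A ` carrier R"
    unfolding FactRing_def A_RCOSETS_def' partial_object.simps by blast
  have inv: "inv\<^bsub>add_monoid Q\<^esub> (A +> r) = A +> (\<ominus> r)" if "r \<in> carrier R" for r
  proof -
    have "inv\<^bsub>add_monoid Q\<^esub> (A +> r) = \<ominus>\<^bsub>R Quot A\<^esub> (A +> r)"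
      by (simp add: a_inv_def m_inv_def Q)
    then show ?thesis using h.hom_a_inv[OF that] by simp
  qed
  have eq: "A +> r = A +> s \<longleftrightarrow> r \<ominus> s \<in> A" if "r \<in> carrier R" "s \<in> carrier R" for r s
    using quotient_eq_iff_same_a_r_cos[OF A] that by blast
  have im: "submodule ((+>) A ` N) R Q" if N: "ideal N R" for N
  proof (intro submodule.intro subgroup.intro submodule_axioms.intro)
    show "(+>) A ` N \<subseteq> carrier (add_monoid Q)"
      using ideal_closed(1)[OF N] by (auto simp: Q carr)
    show "\<one>\<^bsub>add_monoid Q\<^esub> \<in> (+>) A ` N"
    proof -
      have "\<one>\<^bsub>add_monoid Q\<^esub> = A +> \<zero>" by (simp only: monoid.simps Q(3) h.hom_zero)
      then show ?thesis using ideal_closed(2)[OF N] by blast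
    qed
    show "x \<otimes>\<^bsub>add_monoid Q\<^esub> y \<in> (+>) A ` N" if "x \<in> (+>) A ` N" "y \<in> (+>) A ` N" for x y
      using that ideal_closed[OF N] by (auto simp: Q simp flip: h.hom_add)
    show "inv\<^bsub>add_monoid Q\<^esub> x \<in> (+>) A ` N" if "x \<in> (+>) A ` N" for x
    proof -
      obtain r where r: "r \<in> N" "x = A +> r" using \<open>x \<in> (+>) A ` N\<close> by blast
      then have "inv\<^bsub>add_monoid Q\<^esub> x = A +> (\<ominus> r)" using inv ideal_closed(3)[OF N] by blast
      then show ?thesis using ideal_closed(6)[OF N r(1)] by blast
    qed
    show "a \<odot>\<^bsub>Q\<^esub> x \<in> (+>) A ` N" if "a \<in> carrier R" "x \<in> (+>) A ` N" for a x
      using that ideal_closed[OF N] by (auto simp: Q simp flip: h.hom_mult)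
  qed
  have pre: "ideal {r \<in> carrier R. A +> r \<in> N} R" if N: "submodule N R Q" for N
  proof (rule ideal_intro)
    interpret N: submodule N R Q by fact
    show "\<zero> \<in> {r \<in> carrier R. A +> r \<in> N}"
      using N.one_closed h.hom_zero by (simp add: Q)
    show "a \<oplus> b \<in> {r \<in> carrier R. A +> r \<in> N}"
      if "a \<in> {r \<in> carrier R. A +> r \<in> N}" "b \<in> {r \<in> carrier R. A +> r \<in> N}" for a b
      using that N.m_closed[of "A +> a" "A +> b"] by (simp add: Q)
    show "r \<otimes> a \<in> {r \<in> carrier R. A +> r \<in> N}"
      if "r \<in> carrier R" "a \<in> {r \<in> carrier R. A +> r \<in> N}" for r a
      using that N.smult_closed[of r "A +> a"] by (simp add: Q)
  qed auto
  have im_strict: "(+>) A ` N \<subset> (+>) A ` N'" if N: "ideal N R" "A \<subseteq> N" "ideal N' R" "N \<subset> N'" for N N'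
  proof -
    obtain z where z: "z \<in> N'" "z \<notin> N" using N(4) by blast
    have "A +> z \<noteq> A +> w" if "w \<in> N" for w
    proof
      assume "A +> z = A +> w"
      then have "z \<ominus> w \<in> N" using eq ideal_closed(3) N z that by blast
      then have "(z \<ominus> w) \<oplus> w \<in> N" using ideal_closed(4)[OF N(1)] that by blast
      moreover have "(z \<ominus> w) \<oplus> w = z"
        using ideal_closed(3)[OF N(1) that] ideal_closed(3)[OF N(3) z(1)]
        by (simp add: a_minus_def a_assoc l_neg)
      ultimately show False using z by simp
    qed
    then show ?thesis using N(4) z(1) by blast
  qed
  have pre_strict: "{r \<in> carrier R. A +> r \<in> N} \<subset> {r \<in> carrier R. A +> r \<in> N'}"
    if "submodule N R Q" "submodule N' R Q" "N \<subset> N'" for N N'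
  proof -
    have "N' \<subseteq> (+>) A ` carrier R"
      using submodule.axioms(1)[OF that(2)] subgroup.subset by (fastforce simp: Q carr)
    then show ?thesis using that(3) by blast
  qed
  have preA: "A \<subseteq> {r \<in> carrier R. A +> r \<in> N}" if N: "submodule N R Q" for N
  proof
    interpret N: submodule N R Q by fact
    fix r assume r: "r \<in> A"
    then have "A +> r = A" using a_rcos_zero[OF A] by simp
    moreover have "zero Q = A" unfolding Q(3) FactRing_def by (simp only: ring.simps)
    then have "A \<in> N" using N.one_closed by (simp only: monoid.simps)
    ultimately show "r \<in> {r \<in> carrier R. A +> r \<in> N}" using r ideal_closed(3)[OF A] by simp
  qed
  have "(\<exists>N. (\<forall>i\<le>n. submodule (N i) R Q) \<and> (\<forall>i<n. N i \<subset> N (Suc i))) \<longleftrightarrow>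
      (\<exists>N. (\<forall>i\<le>n. ideal (N i) R \<and> A \<subseteq> N i) \<and> (\<forall>i<n. N i \<subset> N (Suc i)))" (is "?l \<longleftrightarrow> ?r") for n :: nat
  proof
    assume ?l
    then obtain N where N: "\<forall>i\<le>n. submodule (N i) R Q" "\<forall>i<n. N i \<subset> N (Suc i)" by blast
    show ?r
    proof (intro exI[of _ "\<lambda>i. {r \<in> carrier R. A +> r \<in> N i}"] conjI allI impI)
      show "ideal {r \<in> carrier R. A +> r \<in> N i} R" "A \<subseteq> {r \<in> carrier R. A +> r \<in> N i}"
        if "i \<le> n" for i using N(1) that pre preA by blast+
      show "{r \<in> carrier R. A +> r \<in> N i} \<subset> {r \<in> carrier R. A +> r \<in> N (Suc i)}" if "i < n" for i
        using N(1)[rule_format, of i] N(1)[rule_format, of "Suc i"] N(2) that by (intro pre_strict) simp_all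
    qed
  next
    assume ?r
    then obtain N where N: "\<forall>i\<le>n. ideal (N i) R \<and> A \<subseteq> N i" "\<forall>i<n. N i \<subset> N (Suc i)" by blast
    show ?l
    proof (intro exI[of _ "\<lambda>i. (+>) A ` N i"] conjI allI impI)
      show "submodule ((+>) A ` N i) R Q" if "i \<le> n" for i using N(1) that im by blast
      show "(+>) A ` N i \<subset> (+>) A ` N (Suc i)" if "i < n" for i
        using N(1)[rule_format, of i] N(1)[rule_format, of "Suc i"] N(2) that by (intro im_strict) simp_all
    qed
  qed
  then show ?thesis
    unfolding module_length_def ideal_chain_length_def Q_def[symmetric] by simp
qed

text \<open>\<open>colength\<close> extracts a number from an extended natural and is meaningful
  only for finite length, so finiteness is carried along.\<close>

definition finite_colength :: "'a set \<Rightarrow> bool" where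
  "finite_colength A \<longleftrightarrow> ideal A R \<and> ideal_chain_length A \<noteq> \<infinity>"

lemma finite_colength_ideal: "finite_colength A \<Longrightarrow> ideal A R"
  by (simp add: finite_colength_def)

lemma enat_colength: "finite_colength A \<Longrightarrow> enat (colength R A) = ideal_chain_length A"
  unfolding finite_colength_def colength_def by (auto simp: module_length_quot_module)

text \<open>A natural number that drops along every strict inclusion above A bounds the chains above
  A by its value at A. With the claimed length as \<open>f\<close>, this yields upper bounds without
  composition series.\<close>

lemma colength_le:
  fixes f :: "'a set \<Rightarrow> nat"
  assumes "ideal A R"
    and f: "\<And>N N'. ideal N R \<Longrightarrow> ideal N' R \<Longrightarrow> A \<subseteq> N \<Longrightarrow> N \<subset> N' \<Longrightarrow> f N' < f N"
  shows "finite_colength A" "colength R A \<le> f A"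
proof -
  have "n \<le> f A" if N: "\<forall>i\<le>n. ideal (N i) R \<and> A \<subseteq> N i" "\<forall>i<n. N i \<subset> N (Suc i)" for n N
  proof -
    have "i \<le> n \<Longrightarrow> f (N i) + i \<le> f (N 0)" for i
    proof (induction i)
      case (Suc i)
      then have "f (N (Suc i)) < f (N i)"
        using N by (intro f) (auto dest: spec[of _ i] spec[of _ "Suc i"])
      then show ?case using Suc by simp
    qed simp
    from this[of n] have "f (N n) + n \<le> f (N 0)" by simp
    moreover have "f (N 0) \<le> f A"
    proof (cases "A = N 0")
      case False
      then have "f (N 0) < f A" using N(1) assms(1) by (intro f) auto
      then show ?thesis by simp
    qed simp
    ultimately show ?thesis by simp
  qed
  then have le: "ideal_chain_length A \<le> enat (f A)"
    unfolding ideal_chain_length_def by (intro Sup_least) auto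
  then show fin: "finite_colength A"
    using assms(1) unfolding finite_colength_def by (cases "ideal_chain_length A") auto
  have "enat (colength R A) \<le> enat (f A)" using le unfolding enat_colength[OF fin] .
  then show "colength R A \<le> f A" by simp
qed

lemma ideal_chain_length_psubset:
  assumes "ideal A R" "ideal B R" "A \<subset> B"
  shows "eSuc (ideal_chain_length B) \<le> ideal_chain_length A"
proof -
  have *: "eSuc x \<le> ideal_chain_length A" if "x \<in> {enat n | n. \<exists>N :: nat \<Rightarrow> 'a set.
     (\<forall>i\<le>n. ideal (N i) R \<and> B \<subseteq> N i) \<and> (\<forall>i<n. N i \<subset> N (Suc i))}" for x
  proof -
    obtain n N where N: "x = enat n" "\<forall>i\<le>n. ideal (N i) R \<and> B \<subseteq> N i" "\<forall>i<n. N i \<subset> N (Suc i)"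
      using \<open>x \<in> _\<close> by blast
    define M where "M i = (case i of 0 \<Rightarrow> A | Suc j \<Rightarrow> N j)" for i :: nat
    have "ideal (M i) R \<and> A \<subseteq> M i" if "i \<le> Suc n" for i
      using N(2) assms that by (cases i) (simp_all add: M_def subset_trans[OF psubset_imp_subset])
    moreover have "M i \<subset> M (Suc i)" if "i < Suc n" for i
    proof (cases i)
      case 0
      then show ?thesis using N(2) assms(3) unfolding M_def by fastforce
    next
      case (Suc j)
      then show ?thesis using N(3) that by (simp add: M_def)
    qed
    ultimately have "enat (Suc n) \<le> ideal_chain_length A"
      unfolding ideal_chain_length_def by (intro Sup_upper) blast
    then show ?thesis by (simp add: N(1) eSuc_enat)
  qed
  show ?thesis
  proof (cases "ideal_chain_length A")
    case (enat k)
    have "enat 0 \<in> {enat n | n. \<exists>N :: nat \<Rightarrow> 'a set.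
       (\<forall>i\<le>n. ideal (N i) R \<and> B \<subseteq> N i) \<and> (\<forall>i<n. N i \<subset> N (Suc i))}"
      using assms(2) by (intro CollectI exI[of _ 0]) auto
    from *[OF this] have "eSuc (enat 0) \<le> enat k" using enat by simp
    then obtain k' where k': "k = Suc k'" by (cases k) (auto simp: eSuc_enat)
    have "ideal_chain_length B \<le> enat k'"
      unfolding ideal_chain_length_def
    proof (rule Sup_least)
      fix x assume "x \<in> {enat n | n. \<exists>N :: nat \<Rightarrow> 'a set.
         (\<forall>i\<le>n. ideal (N i) R \<and> B \<subseteq> N i) \<and> (\<forall>i<n. N i \<subset> N (Suc i))}"
      from *[OF this] have "eSuc x \<le> eSuc (enat k')" using enat k' by (simp add: eSuc_enat)
      then show "x \<le> enat k'" by simp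
    qed
    then have "eSuc (ideal_chain_length B) \<le> eSuc (enat k')" by simp
    then show ?thesis using enat k' by (simp add: eSuc_enat)
  qed simp
qed

lemma finite_colength_mono:
  assumes "finite_colength A" "ideal B R" "A \<subseteq> B"
  shows "finite_colength B" and "colength R B \<le> colength R A"
proof -
  have "finite_colength B \<and> colength R B \<le> colength R A"
  proof (cases "A = B")
    case False
    then have le: "eSuc (ideal_chain_length B) \<le> ideal_chain_length A"
      using assms ideal_chain_length_psubset[of A B] finite_colength_ideal by blast
    then have "ideal_chain_length B \<le> ideal_chain_length A"
      using ile_eSuc order_trans by blast
    moreover from le have fin: "finite_colength B"
      using assms unfolding finite_colength_def by (cases "ideal_chain_length B") auto
    ultimately show ?thesis using enat_colength[OF fin] enat_colength[OF assms(1)] by (metis enat_ord_simps(1))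
  qed (use assms in auto)
  then show "finite_colength B" "colength R B \<le> colength R A" by auto
qed

lemma colength_psubset:
  assumes "finite_colength A" "ideal B R" "A \<subset> B"
  shows "colength R B < colength R A"
proof -
  have "finite_colength B" using finite_colength_mono assms by blast
  then show ?thesis
    using ideal_chain_length_psubset[of A B] assms enat_colength finite_colength_ideal
    by (metis Suc_le_eq eSuc_enat enat_ord_simps(1))
qed

lemma colength_carrier: "finite_colength (carrier R)" "colength R (carrier R) = 0"
proof -
  have False if "ideal N R" "ideal N' R" "carrier R \<subseteq> N" "N \<subset> N'" for N N'
    using ideal_closed(1)[OF that(2)] that(3,4) by blast
  then have "finite_colength (carrier R) \<and> colength R (carrier R) \<le> 0"
    using colength_le[OF oneideal, of "\<lambda>_. 0"] by blast
  then show "finite_colength (carrier R)" "colength R (carrier R) = 0" by auto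
qed

text \<open>The exact sequence \<open>0 \<rightarrow> R/(A : x) \<rightarrow> R/A \<rightarrow> R/(A + x) \<rightarrow> 0\<close>.\<close>

lemma colength_sum_PIdl:
  assumes A: "ideal A R" and x: "x \<in> carrier R"
    and fin: "finite_colength (A <+> PIdl x)" "finite_colength (colon A x)"
  shows "finite_colength A" "colength R A = colength R (A <+> PIdl x) + colength R (colon A x)"
proof -
  \<comment> \<open>The claimed value, used as a rank function. It drops strictly because N
    \<subset> N' cannot have both the same sum with (x) and the same colon by x.\<close>
  define f where "f N = colength R (N <+> PIdl x) + colength R (colon N x)" for N
  have fl: "finite_colength (N <+> PIdl x)" "finite_colength (colon N x)" if "ideal N R" "A \<subseteq> N" for N
    using finite_colength_mono(1)[OF fin(1)] finite_colength_mono(1)[OF fin(2)] sum_mono[OF that(2)]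
      colon_mono[OF that(2)] ideal_sum_PIdl ideal_colon that(1) x by auto
  have dec: "f N' < f N" if N: "ideal N R" "ideal N' R" "A \<subseteq> N" "N \<subset> N'" for N N'
  proof -
    have i: "ideal (N' <+> PIdl x) R" "ideal (colon N' x) R"
      using ideal_sum_PIdl ideal_colon N x by auto
    have sub: "N <+> PIdl x \<subseteq> N' <+> PIdl x" "colon N x \<subseteq> colon N' x"
      using N sum_mono colon_mono by auto
    have "N <+> PIdl x \<noteq> N' <+> PIdl x \<or> colon N x \<noteq> colon N' x"
    proof (rule ccontr)
      assume "\<not> ?thesis"
      then have eq: "N <+> PIdl x = N' <+> PIdl x" "colon N x = colon N' x" by auto
      obtain z where z: "z \<in> N'" "z \<notin> N" using N by blast
      then have "z \<in> N <+> PIdl x" using eq(1) sum_PIdl_upper(1)[OF N(2) x] by blast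
      then obtain w r where w: "w \<in> N" "r \<in> carrier R" "z = w \<oplus> r \<otimes> x"
        unfolding mem_sum_PIdl_iff by blast
      have c: "w \<in> carrier R" "z \<in> carrier R" using ideal_closed(3) N w z by auto
      have "r \<otimes> x = z \<ominus> w" using w c x by (simp add: a_minus_def a_comm[of w] a_assoc r_neg)
      moreover have "w \<in> N'" using w(1) N(4) by blast
      ultimately have "r \<otimes> x \<in> N'" using ideal_closed(5)[OF N(2) z(1)] by simp
      then have "r \<in> colon N x" using eq(2) w by (simp add: colon_def)
      then have "z \<in> N" using w ideal_closed(4)[OF N(1)] by (simp add: colon_def)
      then show False using z by simp
    qed
    then show ?thesis
    proof
      assume "N <+> PIdl x \<noteq> N' <+> PIdl x"
      then have "colength R (N' <+> PIdl x) < colength R (N <+> PIdl x)"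
        using colength_psubset[OF fl(1)[OF N(1,3)] i(1)] sub(1) by blast
      moreover have "colength R (colon N' x) \<le> colength R (colon N x)"
        by (rule finite_colength_mono(2)[OF fl(2)[OF N(1,3)] i(2) sub(2)])
      ultimately show ?thesis unfolding f_def by simp
    next
      assume "colon N x \<noteq> colon N' x"
      then have "colength R (colon N' x) < colength R (colon N x)"
        using colength_psubset[OF fl(2)[OF N(1,3)] i(2)] sub(2) by blast
      moreover have "colength R (N' <+> PIdl x) \<le> colength R (N <+> PIdl x)"
        by (rule finite_colength_mono(2)[OF fl(1)[OF N(1,3)] i(1) sub(1)])
      ultimately show ?thesis unfolding f_def by simp
    qed
  qed
  show finA: "finite_colength A" by (rule colength_le(1)[OF A, where f = f]) (rule dec)
  have le: "colength R A \<le> f A" by (rule colength_le(2)[OF A, where f = f]) (rule dec)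
  \<comment> \<open>For the reverse inequality, M \<mapsto> A + M x carries ideals above A : x to
    ideals between A and A + (x), and does so strictly: s x = a + r x puts s - r into A : x.\<close>
  define E where "E M = A <+> (M \<cdot> (PIdl x))" for M
  have X: "ideal (PIdl x) R" by (rule cgenideal_ideal[OF x])
  have E: "ideal (E M) R" "A \<subseteq> E M" "E M \<subseteq> A <+> PIdl x" if M: "ideal M R" for M
    unfolding E_def
    by (rule add_ideals[OF A ideal_prod_is_ideal[OF M X]], rule sum_upper1[OF A ideal_prod_is_ideal[OF M X]],
      rule sum_mono[OF order_refl prod_subset2[OF M X]])
  define g where "g M = colength R (E M) - colength R (A <+> PIdl x)" for M
  have "colength R (colon A x) \<le> g (colon A x)"
  proof (rule colength_le(2)[OF ideal_colon[OF A x]])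
    fix M M' assume M: "ideal M R" "ideal M' R" "colon A x \<subseteq> M" "M \<subset> M'"
    obtain s where s: "s \<in> M'" "s \<notin> M" using M by blast
    have sc: "s \<in> carrier R" using s M ideal_closed(3) by blast
    have "s \<otimes> x \<in> M' \<cdot> (PIdl x)" by (rule ideal_prod.prod[OF s(1) cgenideal_self[OF x]])
    then have "s \<otimes> x \<in> E M'" unfolding E_def using sum_upper2[OF A ideal_prod_is_ideal[OF M(2) X]] by blast
    moreover have "s \<otimes> x \<notin> E M"
    proof
      assume "s \<otimes> x \<in> E M"
      then obtain a r where *: "s \<otimes> x = a \<oplus> r \<otimes> x" "a \<in> A" "r \<in> M"
        unfolding E_def mem_sum_iff using mem_prod_PIdl[OF M(1) x] by metis
      have c: "a \<in> carrier R" "r \<in> carrier R" using * ideal_closed(3) A M by auto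
      have "(s \<ominus> r) \<otimes> x = s \<otimes> x \<ominus> r \<otimes> x" using c x sc by algebra
      also have "\<dots> = a" using *(1) c x by (simp add: a_minus_def a_assoc r_neg)
      finally have "s \<ominus> r \<in> M" using * c sc M(3) by (auto simp: colon_def)
      then have "(s \<ominus> r) \<oplus> r \<in> M" using * ideal_closed(4) M by blast
      moreover have "(s \<ominus> r) \<oplus> r = s" using c sc by (simp add: a_minus_def a_assoc l_neg)
      ultimately show False using s by simp
    qed
    moreover have "E M \<subseteq> E M'" unfolding E_def using M(4) by (intro sum_mono prod_mono) auto
    ultimately have "E M \<subset> E M'" by blast
    then have "colength R (E M') < colength R (E M)"
      using colength_psubset[OF finite_colength_mono(1)[OF finA E(1,2)] E(1)] M by blast
    moreover have "colength R (A <+> PIdl x) \<le> colength R (E M')"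
      using finite_colength_mono(2)[OF finite_colength_mono(1)[OF finA E(1,2)] _ E(3)] M ideal_sum_PIdl A x by blast
    ultimately show "g M' < g M" unfolding g_def by simp
  qed
  moreover have "E (colon A x) \<subseteq> A"
    unfolding E_def
  proof (intro sum_least[OF A order_refl] prod_least[OF A])
    fix a b assume "a \<in> colon A x" "b \<in> PIdl x"
    then obtain s where s: "s \<in> carrier R" "b = s \<otimes> x" "a \<in> carrier R" "a \<otimes> x \<in> A"
      unfolding cgenideal_def colon_def by blast
    have "a \<otimes> b = s \<otimes> (a \<otimes> x)" using s x by (simp add: m_lcomm)
    then show "a \<otimes> b \<in> A" using ideal_closed(7)[OF A s(1,4)] by simp
  qed
  then have "E (colon A x) = A" using E(2)[OF ideal_colon[OF A x]] by blast
  moreover have "colength R (A <+> PIdl x) \<le> colength R A"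
    using finite_colength_mono(2)[OF finA] ideal_sum_PIdl sum_PIdl_upper A x by blast
  ultimately show "colength R A = colength R (A <+> PIdl x) + colength R (colon A x)"
    using le unfolding g_def f_def by simp
qed

text \<open>R/(A \<inter> B) embeds into R/A \<times> R/B. The rank function sees N through N
  \<inter> B modulo A and through its image modulo B; at A \<inter> B its value is l(R/A) +
  l(R/B).\<close>

lemma colength_inter_le:
  assumes "finite_colength A" "finite_colength B"
  shows "finite_colength (A \<inter> B)" "colength R (A \<inter> B) \<le> colength R A + colength R B"
proof -
  have A: "ideal A R" and B: "ideal B R" using assms finite_colength_ideal by auto
  have AB: "ideal (A \<inter> B) R" using i_intersect A B by blast
  define f where "f N = colength R ((N \<inter> B) <+> A) + colength R (N <+> B)" for N
  have dec: "f N' < f N" if N: "ideal N R" "ideal N' R" "A \<inter> B \<subseteq> N" "N \<subset> N'" for N N'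
  proof -
    have i: "ideal ((N \<inter> B) <+> A) R" "ideal ((N' \<inter> B) <+> A) R" "ideal (N <+> B) R" "ideal (N' <+> B) R"
      using add_ideals i_intersect N A B by auto
    have fl: "finite_colength ((N \<inter> B) <+> A)" "finite_colength (N <+> B)"
      using finite_colength_mono(1)[OF assms(1) i(1)] finite_colength_mono(1)[OF assms(2) i(3)]
        sum_upper2 i_intersect N A B by auto
    have sub: "(N \<inter> B) <+> A \<subseteq> (N' \<inter> B) <+> A" "N <+> B \<subseteq> N' <+> B"
      using N(4) by (intro sum_mono; blast)+
    have "(N \<inter> B) <+> A \<noteq> (N' \<inter> B) <+> A \<or> N <+> B \<noteq> N' <+> B"
    proof (rule ccontr)
      assume "\<not> ?thesis"
      then have eq: "(N \<inter> B) <+> A = (N' \<inter> B) <+> A" "N <+> B = N' <+> B" by auto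
      obtain z where z: "z \<in> N'" "z \<notin> N" using N by blast
      then have "z \<in> N <+> B" using eq(2) sum_upper1[OF N(2) B] by blast
      then obtain w b where w: "w \<in> N" "b \<in> B" "z = w \<oplus> b" unfolding mem_sum_iff by blast
      have c: "w \<in> carrier R" "b \<in> carrier R" using w ideal_closed(3) N B by auto
      have "b = z \<ominus> w" using w c by (simp add: a_minus_def a_comm[of w] a_assoc r_neg)
      moreover have "w \<in> N'" using w(1) N(4) by blast
      ultimately have "b \<in> N'" using ideal_closed(5)[OF N(2) z(1)] by simp
      then have "b \<in> (N \<inter> B) <+> A"
        using eq(1) w sum_upper1[OF i_intersect[OF N(2) B] A] by blast
      then obtain v a where v: "v \<in> N" "v \<in> B" "a \<in> A" "b = v \<oplus> a" unfolding mem_sum_iff by blast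
      have c': "v \<in> carrier R" "a \<in> carrier R" using v ideal_closed(3) N A by auto
      have "a = b \<ominus> v" using v c' by (simp add: a_minus_def a_comm[of v] a_assoc r_neg)
      then have "a \<in> B" using ideal_closed(5)[OF B w(2) v(2)] by simp
      then have "a \<in> N" using v(3) N(3) by blast
      then have "z \<in> N" using w v ideal_closed(4)[OF N(1)] by simp
      then show False using z by simp
    qed
    then show ?thesis
      unfolding f_def
      using sub colength_psubset[OF fl(1) i(2)] colength_psubset[OF fl(2) i(4)]
        finite_colength_mono(2)[OF fl(1) i(2)] finite_colength_mono(2)[OF fl(2) i(4)]
      by (metis add_le_less_mono add_less_le_mono psubsetI)
  qed
  have "f (A \<inter> B) = colength R A + colength R B"
    unfolding f_def using sum_comm sum_absorb A B AB by (metis Int_lower1 Int_lower2 inf.left_idem inf_commute)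
  then show "finite_colength (A \<inter> B)" "colength R (A \<inter> B) \<le> colength R A + colength R B"
    using colength_le[OF AB, of f] dec by auto
qed

end

section \<open>Noetherian local rings\<close>

context noetherian_ring
begin

lemma ideal_chain_stabilizes:
  assumes "\<And>i::nat. ideal (A i) R" "\<And>i. A i \<subseteq> A (Suc i)"
  shows "\<exists>k. \<forall>j\<ge>k. A j = A k"
proof -
  have mono: "A i \<subseteq> A j" if "i \<le> j" for i j
    using that assms(2) by (rule lift_Suc_mono_le[rotated])
  have "subset.chain {I. ideal I R} (range A)"
    unfolding subset_chain_def
  proof (intro conjI ballI)
    fix X Y assume "X \<in> range A" "Y \<in> range A"
    then obtain i j where "X = A i" "Y = A j" by blast
    then show "X \<subseteq> Y \<or> Y \<subseteq> X" using mono[of i j] mono[of j i] nle_le[of i j] by blast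
  qed (use assms(1) in blast)
  then have "\<Union>(range A) \<in> range A" by (intro ideal_chain_is_trivial) auto
  then obtain k where "\<Union>(range A) = A k" by auto
  then have "A j \<subseteq> A k" for j by blast
  then show ?thesis using mono by (intro exI[of _ k]) blast
qed

text \<open>Larger ideals count as smaller, so induction starts at the top and minimal elements are
  the maximal members of a family.\<close>

lemma wf_ideals: "wf {(B, A). ideal A R \<and> ideal B R \<and> A \<subset> B}"
  unfolding wf_iff_no_infinite_down_chain
proof
  assume "\<exists>f. \<forall>i. (f (Suc i), f i) \<in> {(B, A). ideal A R \<and> ideal B R \<and> A \<subset> B}"
  then obtain f where "\<And>i::nat. ideal (f i) R" "\<And>i. f i \<subset> f (Suc i)" by blast
  then show False using ideal_chain_stabilizes[of f] by (metis le_SucI order_refl psubsetE psubset_imp_subset)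
qed

lemma maximal_ideal_exists:
  assumes "ideal A R" "P A"
  obtains M where "ideal M R" "P M" "A \<subseteq> M" "\<And>B. ideal B R \<Longrightarrow> P B \<Longrightarrow> M \<subseteq> B \<Longrightarrow> B = M"
proof -
  define Q where "Q = {B. ideal B R \<and> P B \<and> A \<subseteq> B}"
  have "A \<in> Q" using assms unfolding Q_def by simp
  then obtain M where M: "M \<in> Q" "\<And>B. (B, M) \<in> {(B, A). ideal A R \<and> ideal B R \<and> A \<subset> B} \<Longrightarrow> B \<notin> Q"
    using wfE_min[OF wf_ideals, of A Q] by blast
  show ?thesis
  proof (rule that)
    fix B assume B: "ideal B R" "P B" "M \<subseteq> B"
    then have "B \<in> Q" using M(1) unfolding Q_def by auto
    then have "(B, M) \<notin> {(B, A). ideal A R \<and> ideal B R \<and> A \<subset> B}" using M(2) by blast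
    then show "B = M" using B M(1) unfolding Q_def by auto
  qed (use M(1) in \<open>auto simp: Q_def\<close>)
qed

end

context noetherian_local_ring
begin

lemma \<mm>_ideal: "ideal \<mm> R"
  using is_maximalideal maximalideal.axioms(1) by blast

lemma one_notin_\<mm>: "\<one> \<notin> \<mm>"
  using I_notcarr ideal_eq_carrier[OF \<mm>_ideal] by auto

lemma proper_ideal_subset:
  assumes "ideal A R" "A \<noteq> carrier R"
  shows "A \<subseteq> \<mm>"
proof -
  obtain M where M: "ideal M R" "M \<noteq> carrier R" "A \<subseteq> M"
    "\<And>B. ideal B R \<Longrightarrow> B \<noteq> carrier R \<Longrightarrow> M \<subseteq> B \<Longrightarrow> B = M"
    using maximal_ideal_exists[of A "\<lambda>B. B \<noteq> carrier R"] assms by blast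
  have "maximalideal M R"
    by (rule maximalidealI) (use M in auto)
  then show ?thesis using M(3) maximal_unique by blast
qed

lemma unit_outside_\<mm>:
  assumes "x \<in> carrier R" "x \<notin> \<mm>"
  shows "\<exists>y\<in>carrier R. y \<otimes> x = \<one>"
proof -
  have "PIdl x = carrier R"
    using proper_ideal_subset[OF cgenideal_ideal] cgenideal_self assms by blast
  then have "\<one> \<in> PIdl x" by simp
  then obtain y where "y \<in> carrier R" "\<one> = y \<otimes> x" unfolding cgenideal_def by blast
  then show ?thesis by (intro bexI[of _ y]) (rule sym)
qed

text \<open>An ideal maximal among those disjoint from a multiplicative set is prime: if a and b
  both lay outside, the two enlargements would meet S, and the product of the meeting elements would
  lie in P and in S.\<close>

lemma prime_avoiding:
  assumes A: "ideal A R" and S: "S \<subseteq> carrier R" "\<one> \<in> S" "\<And>s t. s \<in> S \<Longrightarrow> t \<in> S \<Longrightarrow> s \<otimes> t \<in> S"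
    and disj: "A \<inter> S = {}"
  obtains P where "primeideal P R" "A \<subseteq> P" "P \<inter> S = {}"
proof -
  obtain P where P: "ideal P R" "P \<inter> S = {}" "A \<subseteq> P"
    "\<And>B. ideal B R \<Longrightarrow> B \<inter> S = {} \<Longrightarrow> P \<subseteq> B \<Longrightarrow> B = P"
    using maximal_ideal_exists[of A "\<lambda>B. B \<inter> S = {}"] A disj by blast
  have meet: "\<exists>p\<in>P. \<exists>r\<in>carrier R. p \<oplus> r \<otimes> x \<in> S" if x: "x \<in> carrier R" "x \<notin> P" for x
  proof -
    have "P <+> PIdl x \<noteq> P" using sum_PIdl_upper(2)[OF P(1) x(1)] x(2) by blast
    then have "(P <+> PIdl x) \<inter> S \<noteq> {}"
      using P(4)[OF ideal_sum_PIdl[OF P(1) x(1)]] sum_PIdl_upper(1)[OF P(1) x(1)] by blast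
    then obtain z where "z \<in> P <+> PIdl x" "z \<in> S" by blast
    then show ?thesis unfolding mem_sum_PIdl_iff by blast
  qed
  have "primeideal P R"
  proof (rule primeidealI[OF P(1) is_cring])
    show "carrier R \<noteq> P" using P(2) S(2) one_closed by blast
    fix a b assume ab: "a \<in> carrier R" "b \<in> carrier R" "a \<otimes> b \<in> P"
    show "a \<in> P \<or> b \<in> P"
    proof (rule ccontr)
      assume n: "\<not> ?thesis"
      obtain p r where p: "p \<in> P" "r \<in> carrier R" "p \<oplus> r \<otimes> a \<in> S" using meet ab n by blast
      obtain q s where q: "q \<in> P" "s \<in> carrier R" "q \<oplus> s \<otimes> b \<in> S" using meet ab n by blast
      have c: "p \<in> carrier R" "q \<in> carrier R" using p q ideal_closed(3)[OF P(1)] by auto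
      have "(p \<oplus> r \<otimes> a) \<otimes> (q \<oplus> s \<otimes> b) = (q \<oplus> s \<otimes> b) \<otimes> p \<oplus> ((r \<otimes> a) \<otimes> q \<oplus> (r \<otimes> s) \<otimes> (a \<otimes> b))"
        using c p q ab by algebra
      also have "\<dots> \<in> P"
        using ideal_closed(4)[OF P(1)] ideal_closed(7)[OF P(1) _ p(1), of "q \<oplus> s \<otimes> b"]
          ideal_closed(7)[OF P(1) _ q(1), of "r \<otimes> a"] ideal_closed(7)[OF P(1) _ ab(3), of "r \<otimes> s"]
          p(2) q(2) c ab(1,2) by simp
      finally show False using S(3)[OF p(3) q(3)] P(2) by blast
    qed
  qed
  then show ?thesis using that P by blast
qed

definition mm_primary :: "'a set \<Rightarrow> bool" where
  "mm_primary A \<longleftrightarrow> ideal A R \<and> (\<forall>t\<in>\<mm>. \<exists>k::nat. t [^] k \<in> A)"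

lemma mm_primaryD: "mm_primary A \<Longrightarrow> ideal A R"
  by (simp add: mm_primary_def)

lemma mm_primary_mono: "mm_primary A \<Longrightarrow> ideal B R \<Longrightarrow> A \<subseteq> B \<Longrightarrow> mm_primary B"
  unfolding mm_primary_def by blast

lemma mm_primary_carrier: "mm_primary (carrier R)"
  unfolding mm_primary_def using oneideal ideal_closed(3)[OF \<mm>_ideal] by auto

lemma mm_primary_\<mm>: "mm_primary \<mm>"
  unfolding mm_primary_def using \<mm>_ideal ideal_closed(3)[OF \<mm>_ideal]
  by (auto intro!: exI[of _ "1::nat"])

text \<open>If no power of some t \<in> \<mm> lay in A, there would be a prime over A avoiding all
  powers of t, and it could not be \<mm>.\<close>

lemma mm_primary_if_primes:
  assumes A: "ideal A R" and P: "\<And>P. primeideal P R \<Longrightarrow> A \<subseteq> P \<Longrightarrow> P = \<mm>"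
  shows "mm_primary A"
  unfolding mm_primary_def
proof (intro conjI ballI A, rule ccontr)
  fix t assume t: "t \<in> \<mm>" "\<not> (\<exists>k::nat. t [^] k \<in> A)"
  have tc: "t \<in> carrier R" using t ideal_closed(3)[OF \<mm>_ideal] by blast
  define S where "S = {t [^] k | k :: nat. True}"
  have 1: "S \<subseteq> carrier R" "A \<inter> S = {}" unfolding S_def using tc t(2) by auto
  have 2: "\<one> \<in> S" unfolding S_def by (rule CollectI, rule exI[of _ 0]) simp
  have 3: "s \<otimes> s' \<in> S" if "s \<in> S" "s' \<in> S" for s s'
  proof -
    obtain k l :: nat where "s = t [^] k" "s' = t [^] l"
      using \<open>s \<in> S\<close> \<open>s' \<in> S\<close> unfolding S_def by blast
    then have "s \<otimes> s' = t [^] (k + l)" using nat_pow_mult[OF tc] by simp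
    then show ?thesis unfolding S_def by blast
  qed
  obtain P where P': "primeideal P R" "A \<subseteq> P" "P \<inter> S = {}" using prime_avoiding[OF A 1(1) 2 3 1(2)] .
  have "t [^] (1::nat) \<in> S" unfolding S_def by blast
  then show False using P[OF P'(1,2)] P'(3) t(1) tc by auto
qed

lemma mm_primary_if_mult_mem:
  assumes "mm_primary A" "mm_primary B" "ideal C R" and C: "\<And>a b. a \<in> A \<Longrightarrow> b \<in> B \<Longrightarrow> a \<otimes> b \<in> C"
  shows "mm_primary C"
  unfolding mm_primary_def
proof (intro conjI ballI assms(3))
  fix t assume t: "t \<in> \<mm>"
  then obtain k l :: nat where "t [^] k \<in> A" "t [^] l \<in> B" using assms(1,2) unfolding mm_primary_def by blast
  then have "t [^] (k + l) \<in> C" using C nat_pow_mult ideal_closed(3)[OF \<mm>_ideal t] by metis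
  then show "\<exists>k::nat. t [^] k \<in> C" by blast
qed

lemma finite_colength_\<mm>: "finite_colength \<mm>" "colength R \<mm> = 1"
proof -
  define f where "f N = (if N = carrier R then 0 else 1 :: nat)" for N
  have dec: "f N' < f N" if "ideal N R" "ideal N' R" "\<mm> \<subseteq> N" "N \<subset> N'" for N N'
  proof -
    have "N \<noteq> carrier R" using that ideal_closed(1)[OF that(2)] by blast
    then have "N = \<mm>" using I_maximal[OF that(1,3)] ideal_closed(1)[OF that(1)] by blast
    then have "N' = carrier R" using that I_maximal[OF that(2)] ideal_closed(1)[OF that(2)] by blast
    then show ?thesis using \<open>N \<noteq> carrier R\<close> by (simp add: f_def)
  qed
  show fin: "finite_colength \<mm>" by (rule colength_le(1)[OF \<mm>_ideal, of f]) (rule dec)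
  have "colength R \<mm> \<le> f \<mm>" by (rule colength_le(2)[OF \<mm>_ideal, of f]) (rule dec)
  moreover have "f \<mm> = 1" using I_notcarr by (auto simp: f_def)
  moreover have "\<mm> \<subset> carrier R" using I_notcarr ideal_closed(1)[OF \<mm>_ideal] by blast
  ultimately show "colength R \<mm> = 1" using colength_psubset[OF fin oneideal] by simp
qed

text \<open>Let M be maximal among the counterexamples above A. For a suitable x \<notin> M the
  colon M : x equals \<mm> and has colength 1, while M + (x) is strictly larger and no
  counterexample; the exact sequence then makes the colength of M finite.\<close>

lemma mm_primary_finite_colength: "mm_primary A \<Longrightarrow> finite_colength A"
proof (rule ccontr)
  assume A: "mm_primary A" "\<not> finite_colength A"
  obtain M where M: "ideal M R" "\<not> finite_colength M" "A \<subseteq> M"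
    "\<And>B. ideal B R \<Longrightarrow> \<not> finite_colength B \<Longrightarrow> M \<subseteq> B \<Longrightarrow> B = M"
    using maximal_ideal_exists[of A "\<lambda>B. \<not> finite_colength B"] A mm_primaryD by blast
  have prM: "mm_primary M" using mm_primary_mono A(1) M by blast
  have neM: "M \<noteq> carrier R" using colength_carrier M(2) by blast
  \<comment> \<open>A maximal proper ideal of the form \<open>M : x\<close> is prime, hence equal to \<open>\<mm>\<close>.\<close>
  have "colon M \<one> = M" using ideal_closed(3)[OF M(1)] by (auto simp: colon_def)
  then have colM: "M \<noteq> carrier R \<and> (\<exists>x\<in>carrier R. M = colon M x)" using neM one_closed by blast
  obtain P where P: "ideal P R" "P \<noteq> carrier R \<and> (\<exists>x\<in>carrier R. P = colon M x)" "M \<subseteq> P"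
    "\<And>B. ideal B R \<Longrightarrow> B \<noteq> carrier R \<and> (\<exists>x\<in>carrier R. B = colon M x) \<Longrightarrow> P \<subseteq> B \<Longrightarrow> B = P"
    by (rule maximal_ideal_exists[of M "\<lambda>P. P \<noteq> carrier R \<and> (\<exists>x\<in>carrier R. P = colon M x)", OF M(1) colM])
      (rule that, (assumption | blast)+)
  obtain x where x: "x \<in> carrier R" "P = colon M x" using P(2) by blast
  have xM: "x \<notin> M" using P(2) x colon_eq_carrier_iff[OF M(1)] by blast
  have prime: "b \<in> P" if ab: "a \<in> carrier R" "b \<in> carrier R" "a \<otimes> b \<in> P" "a \<notin> P" for a b
  proof -
    have "a \<otimes> x \<notin> M" using ab x by (simp add: colon_def)
    then have "colon M (a \<otimes> x) \<noteq> carrier R" using colon_eq_carrier_iff[OF M(1)] ab x by simp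
    moreover have "P \<subseteq> colon M (a \<otimes> x)"
    proof
      fix r assume "r \<in> P"
      then have r: "r \<in> carrier R" "r \<otimes> x \<in> M" by (auto simp: x(2) colon_def)
      have "r \<otimes> (a \<otimes> x) = a \<otimes> (r \<otimes> x)" using r ab x by algebra
      then show "r \<in> colon M (a \<otimes> x)" using r ideal_closed(7)[OF M(1) ab(1)] by (simp add: colon_def)
    qed
    ultimately have "colon M (a \<otimes> x) = P" using P(4) ideal_colon[OF M(1)] ab(1) x(1) by blast
    moreover have "b \<otimes> (a \<otimes> x) \<in> M"
      using ab x m_assoc m_comm by (simp add: colon_def)
    ultimately show ?thesis using ab by (auto simp: colon_def)
  qed
  have "\<mm> \<subseteq> P"
  proof
    fix t assume t: "t \<in> \<mm>"
    then have tc: "t \<in> carrier R" using ideal_closed(3)[OF \<mm>_ideal] by blast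
    obtain k :: nat where "t [^] k \<in> M" using prM t unfolding mm_primary_def by blast
    then have "t [^] k \<in> P" using colon_upper[OF M(1) x(1)] x(2) by blast
    then show "t \<in> P"
    proof (induction k)
      case 0
      then show ?case using ideal_eq_carrier[OF P(1)] P(2) by simp
    next
      case (Suc k)
      then show ?case using prime[of "t [^] k" t] tc by (cases "t [^] k \<in> P") auto
    qed
  qed
  then have "P = \<mm>" using I_maximal[OF P(1)] ideal_closed(1)[OF P(1)] P(2) by blast
  then have "finite_colength (colon M x)" using finite_colength_\<mm> x by simp
  moreover have "finite_colength (M <+> PIdl x)"
    using M(4)[OF ideal_sum_PIdl[OF M(1) x(1)]] sum_PIdl_upper[OF M(1) x(1)] xM by blast
  ultimately show False using colength_sum_PIdl[OF M(1) x(1)] M(2) by blast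
qed

lemma mm_primary_colength_sum_PIdl:
  assumes "mm_primary A" "x \<in> carrier R"
  shows "colength R A = colength R (A <+> PIdl x) + colength R (colon A x)"
proof (rule colength_sum_PIdl)
  show A: "ideal A R" by (rule mm_primaryD[OF assms(1)])
  show "finite_colength (A <+> PIdl x)" "finite_colength (colon A x)"
    using mm_primary_mono[OF assms(1)] mm_primary_finite_colength ideal_sum_PIdl[OF A assms(2)]
      sum_PIdl_upper[OF A assms(2)] ideal_colon[OF A assms(2)] colon_upper[OF A assms(2)] by auto
qed (rule assms(2))

lemma colength_mono: "mm_primary A \<Longrightarrow> ideal B R \<Longrightarrow> A \<subseteq> B \<Longrightarrow> colength R B \<le> colength R A"
  using finite_colength_mono mm_primary_finite_colength by blast

lemma colength_strict: "mm_primary A \<Longrightarrow> ideal B R \<Longrightarrow> A \<subset> B \<Longrightarrow> colength R B < colength R A"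
  using colength_psubset mm_primary_finite_colength by blast

end

section \<open>Numbers of generators\<close>

context cring
begin

lemma Idl_prod:
  assumes "S \<subseteq> carrier R" "T \<subseteq> carrier R"
  shows "(Idl S) \<cdot> (Idl T) = Idl {s \<otimes> t | s t. s \<in> S \<and> t \<in> T}"
proof
  define P where "P = Idl {s \<otimes> t | s t. s \<in> S \<and> t \<in> T}"
  have c: "{s \<otimes> t | s t. s \<in> S \<and> t \<in> T} \<subseteq> carrier R" using assms by auto
  have P: "ideal P R" unfolding P_def by (rule genideal_ideal[OF c])
  have mem: "s \<otimes> t \<in> P" if "s \<in> S" "t \<in> T" for s t
    unfolding P_def using genideal_self[OF c] that by blast
  have 1: "s \<otimes> t \<in> P" if "s \<in> Idl S" "t \<in> T" for s t
  proof -
    have t: "t \<in> carrier R" using that(2) assms by auto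
    have "Idl S \<subseteq> colon P t"
      using mem[OF _ that(2)] assms by (intro genideal_minimal ideal_colon[OF P t]) (auto simp: colon_def)
    then show ?thesis using that(1) by (auto simp: colon_def)
  qed
  have 2: "s \<otimes> t \<in> P" if "s \<in> Idl S" "t \<in> Idl T" for s t
  proof -
    have s: "s \<in> carrier R" using that(1) ideal_closed(3)[OF genideal_ideal[OF assms(1)]] by blast
    have "t \<otimes> s \<in> P" if "t \<in> T" for t
      using 1[OF \<open>s \<in> Idl S\<close> that] m_comm[of s t] that s assms(2) by auto
    then have "Idl T \<subseteq> colon P s"
      using assms by (intro genideal_minimal ideal_colon[OF P s]) (auto simp: colon_def)
    then have "t \<otimes> s \<in> P" "t \<in> carrier R" using that(2) by (auto simp: colon_def)
    then show ?thesis using m_comm s by simp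
  qed
  show "(Idl S) \<cdot> (Idl T) \<subseteq> Idl {s \<otimes> t | s t. s \<in> S \<and> t \<in> T}"
    using prod_least[OF P 2] unfolding P_def by blast
  show "Idl {s \<otimes> t | s t. s \<in> S \<and> t \<in> T} \<subseteq> (Idl S) \<cdot> (Idl T)"
    using genideal_self[OF assms(1)] genideal_self[OF assms(2)]
    by (intro genideal_minimal ideal_prod_is_ideal genideal_ideal assms) (auto intro: ideal_prod.prod)
qed

lemma Idl_Un:
  assumes "S \<subseteq> carrier R" "T \<subseteq> carrier R"
  shows "Idl (S \<union> T) = Idl S <+> Idl T"
proof
  have i: "ideal (Idl S) R" "ideal (Idl T) R" using assms genideal_ideal by auto
  show "Idl (S \<union> T) \<subseteq> Idl S <+> Idl T"
    using genideal_self assms sum_upper1[OF i] sum_upper2[OF i]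
    by (intro genideal_minimal add_ideals i) blast
  show "Idl S <+> Idl T \<subseteq> Idl (S \<union> T)"
    using assms by (intro sum_least genideal_ideal subset_Idl_subset) auto
qed

lemma ideals_set_simps [simp]: "\<one>\<^bsub>ideals_set R\<^esub> = carrier R" "A \<otimes>\<^bsub>ideals_set R\<^esub> B = A \<cdot> B"
  by (simp_all add: ideals_set_def)

lemma ideal_power_0: "ideal_power R A 0 = carrier R"
  by (simp add: nat_pow_def ideals_set_def)

lemma ideal_power_Suc: "ideal_power R A (Suc m) = ideal_power R A m \<cdot> A"
  by (simp add: nat_pow_def ideals_set_def)

lemma ideal_ideal_power: "ideal A R \<Longrightarrow> ideal (ideal_power R A m) R"
  by (induction m) (simp_all add: ideal_power_0 ideal_power_Suc oneideal ideal_prod_is_ideal)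

lemma ideal_power_1: "ideal A R \<Longrightarrow> ideal_power R A 1 = A"
  using ideal_prod_commute[OF oneideal, of A]
  by (simp add: ideal_power_0 ideal_power_Suc ideal_prod_one)

lemma ideal_power_add:
  assumes "ideal A R"
  shows "ideal_power R A (m + k) = ideal_power R A m \<cdot> ideal_power R A k"
  using assms
  by (induction k)
    (simp_all add: ideal_power_0 ideal_power_Suc ideal_prod_one ideal_prod_assoc ideal_ideal_power)

lemma ideal_power_antimono:
  assumes "ideal A R" "m \<le> k"
  shows "ideal_power R A k \<subseteq> ideal_power R A m"
  using assms prod_subset1[of "ideal_power R A m" "ideal_power R A (k - m)"]
  by (simp add: ideal_ideal_power flip: ideal_power_add)

lemma ideal_power_mono:
  assumes "A \<subseteq> B" shows "ideal_power R A m \<subseteq> ideal_power R B m"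
  by (induction m) (simp_all add: ideal_power_0 ideal_power_Suc prod_mono assms)

text \<open>A bound rather than an exact number: products and monomials of generators may coincide,
  and only upper bounds are wanted.\<close>

definition generated_by :: "nat \<Rightarrow> 'a set \<Rightarrow> bool" where
  "generated_by k A \<longleftrightarrow> (\<exists>S\<subseteq>carrier R. finite S \<and> card S \<le> k \<and> A = Idl S)"

lemma min_gens_le: "generated_by k A \<Longrightarrow> min_gens R A \<le> k"
  unfolding generated_by_def min_gens_def by (metis (mono_tags, lifting) Least_le order_trans)

lemma generated_by_sum:
  assumes "generated_by k A" "generated_by l B" shows "generated_by (k + l) (A <+> B)"
proof -
  obtain S T where S: "S \<subseteq> carrier R" "finite S" "card S \<le> k" "A = Idl S"
    and T: "T \<subseteq> carrier R" "finite T" "card T \<le> l" "B = Idl T"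
    using assms unfolding generated_by_def by blast
  show ?thesis
    unfolding generated_by_def
  proof (intro exI[of _ "S \<union> T"] conjI)
    show "card (S \<union> T) \<le> k + l" using card_Un_le[of S T] S T by linarith
  qed (use S T in \<open>auto simp: Idl_Un\<close>)
qed

lemma generated_by_prod:
  assumes "generated_by k A" "generated_by l B" shows "generated_by (k * l) (A \<cdot> B)"
proof -
  obtain S T where S: "S \<subseteq> carrier R" "finite S" "card S \<le> k" "A = Idl S"
    and T: "T \<subseteq> carrier R" "finite T" "card T \<le> l" "B = Idl T"
    using assms unfolding generated_by_def by blast
  have im: "{s \<otimes> t | s t. s \<in> S \<and> t \<in> T} = (\<lambda>(s, t). s \<otimes> t) ` (S \<times> T)" by auto
  have "card ((\<lambda>(s, t). s \<otimes> t) ` (S \<times> T)) \<le> card S * card T"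
    using card_image_le[of "S \<times> T"] S T by (simp add: card_cartesian_product)
  also have "\<dots> \<le> k * l" using S T by (intro mult_le_mono)
  finally show ?thesis
    unfolding generated_by_def using S T im Idl_prod[OF S(1) T(1)]
    by (intro exI[of _ "(\<lambda>(s, t). s \<otimes> t) ` (S \<times> T)"]) auto
qed

end

context noetherian_local_ring
begin

lemma min_gens_generated: "ideal A R \<Longrightarrow> generated_by (min_gens R A) A"
  unfolding generated_by_def min_gens_def
  using finetely_gen[of A] LeastI_ex[of "\<lambda>n. \<exists>S \<subseteq> carrier R. finite S \<and> card S = n \<and> A = Idl S"]
  by (metis (mono_tags, lifting) order_refl)

lemma mm_primary_prod:
  assumes "mm_primary A" "mm_primary B" shows "mm_primary (A \<cdot> B)"
  using mm_primary_if_mult_mem[OF assms] ideal_prod_is_ideal mm_primaryD assms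
  by (blast intro: ideal_prod.prod)

lemma mm_primary_power: "mm_primary A \<Longrightarrow> mm_primary (ideal_power R A m)"
  by (induction m) (simp_all add: ideal_power_0 ideal_power_Suc mm_primary_carrier mm_primary_prod)

lemma mm_primary_sum: "mm_primary A \<Longrightarrow> ideal B R \<Longrightarrow> mm_primary (A <+> B)"
  using mm_primary_mono add_ideals sum_upper1 mm_primaryD by blast

lemma mm_primary_colon: "mm_primary A \<Longrightarrow> x \<in> carrier R \<Longrightarrow> mm_primary (colon A x)"
  using mm_primary_mono ideal_colon colon_upper mm_primaryD by blast

text \<open>Adjoining s costs the length of R modulo the colon by s, hence at most l(R/C).\<close>

lemma colength_adjoin:
  assumes A: "mm_primary A" and C: "mm_primary C" and "finite S" "S \<subseteq> carrier R"
    and "\<And>s. s \<in> S \<Longrightarrow> C \<subseteq> colon A s"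
  shows "colength R A \<le> colength R (A <+> Idl S) + card S * colength R C"
  using assms(3-5)
proof (induction S rule: finite_induct)
  case empty
  then show ?case using sum_absorb[OF mm_primaryD[OF A] zeroideal] ideal_closed(2)[OF mm_primaryD[OF A]]
    by (simp add: Idl_empty)
next
  case (insert s S)
  have s: "s \<in> carrier R" and S: "S \<subseteq> carrier R" using insert by auto
  have iA: "ideal A R" using A mm_primaryD by blast
  have iS: "ideal (Idl S) R" by (rule genideal_ideal[OF S])
  have pr: "mm_primary (A <+> Idl S)" by (rule mm_primary_sum[OF A iS])
  have "C \<subseteq> colon (A <+> Idl S) s"
    using insert.prems(2)[of s] colon_mono[OF sum_upper1[OF iA iS]] by blast
  then have "colength R (colon (A <+> Idl S) s) \<le> colength R C"
    using colength_mono[OF C] ideal_colon[OF mm_primaryD[OF pr] s] by blast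
  moreover have "A <+> Idl (insert s S) = (A <+> Idl S) <+> PIdl s"
    unfolding Idl_insert[OF S s] by (rule sum_assoc[symmetric, OF iA iS cgenideal_ideal[OF s]])
  moreover have "colength R A \<le> colength R (A <+> Idl S) + card S * colength R C"
    using insert by auto
  ultimately show ?case using mm_primary_colength_sum_PIdl[OF pr s] insert.hyps by simp
qed

text \<open>A/AB is generated by k elements, each of them killed by B.\<close>

lemma colength_prod_le:
  assumes A: "mm_primary A" and B: "mm_primary B" and gen: "generated_by k A"
  shows "colength R (A \<cdot> B) \<le> colength R A + k * colength R B"
proof -
  obtain S where S: "S \<subseteq> carrier R" "finite S" "card S \<le> k" "A = Idl S"
    using gen unfolding generated_by_def by blast
  have iA: "ideal A R" and iB: "ideal B R" using A B mm_primaryD by auto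
  have SA: "S \<subseteq> A" using genideal_self[OF S(1)] S(4) by simp
  have "B \<subseteq> colon (A \<cdot> B) s" if "s \<in> S" for s
  proof
    fix b assume b: "b \<in> B"
    have "s \<otimes> b \<in> A \<cdot> B" using SA that b by (blast intro: ideal_prod.prod)
    then show "b \<in> colon (A \<cdot> B) s"
      using m_comm[of s b] ideal_closed(3)[OF iB b] S(1) that by (auto simp: colon_def)
  qed
  then have "colength R (A \<cdot> B) \<le> colength R ((A \<cdot> B) <+> Idl S) + card S * colength R B"
    by (intro colength_adjoin mm_primary_prod A B S)
  also have "(A \<cdot> B) <+> Idl S = A"
    using S(4) sum_comm[OF ideal_prod_is_ideal[OF iA iB] iA] sum_absorb[OF iA ideal_prod_is_ideal[OF iA iB]]
      prod_subset1[OF iA iB] by simp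
  also have "card S * colength R B \<le> k * colength R B" using S(3) by simp
  finally show ?thesis by simp
qed

text \<open>Choose C maximal among the ideals with B \<subseteq> C \<subset> A, so that A/C is
  simple. If t x \<notin> C for some t \<in> \<mm> and x \<in> A, then x = u + s t x with u \<in> C,
  and the unit 1 - s t gives x \<in> C. Hence \<mm> A \<subseteq> C.\<close>

lemma nakayama:
  assumes A: "ideal A R" and B: "ideal B R" "B \<subseteq> A" and eq: "A \<subseteq> B <+> (\<mm> \<cdot> A)"
  shows "A = B"
proof (rule ccontr)
  assume "A \<noteq> B"
  then have "B \<subseteq> A \<and> B \<noteq> A" using B by blast
  then obtain C where C: "ideal C R" "C \<subseteq> A \<and> C \<noteq> A" "B \<subseteq> C"
    "\<And>D. ideal D R \<Longrightarrow> D \<subseteq> A \<and> D \<noteq> A \<Longrightarrow> C \<subseteq> D \<Longrightarrow> D = C"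
    using maximal_ideal_exists[of B "\<lambda>D. D \<subseteq> A \<and> D \<noteq> A"] B(1) by blast
  have adj: "C <+> PIdl y = A" if "y \<in> A" "y \<notin> C" for y
  proof -
    have y: "y \<in> carrier R" using that ideal_closed(3)[OF A] by blast
    have "C <+> PIdl y \<subseteq> A" by (rule sum_PIdl_least[OF A]) (use that C in auto)
    then show ?thesis
      using C(4)[OF ideal_sum_PIdl[OF C(1) y]] sum_PIdl_upper[OF C(1) y] that by blast
  qed
  have "t \<otimes> x \<in> C" if t: "t \<in> \<mm>" and x: "x \<in> A" for t x
  proof (rule ccontr)
    assume n: "t \<otimes> x \<notin> C"
    have c: "t \<in> carrier R" "x \<in> carrier R" using t x ideal_closed(3) \<mm>_ideal A by auto
    have "x \<in> C <+> PIdl (t \<otimes> x)" using adj[OF ideal_closed(7)[OF A c(1) x] n] x by simp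
    then obtain u s where u: "u \<in> C" "s \<in> carrier R" "x = u \<oplus> s \<otimes> (t \<otimes> x)"
      unfolding mem_sum_PIdl_iff by blast
    have uc: "u \<in> carrier R" using u ideal_closed(3)[OF C(1)] by blast
    have "(\<one> \<ominus> s \<otimes> t) \<otimes> x = x \<ominus> s \<otimes> (t \<otimes> x)" using c u(2) by algebra
    also have "\<dots> = (u \<oplus> s \<otimes> (t \<otimes> x)) \<ominus> s \<otimes> (t \<otimes> x)" using u(3) by simp
    also have "\<dots> = u" using c u(2) uc by algebra
    finally have ux: "(\<one> \<ominus> s \<otimes> t) \<otimes> x \<in> C" using u(1) by simp
    have st: "s \<otimes> t \<in> \<mm>" using ideal_closed(7)[OF \<mm>_ideal u(2) t] .
    have "\<one> \<ominus> s \<otimes> t \<notin> \<mm>"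
    proof
      assume "\<one> \<ominus> s \<otimes> t \<in> \<mm>"
      then have "(\<one> \<ominus> s \<otimes> t) \<oplus> s \<otimes> t \<in> \<mm>" using st ideal_closed(4)[OF \<mm>_ideal] by blast
      moreover have "(\<one> \<ominus> s \<otimes> t) \<oplus> s \<otimes> t = \<one>" using c u(2) by algebra
      ultimately show False using one_notin_\<mm> by simp
    qed
    then obtain v where v: "v \<in> carrier R" "v \<otimes> (\<one> \<ominus> s \<otimes> t) = \<one>"
      using unit_outside_\<mm>[of "\<one> \<ominus> s \<otimes> t"] c u(2) by auto
    have "x = (v \<otimes> (\<one> \<ominus> s \<otimes> t)) \<otimes> x" using v c by simp
    also have "\<dots> = v \<otimes> ((\<one> \<ominus> s \<otimes> t) \<otimes> x)" using v c u(2) by (intro m_assoc) auto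
    also have "\<dots> \<in> C" by (rule ideal_closed(7)[OF C(1) v(1) ux])
    finally have "t \<otimes> x \<in> C" using ideal_closed(7)[OF C(1) c(1)] by blast
    then show False using n by simp
  qed
  then have "\<mm> \<cdot> A \<subseteq> C" by (intro prod_least[OF C(1)])
  then have "A \<subseteq> C" using eq sum_least[OF C(1) C(3)] by blast
  then show False using C(2) by blast
qed

text \<open>Each new element of M lowers the colength by at least 1, so the difference of the
  colengths bounds the number of elements adjoined.\<close>

lemma generating_set_modulo:
  assumes M: "ideal M R"
  shows "mm_primary A \<Longrightarrow> A \<subseteq> M \<Longrightarrow>
    \<exists>S\<subseteq>M. finite S \<and> card S \<le> colength R A - colength R M \<and> A <+> Idl S = M"
proof (induction "colength R A - colength R M" arbitrary: A rule: less_induct)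
  case less
  have A: "ideal A R" using less mm_primaryD by blast
  show ?case
  proof (cases "A = M")
    case True
    then show ?thesis using sum_absorb[OF A zeroideal] ideal_closed(2)[OF A]
      by (intro exI[of _ "{}"]) (simp add: Idl_empty)
  next
    case False
    then obtain x where x: "x \<in> M" "x \<notin> A" using less by blast
    have xc: "x \<in> carrier R" using x ideal_closed(3)[OF M] by blast
    let ?B = "A <+> PIdl x"
    have B: "mm_primary ?B" "?B \<subseteq> M"
      using mm_primary_sum[OF less.prems(1) cgenideal_ideal[OF xc]] sum_PIdl_least[OF M less.prems(2) x(1)] by auto
    have lt: "colength R ?B < colength R A"
      using colength_strict[OF less.prems(1)] ideal_sum_PIdl[OF A xc] sum_PIdl_upper[OF A xc] x(2) by blast
    have ge: "colength R M \<le> colength R ?B" using colength_mono[OF B(1) M B(2)] .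
    obtain S where S: "S \<subseteq> M" "finite S" "card S \<le> colength R ?B - colength R M" "?B <+> Idl S = M"
      using less.hyps[OF diff_less_mono[OF lt ge] B] by blast
    have Sc: "S \<subseteq> carrier R" using S ideal_closed(1)[OF M] by blast
    have "A <+> Idl (insert x S) = M"
      unfolding Idl_insert[OF Sc xc] using S(4) sum_comm[OF genideal_ideal[OF Sc] cgenideal_ideal[OF xc]]
        sum_assoc[OF A cgenideal_ideal[OF xc] genideal_ideal[OF Sc]] by simp
    moreover have "card (insert x S) \<le> colength R A - colength R M"
      using card_insert_le_m1[of _ S x] card_insert_if[OF S(2), of x] S(3) lt ge by (auto split: if_splits)
    ultimately show ?thesis using S x by (intro exI[of _ "insert x S"]) auto
  qed
qed

text \<open>That is mu(M) = l(M / \<mm> M), written additively to avoid truncated subtraction. One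
  direction is \<open>colength_prod_le\<close>; for the other, generators of M modulo \<mm> M
  generate M by Nakayama.\<close>

lemma min_gens_eq:
  assumes M: "mm_primary M"
  shows "min_gens R M + colength R M = colength R (\<mm> \<cdot> M)"
proof (rule antisym)
  have iM: "ideal M R" using M mm_primaryD by blast
  have pr: "mm_primary (\<mm> \<cdot> M)" by (rule mm_primary_prod[OF mm_primary_\<mm> M])
  have sub: "\<mm> \<cdot> M \<subseteq> M" by (rule prod_subset2[OF \<mm>_ideal iM])
  have "colength R (\<mm> \<cdot> M) = colength R (M \<cdot> \<mm>)" using ideal_prod_commute[OF \<mm>_ideal iM] by simp
  also have "\<dots> \<le> colength R M + min_gens R M * colength R \<mm>"
    by (intro colength_prod_le M mm_primary_\<mm> min_gens_generated iM)
  finally show "colength R (\<mm> \<cdot> M) \<le> min_gens R M + colength R M"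
    using finite_colength_\<mm> by simp
  obtain S where S: "S \<subseteq> M" "finite S" "card S \<le> colength R (\<mm> \<cdot> M) - colength R M" "(\<mm> \<cdot> M) <+> Idl S = M"
    using generating_set_modulo[OF iM pr sub] by blast
  have Sc: "S \<subseteq> carrier R" using S ideal_closed(1)[OF iM] by blast
  have "M = Idl S"
    using genideal_minimal[OF iM S(1)] S(4)
      sum_comm[OF ideal_prod_is_ideal[OF \<mm>_ideal iM] genideal_ideal[OF Sc]]
    by (intro nakayama iM genideal_ideal Sc) auto
  then have "min_gens R M \<le> colength R (\<mm> \<cdot> M) - colength R M"
    using S Sc by (intro min_gens_le) (auto simp: generated_by_def)
  then show "min_gens R M + colength R M \<le> colength R (\<mm> \<cdot> M)"
    using colength_mono[OF pr iM sub] by simp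
qed

text \<open>Amounts to mu(M) \<le> k + l(M/B): k generators come from B and the rest are counted by
  M/B. This is how an ideal built from general elements bounds mu(I^m).\<close>

lemma min_gens_le_colength:
  assumes M: "mm_primary M" and B: "mm_primary B" "B \<subseteq> M" "generated_by k B"
  shows "min_gens R M + colength R M \<le> k + colength R B"
proof -
  obtain S where S: "S \<subseteq> carrier R" "finite S" "card S \<le> k" "B = Idl S"
    using B(3) unfolding generated_by_def by blast
  have iM: "ideal M R" and iB: "ideal B R" using M B mm_primaryD by auto
  have pr: "mm_primary (\<mm> \<cdot> M)" by (rule mm_primary_prod[OF mm_primary_\<mm> M])
  have "\<mm> \<subseteq> colon (\<mm> \<cdot> M) s" if "s \<in> S" for s
  proof
    fix t assume t: "t \<in> \<mm>"
    have "s \<in> M" using genideal_self[OF S(1)] that S(4) B(2) by blast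
    then show "t \<in> colon (\<mm> \<cdot> M) s"
      using t ideal_closed(3)[OF \<mm>_ideal t] by (auto simp: colon_def intro: ideal_prod.prod)
  qed
  then have "colength R (\<mm> \<cdot> M) \<le> colength R ((\<mm> \<cdot> M) <+> B) + card S * colength R \<mm>"
    unfolding S(4) by (intro colength_adjoin pr mm_primary_\<mm> S)
  also have "colength R ((\<mm> \<cdot> M) <+> B) \<le> colength R B"
    using colength_mono[OF B(1)] add_ideals[OF mm_primaryD[OF pr] iB] sum_upper2[OF mm_primaryD[OF pr] iB] by blast
  finally show ?thesis using min_gens_eq[OF M] S(3) finite_colength_\<mm> by simp
qed

end

section \<open>Monomials and the Rees algebra\<close>

text \<open>Compatibility of the lexicographic order with addition of exponents, so that
  multiplication by a monomial respects leading terms.\<close>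

lemma map2_plus_less:
  fixes \<alpha> \<beta> \<gamma> :: "nat list"
  assumes "length \<alpha> = length \<gamma>" "length \<beta> = length \<gamma>" "\<beta> < \<alpha>"
  shows "map2 (+) \<beta> \<gamma> < map2 (+) \<alpha> \<gamma>"
  using assms
proof (induction \<gamma> arbitrary: \<alpha> \<beta>)
  case (Cons c \<gamma>)
  then obtain a \<alpha>' b \<beta>' where "\<alpha> = a # \<alpha>'" "\<beta> = b # \<beta>'" by (metis length_Suc_conv)
  then show ?case using Cons by auto
qed simp

lemma sum_list_map2_plus:
  fixes \<alpha> \<beta> :: "nat list"
  shows "length \<alpha> = length \<beta> \<Longrightarrow> sum_list (map2 (+) \<alpha> \<beta>) = sum_list \<alpha> + sum_list \<beta>"
  by (induction \<alpha> \<beta> rule: list_induct2) auto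

lemma list_all2_le_diff:
  fixes \<alpha> \<beta> :: "nat list"
  assumes "list_all2 (\<le>) \<alpha> \<beta>"
  shows "\<exists>\<gamma>. length \<gamma> = length \<alpha> \<and> \<beta> = map2 (+) \<alpha> \<gamma>"
  using assms
proof (induction rule: list_all2_induct)
  case (Cons x xs y ys)
  then obtain \<gamma> where "length \<gamma> = length xs" "ys = map2 (+) xs \<gamma>" by blast
  then show ?case using Cons by (intro exI[of _ "(y - x) # \<gamma>"]) simp
qed simp

context cring
begin

primrec mon :: "'a list \<Rightarrow> nat list \<Rightarrow> 'a" where
  "mon [] \<alpha> = \<one>"
| "mon (a # as) \<alpha> = a [^] hd \<alpha> \<otimes> mon as (tl \<alpha>)"

lemma mon_closed: "set as \<subseteq> carrier R \<Longrightarrow> mon as \<alpha> \<in> carrier R"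
  by (induction as arbitrary: \<alpha>) auto

lemma mon_add:
  assumes "set as \<subseteq> carrier R" "length \<alpha> = length as" "length \<beta> = length as"
  shows "mon as (map2 (+) \<alpha> \<beta>) = mon as \<alpha> \<otimes> mon as \<beta>"
  using assms
proof (induction as arbitrary: \<alpha> \<beta>)
  case (Cons a as)
  then obtain k \<alpha>' l \<beta>' where *: "\<alpha> = k # \<alpha>'" "\<beta> = l # \<beta>'" "length \<alpha>' = length as" "length \<beta>' = length as"
    by (metis length_Suc_conv)
  have c: "a \<in> carrier R" "mon as \<alpha>' \<in> carrier R" "mon as \<beta>' \<in> carrier R"
    using Cons.prems mon_closed by auto
  have "mon (a # as) (map2 (+) \<alpha> \<beta>) = (a [^] k \<otimes> a [^] l) \<otimes> (mon as \<alpha>' \<otimes> mon as \<beta>')"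
    using Cons * c by (simp add: nat_pow_mult)
  also have "\<dots> = (a [^] k \<otimes> mon as \<alpha>') \<otimes> (a [^] l \<otimes> mon as \<beta>')"
    using c by (simp add: m_ac)
  finally show ?case using * by simp
qed simp

lemma mon_times_generator:
  assumes "set as \<subseteq> carrier R" "\<alpha> \<in> exponents (length as) m" "a \<in> set as"
  shows "\<exists>\<beta>\<in>exponents (length as) (Suc m). mon as \<beta> = mon as \<alpha> \<otimes> a"
  using assms
proof (induction as arbitrary: \<alpha> m)
  case (Cons b as)
  then obtain k \<alpha>' where *: "\<alpha> = k # \<alpha>'" "length \<alpha>' = length as" "k + sum_list \<alpha>' = m"
    by (auto simp: exponents_def length_Suc_conv)
  have c: "b \<in> carrier R" "a \<in> carrier R" "mon as \<alpha>' \<in> carrier R" using Cons.prems mon_closed by auto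
  show ?case
  proof (cases "a = b")
    case True
    show ?thesis
    proof (rule bexI[of _ "Suc k # \<alpha>'"])
      show "mon (b # as) (Suc k # \<alpha>') = mon (b # as) \<alpha> \<otimes> a"
        using * c True by (simp add: m_ac)
      show "Suc k # \<alpha>' \<in> exponents (length (b # as)) (Suc m)" using * by (simp add: exponents_def)
    qed
  next
    case False
    then obtain \<beta> where \<beta>: "\<beta> \<in> exponents (length as) (Suc (sum_list \<alpha>'))" "mon as \<beta> = mon as \<alpha>' \<otimes> a"
      using Cons.IH[of \<alpha>' "sum_list \<alpha>'"] Cons.prems * by (auto simp: exponents_def)
    show ?thesis
    proof (rule bexI[of _ "k # \<beta>"])
      show "mon (b # as) (k # \<beta>) = mon (b # as) \<alpha> \<otimes> a"
        using * c \<beta> by (simp add: m_ac)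
      show "k # \<beta> \<in> exponents (length (b # as)) (Suc m)" using * \<beta> by (simp add: exponents_def)
    qed
  qed
qed simp

lemma mon_split_generator:
  assumes "set as \<subseteq> carrier R" "\<beta> \<in> exponents (length as) (Suc m)"
  shows "\<exists>\<alpha>\<in>exponents (length as) m. \<exists>a\<in>set as. mon as \<beta> = mon as \<alpha> \<otimes> a"
  using assms
proof (induction as arbitrary: \<beta> m)
  case Nil
  then show ?case by (auto simp: exponents_def)
next
  case (Cons b as)
  then obtain k \<beta>' where *: "\<beta> = k # \<beta>'" "length \<beta>' = length as" "k + sum_list \<beta>' = Suc m"
    by (auto simp: exponents_def length_Suc_conv)
  have c: "b \<in> carrier R" "mon as \<beta>' \<in> carrier R" using Cons.prems mon_closed by auto
  show ?case
  proof (cases k)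
    case 0
    then obtain \<alpha> a where \<alpha>: "\<alpha> \<in> exponents (length as) m" "a \<in> set as" "mon as \<beta>' = mon as \<alpha> \<otimes> a"
      using Cons.IH[of \<beta>' m] Cons.prems * by (auto simp: exponents_def)
    have c': "a \<in> carrier R" "mon as \<alpha> \<in> carrier R" using \<alpha> Cons.prems mon_closed by auto
    show ?thesis
    proof (intro bexI[of _ "0 # \<alpha>"] bexI[of _ a])
      show "mon (b # as) \<beta> = mon (b # as) (0 # \<alpha>) \<otimes> a" using * 0 \<alpha> c c' by simp
    qed (use \<alpha> in \<open>auto simp: exponents_def\<close>)
  next
    case (Suc l)
    show ?thesis
    proof (intro bexI[of _ "l # \<beta>'"] bexI[of _ b])
      show "mon (b # as) \<beta> = mon (b # as) (l # \<beta>') \<otimes> b" using * Suc c by (simp add: m_ac)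
    qed (use * Suc in \<open>auto simp: exponents_def\<close>)
  qed
qed

lemma mon_zero: "set as \<subseteq> carrier R \<Longrightarrow> length \<alpha> = length as \<Longrightarrow> sum_list \<alpha> = 0 \<Longrightarrow> mon as \<alpha> = \<one>"
proof (induction as arbitrary: \<alpha>)
  case (Cons a as)
  then show ?case by (cases \<alpha>) auto
qed simp

lemma ideal_power_eq_Idl_mon:
  assumes "set as \<subseteq> carrier R"
  shows "ideal_power R (Idl (set as)) m = Idl (mon as ` exponents (length as) m)"
proof (induction m)
  case 0
  have "replicate (length as) 0 \<in> exponents (length as) 0" by (simp add: exponents_def sum_list_replicate)
  moreover have "mon as \<alpha> = \<one>" if "\<alpha> \<in> exponents (length as) 0" for \<alpha>
    using mon_zero[OF assms] that by (simp add: exponents_def)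
  ultimately have "mon as ` exponents (length as) 0 = {\<one>}" by force
  then show ?case by (simp only: ideal_power_0 genideal_one)
next
  case (Suc m)
  have c: "mon as ` exponents (length as) m \<subseteq> carrier R" using mon_closed[OF assms] by auto
  have eq: "{s \<otimes> t | s t. s \<in> mon as ` exponents (length as) m \<and> t \<in> set as} = mon as ` exponents (length as) (Suc m)"
  proof (intro subset_antisym subsetI)
    fix z assume "z \<in> {s \<otimes> t | s t. s \<in> mon as ` exponents (length as) m \<and> t \<in> set as}"
    then obtain \<alpha> a where "\<alpha> \<in> exponents (length as) m" "a \<in> set as" "z = mon as \<alpha> \<otimes> a" by blast
    then show "z \<in> mon as ` exponents (length as) (Suc m)"
      using mon_times_generator[OF assms] by (metis image_eqI)
  next
    fix z assume "z \<in> mon as ` exponents (length as) (Suc m)"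
    then obtain \<beta> where "\<beta> \<in> exponents (length as) (Suc m)" "z = mon as \<beta>" by blast
    then show "z \<in> {s \<otimes> t | s t. s \<in> mon as ` exponents (length as) m \<and> t \<in> set as}"
      using mon_split_generator[OF assms, of \<beta> m] by blast
  qed
  show ?case unfolding ideal_power_Suc Suc Idl_prod[OF c assms] eq ..
qed

lemma generated_by_ideal_power:
  assumes "set xs \<subseteq> carrier R" "length xs = Suc j"
  shows "generated_by (hbinom j (Suc m)) (ideal_power R (Idl (set xs)) m)"
  unfolding generated_by_def ideal_power_eq_Idl_mon[OF assms(1)] assms(2)
  using card_image_le[OF finite_exponents, of "mon xs" "Suc j" m] mon_closed[OF assms(1)]
  by (intro exI[of _ "mon xs ` exponents (Suc j) m"]) (auto simp: finite_exponents card_exponents)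

end

context noetherian_local_ring
begin

text \<open>J^k / J^(k+1) has at most C(k+j, j) generators and is killed by J; summing over k < m
  gives the binomial of one degree higher.\<close>

lemma colength_ideal_power_le:
  assumes xs: "set xs \<subseteq> carrier R" "length xs = Suc j" and J: "mm_primary (Idl (set xs))"
  shows "colength R (ideal_power R (Idl (set xs)) m) \<le> colength R (Idl (set xs)) * hbinom (Suc j) m"
proof (induction m)
  case 0
  then show ?case by (simp add: ideal_power_0 colength_carrier)
next
  case (Suc m)
  have "colength R (ideal_power R (Idl (set xs)) (Suc m)) \<le>
      colength R (ideal_power R (Idl (set xs)) m) + hbinom j (Suc m) * colength R (Idl (set xs))"
    unfolding ideal_power_Suc
    by (intro colength_prod_le mm_primary_power J generated_by_ideal_power xs)
  then show ?case using Suc by (simp add: hbinom_Suc_Suc algebra_simps)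
qed

text \<open>The exact count behind \<open>colength_adjoin\<close>: in increasing order, each element
  contributes the colength of the colon by it of all that was adjoined before.\<close>

lemma colength_adjoin_ordered:
  fixes g :: "'i :: linorder \<Rightarrow> 'a"
  assumes A: "mm_primary A" and "finite S" "g ` S \<subseteq> carrier R"
  shows "colength R A = colength R (A <+> Idl (g ` S))
    + (\<Sum>s\<in>S. colength R (colon (A <+> Idl (g ` {t \<in> S. t < s})) (g s)))"
  using assms(2,3)
proof (induction S rule: finite_linorder_max_induct)
  case empty
  then show ?case using sum_absorb[OF mm_primaryD[OF A] zeroideal] ideal_closed(2)[OF mm_primaryD[OF A]]
    by (simp add: Idl_empty)
next
  case (insert b S)
  have b: "g b \<in> carrier R" and S: "g ` S \<subseteq> carrier R" using insert by auto
  have iA: "ideal A R" using A mm_primaryD by blast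
  have iS: "ideal (Idl (g ` S)) R" by (rule genideal_ideal[OF S])
  have pr: "mm_primary (A <+> Idl (g ` S))" by (rule mm_primary_sum[OF A iS])
  have eq: "A <+> Idl (g ` insert b S) = (A <+> Idl (g ` S)) <+> PIdl (g b)"
    unfolding image_insert Idl_insert[OF S b] by (rule sum_assoc[symmetric, OF iA iS cgenideal_ideal[OF b]])
  have "{t \<in> insert b S. t < b} = S" using insert by auto
  moreover have "{t \<in> insert b S. t < s} = {t \<in> S. t < s}" if "s \<in> S" for s using insert that by auto
  moreover have "b \<notin> S" using insert by auto
  ultimately have "(\<Sum>s\<in>insert b S. colength R (colon (A <+> Idl (g ` {t \<in> insert b S. t < s})) (g s))) =
    colength R (colon (A <+> Idl (g ` S)) (g b)) +
    (\<Sum>s\<in>S. colength R (colon (A <+> Idl (g ` {t \<in> S. t < s})) (g s)))"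
    using insert.hyps by simp
  moreover have "colength R A = colength R (A <+> Idl (g ` S))
    + (\<Sum>s\<in>S. colength R (colon (A <+> Idl (g ` {t \<in> S. t < s})) (g s)))"
    using insert by auto
  ultimately show ?case using mm_primary_colength_sum_PIdl[OF pr b] eq by simp
qed

end

locale primary_generators = noetherian_local_ring +
  fixes as :: "'a list" and I :: "'a set"
  assumes gens_closed: "set as \<subseteq> carrier R" and I_eq: "I = Idl (set as)" and I_primary: "mm_primary I"
    and I_subset: "I \<subseteq> \<mm>"
begin

abbreviation pow :: "nat \<Rightarrow> 'a set" where "pow m \<equiv> ideal_power R I m"

lemma I_ideal: "ideal I R"
  using I_primary mm_primaryD by blast

lemma pow_ideal: "ideal (pow m) R"
  by (rule ideal_ideal_power[OF I_ideal])

lemma pow_primary: "mm_primary (pow m)"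
  by (rule mm_primary_power[OF I_primary])

lemma pow_eq: "pow m = Idl (mon as ` exponents (length as) m)"
  unfolding I_eq by (rule ideal_power_eq_Idl_mon[OF gens_closed])

lemma mon_mem_pow: "length \<alpha> = length as \<Longrightarrow> mon as \<alpha> \<in> pow (sum_list \<alpha>)"
  unfolding pow_eq using genideal_self[of "mon as ` exponents (length as) (sum_list \<alpha>)"] mon_closed[OF gens_closed]
  by (auto simp: exponents_def)

lemma mult_pow: "a \<in> I \<Longrightarrow> z \<in> pow m \<Longrightarrow> a \<otimes> z \<in> pow (Suc m)"
  unfolding ideal_power_Suc ideal_prod_commute[OF pow_ideal I_ideal] by (rule ideal_prod.prod)

text \<open>Homogeneous ideals \<open>\<Oplus>\<^sub>m N m\<close> of the Rees algebra of \<open>I\<close>.\<close>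

definition rees_ideal :: "(nat \<Rightarrow> 'a set) \<Rightarrow> bool" where
  "rees_ideal N \<longleftrightarrow> (\<forall>m. ideal (N m) R \<and> N m \<subseteq> pow m \<and> (\<forall>a\<in>I. \<forall>z\<in>N m. a \<otimes> z \<in> N (Suc m)))"

lemma rees_idealD:
  assumes "rees_ideal N"
  shows "ideal (N m) R" "N m \<subseteq> pow m" "a \<in> I \<Longrightarrow> z \<in> N m \<Longrightarrow> a \<otimes> z \<in> N (Suc m)"
  using assms unfolding rees_ideal_def by auto

lemma rees_ideal_pow:
  assumes N: "rees_ideal N"
  shows "p \<in> pow k \<Longrightarrow> z \<in> N m \<Longrightarrow> p \<otimes> z \<in> N (m + k)"
proof (induction k arbitrary: m p z)
  case 0
  then show ?case using ideal_closed(7)[OF rees_idealD(1)[OF N]] by (simp add: ideal_power_0)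
next
  case (Suc k)
  have zc: "z \<in> carrier R" using Suc.prems(2) ideal_closed(3)[OF rees_idealD(1)[OF N]] by blast
  have "pow k \<cdot> I \<subseteq> colon (N (m + Suc k)) z"
  proof (rule prod_least[OF ideal_colon[OF rees_idealD(1)[OF N] zc]])
    fix q a assume qa: "q \<in> pow k" "a \<in> I"
    have c: "q \<in> carrier R" "a \<in> carrier R" using qa ideal_closed(3) pow_ideal I_ideal by blast+
    have "q \<otimes> (a \<otimes> z) \<in> N (Suc m + k)" by (intro Suc.IH qa rees_idealD(3)[OF N] Suc.prems(2))
    then show "q \<otimes> a \<in> colon (N (m + Suc k)) z" using c zc by (simp add: colon_def m_assoc)
  qed
  then show ?case using Suc.prems(1) by (auto simp: ideal_power_Suc colon_def)
qed

text \<open>The coefficients of the lexicographically leading monomial \<open>\<alpha>\<close> in the elements of \<open>N\<close>.\<close>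

definition lower :: "nat list \<Rightarrow> 'a set" where
  "lower \<alpha> = Idl (mon as ` {\<beta> \<in> exponents (length as) (sum_list \<alpha>). \<beta> < \<alpha>})"

text \<open>The monomials are elements of R and satisfy relations, so a leading coefficient makes
  sense only modulo N and the lower monomials; the colon takes this into account.\<close>

definition lead_ideal :: "(nat \<Rightarrow> 'a set) \<Rightarrow> nat list \<Rightarrow> 'a set" where
  "lead_ideal N \<alpha> = colon (N (sum_list \<alpha>) <+> lower \<alpha>) (mon as \<alpha>)"

lemma mon_image_closed: "mon as ` S \<subseteq> carrier R"
  using mon_closed[OF gens_closed] by auto

lemma lower_ideal: "ideal (lower \<alpha>) R"
  unfolding lower_def by (rule genideal_ideal[OF mon_image_closed])

lemma sum_lower_ideal: "rees_ideal N \<Longrightarrow> ideal (N m <+> lower \<alpha>) R"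
  by (intro add_ideals rees_idealD lower_ideal)

lemma lead_ideal_ideal: "rees_ideal N \<Longrightarrow> ideal (lead_ideal N \<alpha>) R"
  unfolding lead_ideal_def by (intro ideal_colon sum_lower_ideal mon_closed gens_closed)

lemma lead_ideal_mono1:
  "(\<And>m. N m \<subseteq> N' m) \<Longrightarrow> lead_ideal N \<alpha> \<subseteq> lead_ideal N' \<alpha>"
  unfolding lead_ideal_def by (intro colon_mono sum_mono) auto

text \<open>The monomial with exponent \<beta> - \<alpha> carries N to N and the monomials below
  \<alpha> to monomials below \<beta>, and leaves the coefficient r alone.\<close>

lemma lead_ideal_mono2:
  assumes N: "rees_ideal N" and \<alpha>: "length \<alpha> = length as" "list_all2 (\<le>) \<alpha> \<beta>"
  shows "lead_ideal N \<alpha> \<subseteq> lead_ideal N \<beta>"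
proof
  obtain \<gamma> where \<gamma>: "length \<gamma> = length as" "\<beta> = map2 (+) \<alpha> \<gamma>" using list_all2_le_diff[OF \<alpha>(2)] \<alpha>(1) by auto
  have s: "sum_list \<beta> = sum_list \<alpha> + sum_list \<gamma>" using sum_list_map2_plus \<gamma> \<alpha> by simp
  have gc: "mon as \<gamma> \<in> carrier R" "mon as \<alpha> \<in> carrier R" using mon_closed[OF gens_closed] by auto
  have "lower \<alpha> \<subseteq> colon (lower \<beta>) (mon as \<gamma>)"
    unfolding lower_def[of \<alpha>]
  proof (intro genideal_minimal ideal_colon lower_ideal gc image_subsetI)
    fix \<delta> assume "\<delta> \<in> {\<beta> \<in> exponents (length as) (sum_list \<alpha>). \<beta> < \<alpha>}"
    then have \<delta>: "length \<delta> = length as" "sum_list \<delta> = sum_list \<alpha>" "\<delta> < \<alpha>" by (auto simp: exponents_def)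
    have "map2 (+) \<delta> \<gamma> < \<beta>" unfolding \<gamma>(2) by (rule map2_plus_less) (use \<delta> \<gamma> \<alpha> in auto)
    moreover have "map2 (+) \<delta> \<gamma> \<in> exponents (length as) (sum_list \<beta>)"
      using \<delta> \<gamma>(1) s sum_list_map2_plus[of \<delta> \<gamma>] by (simp add: exponents_def)
    ultimately have "map2 (+) \<delta> \<gamma> \<in> {\<delta> \<in> exponents (length as) (sum_list \<beta>). \<delta> < \<beta>}" by simp
    then have "mon as (map2 (+) \<delta> \<gamma>) \<in> lower \<beta>"
      unfolding lower_def by (intro subsetD[OF genideal_self[OF mon_image_closed]] imageI)
    then show "mon as \<delta> \<in> colon (lower \<beta>) (mon as \<gamma>)"
      using mon_add[OF gens_closed \<delta>(1) \<gamma>(1)] mon_closed[OF gens_closed] by (simp add: colon_def)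
  qed
  note low = this
  fix r assume "r \<in> lead_ideal N \<alpha>"
  then have r: "r \<in> carrier R" "r \<otimes> mon as \<alpha> \<in> N (sum_list \<alpha>) <+> lower \<alpha>"
    by (auto simp: lead_ideal_def colon_def)
  then obtain z w where z: "z \<in> N (sum_list \<alpha>)" "w \<in> lower \<alpha>" "r \<otimes> mon as \<alpha> = z \<oplus> w"
    unfolding mem_sum_iff by blast
  have c: "z \<in> carrier R" "w \<in> carrier R"
    using z ideal_closed(3) lower_ideal rees_idealD(1)[OF N] by blast+
  have "r \<otimes> mon as \<beta> = (r \<otimes> mon as \<alpha>) \<otimes> mon as \<gamma>"
    unfolding \<gamma>(2) mon_add[OF gens_closed \<alpha>(1) \<gamma>(1)] using r gc by (simp add: m_assoc)
  also have "\<dots> = mon as \<gamma> \<otimes> z \<oplus> w \<otimes> mon as \<gamma>"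
    unfolding z(3) using c gc by (simp add: l_distr m_comm[of z "mon as \<gamma>"])
  finally have "r \<otimes> mon as \<beta> = mon as \<gamma> \<otimes> z \<oplus> w \<otimes> mon as \<gamma>" .
  moreover have "mon as \<gamma> \<otimes> z \<in> N (sum_list \<beta>)"
    unfolding s by (intro rees_ideal_pow[OF N] mon_mem_pow \<gamma> z)
  moreover have "w \<otimes> mon as \<gamma> \<in> lower \<beta>" using low z(2) by (auto simp: colon_def)
  ultimately have "r \<otimes> mon as \<beta> \<in> N (sum_list \<beta>) <+> lower \<beta>" unfolding mem_sum_iff by blast
  then show "r \<in> lead_ideal N \<beta>" using r by (simp add: lead_ideal_def colon_def)
qed

text \<open>Adjoin the monomials of degree m to \<open>N m\<close> in lexicographic order; the
  result is I^m, and the colon met at each step is a leading coefficient ideal.\<close>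

lemma colength_rees_ideal:
  assumes N: "rees_ideal N" and pr: "mm_primary (N m)"
  shows "colength R (N m) = colength R (pow m) + (\<Sum>\<alpha>\<in>exponents (length as) m. colength R (lead_ideal N \<alpha>))"
proof -
  have "colength R (N m) = colength R (N m <+> Idl (mon as ` exponents (length as) m))
    + (\<Sum>\<alpha>\<in>exponents (length as) m. colength R (colon (N m <+> Idl (mon as ` {\<beta> \<in> exponents (length as) m. \<beta> < \<alpha>})) (mon as \<alpha>)))"
    by (intro colength_adjoin_ordered pr finite_exponents mon_image_closed)
  also have "N m <+> Idl (mon as ` exponents (length as) m) = pow m"
    unfolding pow_eq[symmetric] sum_comm[OF rees_idealD(1)[OF N] pow_ideal]
    by (rule sum_absorb[OF pow_ideal rees_idealD(1,2)[OF N]])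
  also have "(\<Sum>\<alpha>\<in>exponents (length as) m. colength R (colon (N m <+> Idl (mon as ` {\<beta> \<in> exponents (length as) m. \<beta> < \<alpha>})) (mon as \<alpha>)))
    = (\<Sum>\<alpha>\<in>exponents (length as) m. colength R (lead_ideal N \<alpha>))"
    by (rule sum.cong) (auto simp: lead_ideal_def lower_def exponents_def)
  finally show ?thesis .
qed

text \<open>l(I^m / N m) is a sum over exponents of colengths of leading coefficient ideals. These
  ideals grow with the exponent, so \<open>ev_poly_sum_exponents\<close> applies.\<close>

lemma ev_poly_rees_ideal:
  assumes N: "rees_ideal N" and pr: "\<And>m. mm_primary (N m)"
  shows "ev_poly (length as) (\<lambda>m. int (colength R (N m)) - int (colength R (pow m)))"
proof -
  have "ev_poly (length as) (\<lambda>m. \<Sum>\<alpha>\<in>exponents (length as) m. int (colength R (lead_ideal N \<alpha>)))"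
  proof (rule ev_poly_sum_exponents)
    fix \<alpha> \<beta> :: "nat list"
    assume *: "length \<alpha> = length as" "list_all2 (\<le>) \<alpha> \<beta>"
    have "mm_primary (lead_ideal N \<alpha>)"
      unfolding lead_ideal_def
      by (intro mm_primary_colon mm_primary_sum pr lower_ideal mon_closed gens_closed)
    then show "colength R (lead_ideal N \<beta>) \<le> colength R (lead_ideal N \<alpha>)"
      by (rule colength_mono[OF _ lead_ideal_ideal[OF N] lead_ideal_mono2[OF N *]])
  qed
  then show ?thesis using colength_rees_ideal[OF N pr] by simp
qed

text \<open>For N m = I^(m+1) the lengths l(I^m / N m) form the first difference of l(R/I^m), which
  raises the order by one.\<close>

lemma ev_poly_colength_pow: "ev_poly (Suc (length as)) (\<lambda>m. int (colength R (pow m)))"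
proof -
  have "rees_ideal (\<lambda>m. pow (Suc m))"
    unfolding rees_ideal_def
  proof (intro allI conjI ballI)
    show "pow (Suc m) \<subseteq> pow m" for m by (rule ideal_power_antimono[OF I_ideal]) simp
    show "a \<otimes> z \<in> pow (Suc (Suc m))" if "a \<in> I" "z \<in> pow (Suc m)" for m a z using that by (rule mult_pow)
  qed (rule pow_ideal)
  from ev_poly_rees_ideal[OF this pow_primary] show ?thesis by simp
qed

text \<open>Here N m = \<mm> I^m, and l(I^m / \<mm> I^m) = mu(I^m).\<close>

lemma ev_poly_min_gens_pow: "ev_poly (length as) (\<lambda>m. int (min_gens R (pow m)))"
proof -
  have "rees_ideal (\<lambda>m. \<mm> \<cdot> pow m)"
    unfolding rees_ideal_def
  proof (intro allI conjI ballI)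
    show "ideal (\<mm> \<cdot> pow m) R" for m by (intro ideal_prod_is_ideal \<mm>_ideal pow_ideal)
    show "\<mm> \<cdot> pow m \<subseteq> pow m" for m by (intro prod_subset2 \<mm>_ideal pow_ideal)
    fix m a z assume az: "a \<in> I" "z \<in> \<mm> \<cdot> pow m"
    have "z \<in> carrier R" "a \<in> carrier R"
      using az ideal_closed(3) I_ideal ideal_prod_is_ideal[OF \<mm>_ideal pow_ideal] by blast+
    then have "a \<otimes> z = z \<otimes> a" using m_comm by simp
    also have "\<dots> \<in> (\<mm> \<cdot> pow m) \<cdot> I" using az by (intro ideal_prod.prod)
    also have "\<dots> = \<mm> \<cdot> pow (Suc m)"
      unfolding ideal_power_Suc by (intro ideal_prod_assoc \<mm>_ideal pow_ideal I_ideal)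
    finally show "a \<otimes> z \<in> \<mm> \<cdot> pow (Suc m)" .
  qed
  from ev_poly_rees_ideal[OF this mm_primary_prod[OF mm_primary_\<mm> pow_primary]]
  show ?thesis unfolding min_gens_eq[OF pow_primary, symmetric] by simp
qed

text \<open>Let an element of N' be congruent modulo N to a combination of an initial segment of
  monomials. The coefficient of its largest monomial is a leading coefficient of N', hence of N, so
  this monomial can be removed; once the segment is empty, the element lies in N.\<close>

lemma rees_ideal_eqI:
  assumes N: "rees_ideal N" "rees_ideal N'" and le: "\<And>m. N m \<subseteq> N' m"
    and L: "\<And>\<alpha>. length \<alpha> = length as \<Longrightarrow> lead_ideal N' \<alpha> = lead_ideal N \<alpha>"
  shows "N' m = N m"
proof -
  let ?E = "exponents (length as) m"
  \<comment> \<open>S has to be closed downwards, so that what remains below its maximum b spans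
    exactly \<open>lower b\<close>.\<close>
  have "finite S \<Longrightarrow> S \<subseteq> ?E \<Longrightarrow> (\<And>s t. s \<in> S \<Longrightarrow> t \<in> ?E \<Longrightarrow> t < s \<Longrightarrow> t \<in> S) \<Longrightarrow>
      N' m \<inter> (N m <+> Idl (mon as ` S)) \<subseteq> N m" for S
  proof (induction S rule: finite_linorder_max_induct)
    case empty
    then show ?case using sum_absorb[OF rees_idealD(1)[OF N(1)] zeroideal] ideal_closed(2)[OF rees_idealD(1)[OF N(1)]]
      by (simp add: Idl_empty)
  next
    case (insert b S)
    have bE: "b \<in> ?E" using insert.prems by blast
    have S: "S = {\<beta> \<in> ?E. \<beta> < b}" using insert by blast
    have IH: "N' m \<inter> (N m <+> Idl (mon as ` S)) \<subseteq> N m"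
    proof (rule insert.IH)
      fix s t assume "s \<in> S" "t \<in> ?E" "t < s"
      then show "t \<in> S" using S by auto
    qed (use insert.prems in blast)
    have b: "length b = length as" "sum_list b = m" using bE by (auto simp: exponents_def)
    have low: "lower b = Idl (mon as ` S)" unfolding lower_def S b(2) ..
    have bc: "mon as b \<in> carrier R" by (rule mon_closed[OF gens_closed])
    have iN: "ideal (N m) R" "ideal (N' m) R" using N rees_idealD(1) by auto
    show ?case
    proof
      fix z assume z: "z \<in> N' m \<inter> (N m <+> Idl (mon as ` insert b S))"
      have "N m <+> Idl (mon as ` insert b S) = (N m <+> lower b) <+> PIdl (mon as b)"
        unfolding image_insert Idl_insert[OF mon_image_closed bc] low
        by (intro sum_assoc[symmetric] iN genideal_ideal mon_image_closed cgenideal_ideal bc)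
      then have "z \<in> (N m <+> lower b) <+> PIdl (mon as b)" using z by simp
      then obtain w r where w: "w \<in> N m <+> lower b" "r \<in> carrier R" "z = w \<oplus> r \<otimes> mon as b"
        unfolding mem_sum_PIdl_iff by blast
      have i: "ideal (N m <+> lower b) R" "ideal (N' m <+> lower b) R" using sum_lower_ideal N by auto
      have c: "w \<in> carrier R" "z \<in> carrier R" using w z ideal_closed(3) i iN by auto
      have "z \<in> N' m <+> lower b" "w \<in> N' m <+> lower b"
        using sum_upper1[OF iN(2) lower_ideal] z w(1) sum_mono[OF le order_refl] by blast+
      then have "z \<ominus> w \<in> N' m <+> lower b" by (rule ideal_closed(5)[OF i(2)])
      moreover have "z \<ominus> w = r \<otimes> mon as b" unfolding w(3) using c w(2) bc by algebra
      ultimately have "r \<in> lead_ideal N' b" using w(2) b(2) by (simp add: lead_ideal_def colon_def)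
      then have "r \<in> lead_ideal N b" using L[OF b(1)] by simp
      then have "r \<otimes> mon as b \<in> N m <+> lower b" using b(2) by (simp add: lead_ideal_def colon_def)
      then have "z \<in> N m <+> lower b" unfolding w(3) by (rule ideal_closed(4)[OF i(1) w(1)])
      then show "z \<in> N m" using IH z low by auto
    qed
  qed
  from this[OF finite_exponents order_refl]
  have "N' m \<inter> (N m <+> pow m) \<subseteq> N m" unfolding pow_eq by blast
  moreover have "N' m \<subseteq> N m <+> pow m"
    using rees_idealD(2)[OF N(2)] sum_upper2[OF rees_idealD(1)[OF N(1)] pow_ideal] by blast
  ultimately show ?thesis using le by blast
qed

text \<open>The Hilbert basis theorem for homogeneous ideals of the Rees algebra: the leading
  coefficient ideals stabilize uniformly in the exponent, which stabilizes the ideals in all degrees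
  at once.\<close>

lemma rees_ideal_chain_stabilizes:
  assumes N: "\<And>i :: nat. rees_ideal (N i)" "\<And>i m. N i m \<subseteq> N (Suc i) m"
  shows "\<exists>k. \<forall>j\<ge>k. N j = N k"
proof -
  have "\<exists>k. \<forall>t\<ge>k. \<forall>\<alpha>. length \<alpha> = length as \<longrightarrow> lead_ideal (N t) \<alpha> = lead_ideal (N k) \<alpha>"
  proof (rule monotone_exponent_families_stabilize[where \<S> = "{A. ideal A R}"])
    show "\<exists>k. A (Suc k) = A k" if "\<And>i. A i \<in> {A. ideal A R}" "\<And>i. A i \<subseteq> A (Suc i)" for A :: "nat \<Rightarrow> 'a set"
      using ideal_chain_stabilizes[of A] that by (metis le_SucI mem_Collect_eq order_refl)
    show "lead_ideal (N t) \<alpha> \<in> {A. ideal A R}" for t \<alpha> using lead_ideal_ideal[OF N(1)] by simp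
    show "lead_ideal (N t) \<alpha> \<subseteq> lead_ideal (N (Suc t)) \<alpha>" for t \<alpha> by (rule lead_ideal_mono1[OF N(2)])
    show "lead_ideal (N t) \<alpha> \<subseteq> lead_ideal (N t) \<beta>" if "length \<alpha> = length as" "list_all2 (\<le>) \<alpha> \<beta>" for t \<alpha> \<beta>
      by (rule lead_ideal_mono2[OF N(1) that])
  qed
  then obtain k where k: "\<And>t \<alpha>. t \<ge> k \<Longrightarrow> length \<alpha> = length as \<Longrightarrow> lead_ideal (N t) \<alpha> = lead_ideal (N k) \<alpha>"
    by blast
  have "N j m = N k m" if "j \<ge> k" for j m
  proof (rule rees_ideal_eqI[OF N(1) N(1)])
    show "N k m \<subseteq> N j m" for m
      using that by (rule lift_Suc_mono_le[of "\<lambda>i. N i m", OF N(2)])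
  qed (use k[OF that] in simp)
  then show ?thesis by (intro exI[of _ k]) blast
qed

end

section \<open>General elements\<close>

context cring
begin

primrec horner :: "'a list \<Rightarrow> 'a \<Rightarrow> 'a" where
  "horner [] u = \<zero>"
| "horner (a # as) u = a \<oplus> u \<otimes> horner as u"

lemma horner_closed: "set as \<subseteq> carrier R \<Longrightarrow> u \<in> carrier R \<Longrightarrow> horner as u \<in> carrier R"
  by (induction as) auto

lemma horner_mem: "ideal B R \<Longrightarrow> set as \<subseteq> B \<Longrightarrow> u \<in> carrier R \<Longrightarrow> horner as u \<in> B"
  by (induction as) (auto simp: ideal_closed)

text \<open>The quotient of the polynomial with coefficients \<open>as\<close> by \<open>X - v\<close>.\<close>

primrec horner_quot :: "'a list \<Rightarrow> 'a \<Rightarrow> 'a list" where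
  "horner_quot [] v = []"
| "horner_quot (a # as) v = (if as = [] then [] else horner as v # horner_quot as v)"

lemma length_horner_quot: "length (horner_quot as v) = length as - 1"
  by (induction as) auto

lemma set_horner_quot: "set as \<subseteq> carrier R \<Longrightarrow> v \<in> carrier R \<Longrightarrow> set (horner_quot as v) \<subseteq> carrier R"
  by (induction as) (auto simp: horner_closed)

lemma horner_diff:
  assumes "set as \<subseteq> carrier R" "u \<in> carrier R" "v \<in> carrier R"
  shows "horner as u \<ominus> horner as v = (u \<ominus> v) \<otimes> horner (horner_quot as v) u"
  using assms(1)
proof (induction as)
  case Nil
  then show ?case using assms by simp algebra
next
  case (Cons a as)
  show ?case
  proof (cases "as = []")
    case True
    then show ?thesis using Cons assms by simp algebra
  next
    case False
    define p q w where "p = horner as u" and "q = horner as v" and "w = horner (horner_quot as v) u"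
    have c: "p \<in> carrier R" "q \<in> carrier R" "w \<in> carrier R" "a \<in> carrier R"
      unfolding p_def q_def w_def using Cons.prems assms(2,3)
      by (auto intro!: horner_closed dest: subsetD[OF set_horner_quot])
    have IH: "p \<ominus> q = (u \<ominus> v) \<otimes> w" using Cons unfolding p_def q_def w_def by simp
    have "(a \<oplus> u \<otimes> p) \<ominus> (a \<oplus> v \<otimes> q) = u \<otimes> (p \<ominus> q) \<oplus> (u \<ominus> v) \<otimes> q"
      using c assms by algebra
    also have "\<dots> = (u \<ominus> v) \<otimes> (q \<oplus> u \<otimes> w)" unfolding IH using c assms by algebra
    finally show ?thesis using False unfolding p_def q_def w_def by simp
  qed
qed

text \<open>Division is reversible: p = p(v) + (X - v) q expresses the coefficients of p through
  p(v) and those of q.\<close>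

lemma horner_quot_mem:
  assumes B: "ideal B R" and "set as \<subseteq> carrier R" "v \<in> carrier R"
    and "set (horner_quot as v) \<subseteq> B" "horner as v \<in> B"
  shows "set as \<subseteq> B"
  using assms(2,4,5)
proof (induction as)
  case (Cons a as)
  have a: "a \<in> carrier R" using Cons by simp
  show ?case
  proof (cases "as = []")
    case True
    then show ?thesis using Cons a assms by simp
  next
    case False
    then have h: "horner as v \<in> B" "set as \<subseteq> B" using Cons by auto
    have hc: "horner as v \<in> carrier R" using horner_closed Cons.prems assms(3) by auto
    have "(a \<oplus> v \<otimes> horner as v) \<ominus> v \<otimes> horner as v \<in> B"
      using Cons.prems(3) h assms(3) by (intro ideal_closed(5)[OF B] ideal_closed(7)[OF B]) auto
    moreover have "(a \<oplus> v \<otimes> horner as v) \<ominus> v \<otimes> horner as v = a" using a hc assms(3) by algebra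
    ultimately show ?thesis using h by simp
  qed
qed simp

text \<open>Divided differences do the work of the Vandermonde determinant: in p(u) - p(v) = (u - v)
  q(u) the unit u - v can be cancelled, which leaves the quotient q with one coefficient and one
  node fewer.\<close>

lemma horner_coefficients_mem:
  assumes B: "ideal B R"
  shows "set as \<subseteq> carrier R \<Longrightarrow> finite S \<Longrightarrow> S \<subseteq> carrier R \<Longrightarrow> card S = length as \<Longrightarrow>
    (\<And>u v. u \<in> S \<Longrightarrow> v \<in> S \<Longrightarrow> u \<noteq> v \<Longrightarrow> \<exists>y\<in>carrier R. y \<otimes> (u \<ominus> v) = \<one>) \<Longrightarrow>
    (\<And>u. u \<in> S \<Longrightarrow> horner as u \<in> B) \<Longrightarrow> set as \<subseteq> B"
proof (induction "length as" arbitrary: as S)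
  case (Suc n)
  then obtain v where v: "v \<in> S" by fastforce
  have vc: "v \<in> carrier R" using v Suc.prems by blast
  have "set (horner_quot as v) \<subseteq> B"
  proof (rule Suc.hyps(1)[of _ "S - {v}"])
    show "n = length (horner_quot as v)" using Suc.hyps(2) by (simp add: length_horner_quot)
    show "card (S - {v}) = length (horner_quot as v)" using Suc v by (simp add: length_horner_quot)
    show "set (horner_quot as v) \<subseteq> carrier R" by (rule set_horner_quot[OF Suc.prems(1) vc])
    show "horner (horner_quot as v) u \<in> B" if u: "u \<in> S - {v}" for u
    proof -
      have uc: "u \<in> carrier R" using u Suc.prems by blast
      obtain y where y: "y \<in> carrier R" "y \<otimes> (u \<ominus> v) = \<one>" using Suc.prems(5)[of u v] u v by blast
      define w where "w = horner (horner_quot as v) u"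
      have wc: "w \<in> carrier R" unfolding w_def by (intro horner_closed set_horner_quot Suc.prems vc uc)
      have "horner as u \<ominus> horner as v \<in> B" using u v Suc.prems(6) by (intro ideal_closed(5)[OF B]) auto
      then have "y \<otimes> ((u \<ominus> v) \<otimes> w) \<in> B"
        unfolding horner_diff[OF Suc.prems(1) uc vc] w_def by (intro ideal_closed(7)[OF B y(1)])
      moreover have "y \<otimes> ((u \<ominus> v) \<otimes> w) = w" using y wc uc vc by (simp flip: m_assoc)
      ultimately show ?thesis unfolding w_def by simp
    qed
  qed (use Suc.prems in auto)
  then show ?case by (rule horner_quot_mem[OF B Suc.prems(1) vc _ Suc.prems(6)[OF v]])
qed simp

definition nonzerodiv_mod :: "'a set \<Rightarrow> 'a \<Rightarrow> bool" where
  "nonzerodiv_mod K x \<longleftrightarrow> (\<forall>a\<in>carrier R. x \<otimes> a \<in> K \<longrightarrow> a \<in> K)"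

lemma nonzerodiv_mod_pow:
  assumes "nonzerodiv_mod K y" "y \<in> carrier R"
  shows "nonzerodiv_mod K (y [^] (k :: nat))"
proof (induction k)
  case 0
  show ?case by (simp add: nonzerodiv_mod_def)
next
  case (Suc k)
  show ?case
    unfolding nonzerodiv_mod_def
  proof (intro ballI impI)
    fix a assume a: "a \<in> carrier R" "y [^] Suc k \<otimes> a \<in> K"
    then have "y [^] k \<otimes> (y \<otimes> a) \<in> K" using assms(2) by (simp add: m_assoc)
    then have "y \<otimes> a \<in> K" using Suc a(1) assms(2) unfolding nonzerodiv_mod_def by simp
    then show "a \<in> K" using assms a(1) unfolding nonzerodiv_mod_def by blast
  qed
qed

end

text \<open>Differences of distinct nodes are units of the local ring, as the division by u - v
  requires.\<close>

locale generic_elements = primary_generators +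
  fixes U :: "'a set"
  assumes U_closed: "U \<subseteq> carrier R"
    and U_infinite: "infinite U"
    and U_diff: "\<And>u v. u \<in> U \<Longrightarrow> v \<in> U \<Longrightarrow> u \<noteq> v \<Longrightarrow> u \<ominus> v \<notin> \<mm>"
begin

definition gen :: "'a \<Rightarrow> 'a" where "gen u = horner as u"

lemma gen_mem: "u \<in> U \<Longrightarrow> gen u \<in> I"
  unfolding gen_def using genideal_self[OF gens_closed] U_closed I_eq by (intro horner_mem I_ideal) auto

lemma gen_closed: "u \<in> U \<Longrightarrow> gen u \<in> carrier R"
  using gen_mem ideal_closed(3)[OF I_ideal] by blast

lemma I_subset_if_gen_mem:
  assumes "S \<subseteq> U" "finite S" "card S = length as" "ideal B R" "\<And>u. u \<in> S \<Longrightarrow> gen u \<in> B"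
  shows "I \<subseteq> B"
  unfolding I_eq
proof (rule genideal_minimal[OF assms(4)], rule horner_coefficients_mem[OF assms(4) gens_closed assms(2) _ assms(3)])
  show "\<exists>y\<in>carrier R. y \<otimes> (u \<ominus> v) = \<one>" if "u \<in> S" "v \<in> S" "u \<noteq> v" for u v
    using unit_outside_\<mm>[of "u \<ominus> v"] U_diff[of u v] U_closed that assms(1) by auto
qed (use assms U_closed in \<open>auto simp: gen_def\<close>)

lemma I_eq_Idl_gen:
  assumes "S \<subseteq> U" "finite S" "card S = length as"
  shows "I = Idl (gen ` S)"
proof
  have c: "gen ` S \<subseteq> carrier R" using gen_closed assms by auto
  show "I \<subseteq> Idl (gen ` S)"
    using genideal_self[OF c] by (intro I_subset_if_gen_mem[of S] assms genideal_ideal c) auto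
  show "Idl (gen ` S) \<subseteq> I" using gen_mem assms by (intro genideal_minimal I_ideal) auto
qed

text \<open>If n general elements carry z into K, then I z \<subseteq> K; a power y^k lies in I, so
  y^k z \<in> K and hence z \<in> K. Thus a single nonzerodivisor in \<mm> makes almost all general
  elements of I nonzerodivisors modulo K.\<close>

lemma finite_zerodivisors_mod:
  assumes K: "ideal K R" and y: "y \<in> \<mm>" "nonzerodiv_mod K y"
  shows "finite {u \<in> U. \<not> nonzerodiv_mod K (gen u)}"
proof -
  have "finite {u \<in> U. \<exists>z\<in>carrier R - K. gen u \<otimes> z \<in> K}"
  proof (rule cofinite_regular[where \<L> = "{A. ideal A R}" and n = "length as"])
    show "wf {(M, N). M \<in> {A. ideal A R} \<and> N \<in> {A. ideal A R} \<and> N \<subset> M}"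
      using wf_ideals by (rule wf_subset) auto
    show "{z \<in> carrier R. \<forall>u\<in>S. gen u \<otimes> z \<in> N} \<in> {A. ideal A R}"
      if "N \<in> {A. ideal A R}" "S \<subseteq> U" for N S
      using ideal_multipliers[OF oneideal, of N "gen ` S"] that gen_closed by auto
    show "gen u \<otimes> (gen v \<otimes> z) = gen v \<otimes> (gen u \<otimes> z)" if "u \<in> U" "v \<in> U" "z \<in> carrier R" for u v z
      using that gen_closed by (simp add: m_lcomm)
    show "z \<in> K" if S: "S \<subseteq> U" "card S = length as" "finite S" and z: "z \<in> carrier R" "\<forall>u\<in>S. gen u \<otimes> z \<in> K" for S z
    proof -
      have "I \<subseteq> colon K z"
        using z S gen_closed by (intro I_subset_if_gen_mem[of S] ideal_colon K) (auto simp: colon_def)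
      moreover obtain k :: nat where "y [^] k \<in> I" using I_primary y(1) unfolding mm_primary_def by blast
      ultimately have "y [^] k \<otimes> z \<in> K" by (auto simp: colon_def)
      then show ?thesis
        using nonzerodiv_mod_pow[OF y(2) ideal_closed(3)[OF \<mm>_ideal y(1)]] z(1) unfolding nonzerodiv_mod_def by blast
    qed
  qed (use K gen_closed ideal_closed in auto)
  then show ?thesis by (rule rev_finite_subset) (auto simp: nonzerodiv_mod_def)
qed

text \<open>Replace N by its saturation T, the elements that some power of I carries into N. Modulo
  T almost all general elements act injectively by \<open>cofinite_regular\<close>, and T agrees
  with N in large degrees because T is generated in bounded degrees; this is the origin of
  c.\<close>

lemma finite_not_superficial:
  assumes N: "rees_ideal N"
  shows "finite {u \<in> U. \<not> (\<exists>c. \<forall>m\<ge>c. \<forall>z\<in>pow m. gen u \<otimes> z \<in> N (Suc m) \<longrightarrow> z \<in> N m)}"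
proof -
  \<comment> \<open>The part of degree m that I^j carries into N; it grows with j and stabilizes in
    each degree.\<close>
  define T' where "T' j m = {z \<in> pow m. \<forall>p\<in>pow j. p \<otimes> z \<in> N (m + j)}" for j m
  define T where "T m = (\<Union>j. T' j m)" for m
  have pc: "z \<in> carrier R" if "z \<in> pow m" for z m using that ideal_closed(3)[OF pow_ideal] by blast
  have NI: "ideal (N m) R" for m by (rule rees_idealD(1)[OF N])
  have T'ideal: "ideal (T' j m) R" for j m
    unfolding T'_def by (rule ideal_multipliers[OF pow_ideal NI ideal_closed(1)[OF pow_ideal]])
  have T'step: "T' j m \<subseteq> T' (Suc j) m" for j m
  proof
    fix z assume z: "z \<in> T' j m"
    have zc: "z \<in> carrier R" using z pc unfolding T'_def by blast
    have "pow j \<cdot> I \<subseteq> colon (N (m + Suc j)) z"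
    proof (rule prod_least[OF ideal_colon[OF NI zc]])
      fix q a assume qa: "q \<in> pow j" "a \<in> I"
      have c: "q \<in> carrier R" "a \<in> carrier R" using qa pc ideal_closed(3)[OF I_ideal] by auto
      have "a \<otimes> (q \<otimes> z) \<in> N (Suc (m + j))" using z qa by (intro rees_idealD(3)[OF N]) (auto simp: T'_def)
      moreover have "a \<otimes> (q \<otimes> z) = (q \<otimes> a) \<otimes> z" using c zc by (simp add: m_ac)
      ultimately show "q \<otimes> a \<in> colon (N (m + Suc j)) z" using c by (simp add: colon_def)
    qed
    then show "z \<in> T' (Suc j) m" using z unfolding T'_def ideal_power_Suc by (auto simp: colon_def)
  qed
  have T'mono: "T' i m \<subseteq> T' j m" if "i \<le> j" for i j m
    using that by (rule lift_Suc_mono_le[of "\<lambda>j. T' j m", OF T'step])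
  have Tstab: "\<exists>j. T m = T' j m" for m
  proof -
    obtain k where "\<forall>j\<ge>k. T' j m = T' k m" using ideal_chain_stabilizes[of "\<lambda>j. T' j m", OF T'ideal T'step] by blast
    then have "T' j m \<subseteq> T' k m" for j using T'mono[of j k m] nle_le[of j k] by blast
    then show ?thesis unfolding T_def by (intro exI[of _ k]) blast
  qed
  have Tideal: "ideal (T m) R" for m using Tstab[of m] T'ideal by metis
  have T: "rees_ideal T"
    unfolding rees_ideal_def
  proof (intro allI conjI ballI Tideal)
    show "T m \<subseteq> pow m" for m unfolding T_def T'_def by blast
    fix m a z assume az: "a \<in> I" "z \<in> T m"
    then obtain j where j: "z \<in> T' j m" unfolding T_def by blast
    have c: "a \<in> carrier R" "z \<in> carrier R" using az ideal_closed(3) I_ideal Tideal by blast+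
    have "a \<otimes> z \<in> pow (Suc m)" using az(1) j by (intro mult_pow) (auto simp: T'_def)
    moreover have "p \<otimes> (a \<otimes> z) \<in> N (Suc m + j)" if "p \<in> pow j" for p
    proof -
      have "p \<otimes> (a \<otimes> z) = a \<otimes> (p \<otimes> z)" using c pc[OF that] by (simp add: m_lcomm)
      then show ?thesis using rees_idealD(3)[OF N az(1), of "p \<otimes> z" "m + j"] j that by (simp add: T'_def)
    qed
    ultimately show "a \<otimes> z \<in> T (Suc m)" unfolding T_def T'_def by blast
  qed
  have NT: "N m \<subseteq> T m" for m
  proof -
    have "N m \<subseteq> T' 0 m"
    proof
      fix z assume z: "z \<in> N m"
      then have "\<forall>p\<in>pow 0. p \<otimes> z \<in> N (m + 0)" using ideal_closed(7)[OF NI] by (simp add: ideal_power_0)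
      then show "z \<in> T' 0 m" unfolding T'_def using z rees_idealD(2)[OF N] by blast
    qed
    then show ?thesis unfolding T_def by blast
  qed
  obtain c where c: "\<And>m. m \<ge> c \<Longrightarrow> T m \<subseteq> N m"
  proof -
    \<comment> \<open>The homogeneous ideal generated by the components of T of degree at most k.
      Once this chain is stationary, T is generated in degrees up to k.\<close>
    define F where "F k m = (if m \<le> k then T m else pow (m - k) \<cdot> T k)" for k m
    have powT: "pow i \<cdot> T m \<subseteq> T (m + i)" for i m
      by (rule prod_least[OF Tideal rees_ideal_pow[OF T]])
    have F: "rees_ideal (F k)" for k
      unfolding rees_ideal_def
    proof (intro allI conjI ballI)
      show "ideal (F k m) R" for m unfolding F_def using Tideal ideal_prod_is_ideal pow_ideal by auto
      show "F k m \<subseteq> pow m" for m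
        using rees_idealD(2)[OF T, of m] powT[of "m - k" k] by (cases "m \<le> k") (simp_all add: F_def)
      fix m a z assume az: "a \<in> I" "z \<in> F k m"
      show "a \<otimes> z \<in> F k (Suc m)"
      proof (cases "m \<le> k")
        case True
        then have z: "z \<in> T m" using az by (simp add: F_def)
        show ?thesis
        proof (cases "m = k")
          case True
          have "pow (Suc m - k) = I" using True ideal_power_1[OF I_ideal] by simp
          then show ?thesis using True az z by (simp add: F_def del: nat_pow_Suc) (rule ideal_prod.prod)
        next
          case False
          then show ?thesis using True rees_idealD(3)[OF T az(1) z] by (simp add: F_def)
        qed
      next
        case False
        then have z: "z \<in> pow (m - k) \<cdot> T k" using az by (simp add: F_def)
        have ac: "a \<in> carrier R" "z \<in> carrier R"
          using az ideal_closed(3)[OF I_ideal] z ideal_closed(3)[OF ideal_prod_is_ideal[OF pow_ideal Tideal]] by auto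
        have "a \<otimes> z \<in> I \<cdot> (pow (m - k) \<cdot> T k)" by (rule ideal_prod.prod[OF az(1) z])
        also have "\<dots> = (I \<cdot> pow (m - k)) \<cdot> T k"
          by (rule ideal_prod_assoc[symmetric, OF I_ideal pow_ideal Tideal])
        also have "I \<cdot> pow (m - k) = pow (Suc m - k)"
          using False ideal_prod_commute[OF I_ideal pow_ideal] by (simp add: Suc_diff_le)
        finally show ?thesis using False by (simp add: F_def)
      qed
    qed
    have Fstep: "F k m \<subseteq> F (Suc k) m" for k m
    proof (cases "m \<le> k")
      case True
      then show ?thesis by (simp add: F_def)
    next
      case False
      show ?thesis
      proof (cases "m = Suc k")
        case True
        then show ?thesis using powT[of 1 k] by (simp add: F_def)
      next
        case F: False
        have "pow (m - k) = pow (m - Suc k) \<cdot> I" using False by (simp flip: ideal_power_Suc add: Suc_diff_Suc)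
        then have "pow (m - k) \<cdot> T k = pow (m - Suc k) \<cdot> (I \<cdot> T k)"
          using ideal_prod_assoc[OF pow_ideal I_ideal Tideal] by simp
        also have "\<dots> \<subseteq> pow (m - Suc k) \<cdot> T (Suc k)"
          by (intro prod_mono order_refl prod_least[OF Tideal]) (rule rees_idealD(3)[OF T])
        finally show ?thesis using False F by (simp add: F_def)
      qed
    qed
    obtain k where k: "\<And>j. j \<ge> k \<Longrightarrow> F j = F k"
      using rees_ideal_chain_stabilizes[of F, OF F Fstep] by blast
    \<comment> \<open>The exponent j for the single degree k suffices, since T m = I^(m-k) T k and
      I^(m-k) = I^j I^(m-k-j) for large m.\<close>
    obtain j where j: "T k = T' j k" using Tstab by blast
    have "T m \<subseteq> N m" if m: "m \<ge> k + j + 1" for m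
    proof -
      have "T m = F m m" by (simp add: F_def)
      also have "\<dots> = F k m" using k[of m] m by simp
      also have "\<dots> = pow (m - k) \<cdot> T k" using m by (simp add: F_def)
      also have "\<dots> \<subseteq> N m"
      proof (rule prod_least[OF NI])
        fix p z assume p: "p \<in> pow (m - k)" and z: "z \<in> T k"
        have zc: "z \<in> carrier R" using z ideal_closed(3)[OF Tideal] by blast
        have "pow j \<cdot> pow (m - k - j) \<subseteq> colon (N m) z"
        proof (rule prod_least[OF ideal_colon[OF NI zc]])
          fix q r assume qr: "q \<in> pow j" "r \<in> pow (m - k - j)"
          have "r \<otimes> (q \<otimes> z) \<in> N (k + j + (m - k - j))"
            by (rule rees_ideal_pow[OF N qr(2)]) (use z j qr in \<open>auto simp: T'_def\<close>)
          moreover have "r \<otimes> (q \<otimes> z) = (q \<otimes> r) \<otimes> z" using pc qr zc by (simp add: m_ac)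
          ultimately show "q \<otimes> r \<in> colon (N m) z" using pc qr m by (simp add: colon_def)
        qed
        moreover have "pow (m - k) = pow j \<cdot> pow (m - k - j)"
          using m by (simp flip: ideal_power_add[OF I_ideal])
        ultimately show "p \<otimes> z \<in> N m" using p by (auto simp: colon_def)
      qed
      finally show ?thesis .
    qed
    then show ?thesis using that by blast
  qed
  \<comment> \<open>Pairs of degree and element turn a homogeneous ideal into one set, to which the
    general principle applies with maps that raise the degree by one.\<close>
  define \<L> where "\<L> = {{(m, z). z \<in> M m} | M. rees_ideal M}"
  define X where "X = {(m, z). z \<in> pow m}"
  have fin: "finite {u \<in> U. \<exists>z\<in>X - {(m, z). z \<in> T m}. (case z of (m, z) \<Rightarrow> (Suc m, gen u \<otimes> z)) \<in> {(m, z). z \<in> T m}}"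
  proof (rule cofinite_regular[where \<L> = \<L> and n = "length as"])
    show "wf {(M, N). M \<in> \<L> \<and> N \<in> \<L> \<and> N \<subset> M}"
      unfolding wf_iff_no_infinite_down_chain
    proof
      assume "\<exists>f. \<forall>i. (f (Suc i), f i) \<in> {(M, N). M \<in> \<L> \<and> N \<in> \<L> \<and> N \<subset> M}"
      then obtain f where f: "\<And>i::nat. f i \<in> \<L>" "\<And>i. f i \<subset> f (Suc i)" by blast
      then have "\<forall>i. \<exists>M. rees_ideal M \<and> f i = {(m, z). z \<in> M m}" unfolding \<L>_def by blast
      then obtain M where M: "\<And>i. rees_ideal (M i)" "\<And>i. f i = {(m, z). z \<in> M i m}" by metis
      have "M i m \<subseteq> M (Suc i) m" for i m using f(2)[of i] M(2) by blast
      then obtain k where "\<forall>j\<ge>k. M j = M k" using rees_ideal_chain_stabilizes[of M] M(1) by blast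
      then have "M (Suc k) = M k" using le_SucI[OF order_refl] by blast
      then have "f (Suc k) = f k" unfolding M(2) by simp
      then show False using f(2)[of k] by blast
    qed
    show "M \<subseteq> X" if "M \<in> \<L>" for M using that rees_idealD(2) unfolding \<L>_def X_def by blast
    show "{z \<in> X. \<forall>u\<in>S. (case z of (m, z) \<Rightarrow> (Suc m, gen u \<otimes> z)) \<in> M} \<in> \<L>"
      if M: "M \<in> \<L>" and S: "S \<subseteq> U" for M S
    proof -
      obtain P where P: "rees_ideal P" "M = {(m, z). z \<in> P m}" using M unfolding \<L>_def by blast
      define Q where "Q m = {z \<in> pow m. \<forall>u\<in>S. gen u \<otimes> z \<in> P (Suc m)}" for m
      have g: "gen u \<in> carrier R" if "u \<in> S" for u using that S gen_closed by blast
      have PI: "ideal (P m) R" for m by (rule rees_idealD(1)[OF P(1)])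
      have "rees_ideal Q"
        unfolding rees_ideal_def
      proof (intro allI conjI ballI)
        show "ideal (Q m) R" for m
          unfolding Q_def using ideal_multipliers[OF pow_ideal PI, of "gen ` S"] g by auto
        show "Q m \<subseteq> pow m" for m unfolding Q_def by blast
        fix m a z assume az: "a \<in> I" "z \<in> Q m"
        have c: "a \<in> carrier R" "z \<in> carrier R" using az ideal_closed(3)[OF I_ideal] pc unfolding Q_def by auto
        have "a \<otimes> z \<in> pow (Suc m)" using az by (intro mult_pow) (auto simp: Q_def)
        moreover have "gen u \<otimes> (a \<otimes> z) \<in> P (Suc (Suc m))" if "u \<in> S" for u
          using rees_idealD(3)[OF P(1) az(1), of "gen u \<otimes> z" "Suc m"] az(2) that c g[OF that]
          by (simp add: Q_def m_lcomm)
        ultimately show "a \<otimes> z \<in> Q (Suc m)" unfolding Q_def by blast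
      qed
      moreover have "{z \<in> X. \<forall>u\<in>S. (case z of (m, z) \<Rightarrow> (Suc m, gen u \<otimes> z)) \<in> M} = {(m, z). z \<in> Q m}"
        unfolding X_def Q_def P(2) by auto
      ultimately show ?thesis unfolding \<L>_def by blast
    qed
    show "(case z of (m, z) \<Rightarrow> (Suc m, gen u \<otimes> z)) \<in> M" if "M \<in> \<L>" "u \<in> U" "z \<in> M" for M u z
      using that rees_idealD(3) gen_mem unfolding \<L>_def by fastforce
    show "(case z of (m, z) \<Rightarrow> (Suc m, gen u \<otimes> z)) \<in> X" if "u \<in> U" "z \<in> X" for u z
      using that mult_pow[OF gen_mem] unfolding X_def by auto
    show "(case (case z of (m, z) \<Rightarrow> (Suc m, gen v \<otimes> z)) of (m, z) \<Rightarrow> (Suc m, gen u \<otimes> z)) =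
        (case (case z of (m, z) \<Rightarrow> (Suc m, gen u \<otimes> z)) of (m, z) \<Rightarrow> (Suc m, gen v \<otimes> z))"
      if "u \<in> U" "v \<in> U" "z \<in> X" for u v z
      using that gen_closed pc unfolding X_def by (auto simp: m_lcomm)
    show "{(m, z). z \<in> T m} \<in> \<L>" unfolding \<L>_def using T by blast
    show "z \<in> {(m, z). z \<in> T m}"
      if S: "S \<subseteq> U" "card S = length as" "finite S" and z: "z \<in> X"
        "\<forall>u\<in>S. (case z of (m, z) \<Rightarrow> (Suc m, gen u \<otimes> z)) \<in> {(m, z). z \<in> T m}" for S z
    proof -
      obtain m y where y: "z = (m, y)" "y \<in> pow m" using z(1) unfolding X_def by blast
      have yc: "y \<in> carrier R" using pc[OF y(2)] .
      \<comment> \<open>One exponent j covers all u \<in> S; then I^(j+1) carries y into N, so y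
        lies in the saturation.\<close>
      obtain j where j: "T (Suc m) = T' j (Suc m)" using Tstab by blast
      have p: "p \<otimes> y \<in> N (m + Suc j)" if "p \<in> pow (Suc j)" for p
      proof -
        have "pow j \<cdot> I \<subseteq> colon (N (m + Suc j)) y"
        proof (rule prod_least[OF ideal_colon[OF NI yc]])
          fix q a assume q: "q \<in> pow j" and a: "a \<in> I"
          have qc: "q \<in> carrier R" by (rule pc[OF q])
          have "I \<subseteq> colon (N (m + Suc j)) (q \<otimes> y)"
          proof (rule I_subset_if_gen_mem[OF S(1,3,2)])
            show "ideal (colon (N (m + Suc j)) (q \<otimes> y)) R" using qc yc by (intro ideal_colon NI) auto
            fix u assume u: "u \<in> S"
            then have "gen u \<otimes> y \<in> T' j (Suc m)" using z(2) y(1) j by auto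
            then have "q \<otimes> (gen u \<otimes> y) \<in> N (Suc m + j)" using q by (simp add: T'_def)
            moreover have "q \<otimes> (gen u \<otimes> y) = gen u \<otimes> (q \<otimes> y)"
              using qc yc gen_closed u S(1) by (intro m_lcomm) auto
            ultimately show "gen u \<in> colon (N (m + Suc j)) (q \<otimes> y)"
              using gen_closed u S(1) by (auto simp: colon_def)
          qed
          then have "a \<otimes> (q \<otimes> y) \<in> N (m + Suc j)" using a by (auto simp: colon_def)
          moreover have ac: "a \<in> carrier R" using a ideal_closed(3)[OF I_ideal] by blast
          moreover have "a \<otimes> (q \<otimes> y) = (q \<otimes> a) \<otimes> y" using qc yc ac by (simp add: m_ac)
          ultimately show "q \<otimes> a \<in> colon (N (m + Suc j)) y" using qc by (simp add: colon_def)
        qed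
        then show ?thesis using that unfolding ideal_power_Suc by (auto simp: colon_def)
      qed
      have "y \<in> T' (Suc j) m" unfolding T'_def using y(2) p by blast
      then show ?thesis unfolding T_def y(1) by blast
    qed
  qed
  show ?thesis
  proof (rule finite_subset[OF _ fin], rule subsetI, rule ccontr)
    fix u assume u: "u \<in> {u \<in> U. \<not> (\<exists>c. \<forall>m\<ge>c. \<forall>z\<in>pow m. gen u \<otimes> z \<in> N (Suc m) \<longrightarrow> z \<in> N m)}"
      and n: "u \<notin> {u \<in> U. \<exists>z\<in>X - {(m, z). z \<in> T m}. (case z of (m, z) \<Rightarrow> (Suc m, gen u \<otimes> z)) \<in> {(m, z). z \<in> T m}}"
    have "z \<in> N m" if "m \<ge> c" "z \<in> pow m" "gen u \<otimes> z \<in> N (Suc m)" for m z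
    proof -
      have "gen u \<otimes> z \<in> T (Suc m)" using NT that(3) by blast
      have "z \<in> T m"
      proof (rule ccontr)
        assume "z \<notin> T m"
        then have A: "(m, z) \<in> X - {(m, z). z \<in> T m}" using that(2) unfolding X_def by simp
        have B: "(case (m, z) of (m, z) \<Rightarrow> (Suc m, gen u \<otimes> z)) \<in> {(m, z). z \<in> T m}"
          using \<open>gen u \<otimes> z \<in> T (Suc m)\<close> by simp
        have ex: "\<exists>z\<in>X - {(m, z). z \<in> T m}. (case z of (m, z) \<Rightarrow> (Suc m, gen u \<otimes> z)) \<in> {(m, z). z \<in> T m}"
          by (intro bexI[of _ "(m, z)"] A B)
        have uU: "u \<in> U" using u by simp
        have "\<not> (u \<in> U \<and> (\<exists>z\<in>X - {(m, z). z \<in> T m}.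
            (case z of (m, z) \<Rightarrow> (Suc m, gen u \<otimes> z)) \<in> {(m, z). z \<in> T m}))"
          using n by (simp only: mem_Collect_eq not_False_eq_True)
        then show False by (rule notE) (rule conjI[OF uU ex])
      qed
      then show ?thesis using c[OF that(1)] by blast
    qed
    then show False using u by blast
  qed
qed

end

section \<open>Superficial regular sequences\<close>

context cring
begin

text \<open>A regular sequence on R/K up to properness, which is recovered where needed from K and
  the sequence lying in \<mm>. The recursion through K reduces the exchange of members to a swap of
  two neighbours.\<close>

primrec regular_mod :: "'a list \<Rightarrow> 'a set \<Rightarrow> bool" where
  "regular_mod [] K = True"
| "regular_mod (y # ys) K \<longleftrightarrow> nonzerodiv_mod K y \<and> regular_mod ys (K <+> PIdl y)"

lemma regular_mod_Idl:
  assumes "set ys \<subseteq> carrier R" "S \<subseteq> carrier R"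
    and "\<And>i. i < length ys \<Longrightarrow> nonzerodiv_mod (Idl (S \<union> set (take i ys))) (ys ! i)"
  shows "regular_mod ys (Idl S)"
  using assms
proof (induction ys arbitrary: S)
  case (Cons y ys)
  have "regular_mod ys (Idl (insert y S))"
  proof (rule Cons.IH)
    show "nonzerodiv_mod (Idl (insert y S \<union> set (take i ys))) (ys ! i)" if "i < length ys" for i
      using Cons.prems(3)[of "Suc i"] that by simp
  qed (use Cons.prems in auto)
  moreover have "nonzerodiv_mod (Idl S) y" using Cons.prems(3)[of 0] by simp
  ultimately show ?case using Cons.prems Idl_insert[of S y] by simp
qed simp

lemma regular_mod_regular_sequence:
  assumes "regular_sequence R ys"
  shows "regular_mod ys {\<zero>}"
proof -
  have "regular_mod ys (Idl {})"
    by (rule regular_mod_Idl) (use assms in \<open>auto simp: regular_sequence_def nonzerodiv_mod_def\<close>)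
  then show ?thesis by (simp add: Idl_empty)
qed

text \<open>From y a = k + b x follows x b \<in> K + (y), so b = l + c y, and then y (a - c x) \<in>
  K gives a \<in> K + (x). This is one half of the permutability of regular sequences; the other,
  regularity of x modulo K, is supplied by general position.\<close>

lemma nonzerodiv_mod_swap:
  assumes K: "ideal K R" and x: "x \<in> carrier R" and y: "y \<in> carrier R" "nonzerodiv_mod K y"
    and xy: "nonzerodiv_mod (K <+> PIdl y) x"
  shows "nonzerodiv_mod (K <+> PIdl x) y"
  unfolding nonzerodiv_mod_def
proof (intro ballI impI)
  fix a assume a: "a \<in> carrier R" "y \<otimes> a \<in> K <+> PIdl x"
  then obtain k b where k: "k \<in> K" "b \<in> carrier R" "y \<otimes> a = k \<oplus> b \<otimes> x" unfolding mem_sum_PIdl_iff by blast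
  have kc: "k \<in> carrier R" using k ideal_closed(3)[OF K] by blast
  have "x \<otimes> b = \<ominus> k \<oplus> a \<otimes> y"
  proof -
    have "x \<otimes> b = (k \<oplus> b \<otimes> x) \<ominus> k" using kc k x by algebra
    then show ?thesis using kc a y unfolding k(3)[symmetric] by algebra
  qed
  then have "x \<otimes> b \<in> K <+> PIdl y" unfolding mem_sum_PIdl_iff using ideal_closed(6)[OF K k(1)] a(1) by blast
  then have "b \<in> K <+> PIdl y" using xy k(2) unfolding nonzerodiv_mod_def by blast
  then obtain l c where l: "l \<in> K" "c \<in> carrier R" "b = l \<oplus> c \<otimes> y" unfolding mem_sum_PIdl_iff by blast
  have lc: "l \<in> carrier R" using l ideal_closed(3)[OF K] by blast
  have "y \<otimes> (a \<ominus> c \<otimes> x) = k \<oplus> x \<otimes> l"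
  proof -
    have "y \<otimes> (a \<ominus> c \<otimes> x) = y \<otimes> a \<ominus> y \<otimes> (c \<otimes> x)" using a l y x by algebra
    also have "\<dots> = (k \<oplus> (l \<oplus> c \<otimes> y) \<otimes> x) \<ominus> y \<otimes> (c \<otimes> x)" using k(3) l(3) by simp
    also have "\<dots> = k \<oplus> x \<otimes> l" using kc lc l x y by algebra
    finally show ?thesis .
  qed
  moreover have "k \<oplus> x \<otimes> l \<in> K" using ideal_closed(4)[OF K k(1) ideal_closed(7)[OF K x l(1)]] .
  moreover have "a \<ominus> c \<otimes> x \<in> carrier R" using a l x by simp
  ultimately have "a \<ominus> c \<otimes> x \<in> K" using y(2) unfolding nonzerodiv_mod_def by simp
  moreover have "a = (a \<ominus> c \<otimes> x) \<oplus> c \<otimes> x" using a l x by algebra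
  ultimately show "a \<in> K <+> PIdl x" unfolding mem_sum_PIdl_iff using l(2) by blast
qed

end

section \<open>Primes over regular sequences\<close>

context noetherian_local_ring
begin

text \<open>The multiplicative set of all s x^k with s \<notin> Q misses K, because x is a
  nonzerodivisor modulo K \<subseteq> Q. A prime over K that avoids this set lies in Q and omits
  x.\<close>

lemma prime_below_nonzerodivisor:
  assumes Q: "primeideal Q R" and K: "ideal K R" "K \<subseteq> Q" and x: "x \<in> Q" "nonzerodiv_mod K x"
  obtains P where "primeideal P R" "K \<subseteq> P" "P \<subseteq> Q" "x \<notin> P"
proof -
  interpret Q: primeideal Q R by fact
  have xc: "x \<in> carrier R" using x Q.Icarr by blast
  define S where "S = {s \<otimes> x [^] k | s k :: nat. s \<in> carrier R - Q} "
  have S: "S \<subseteq> carrier R" unfolding S_def using xc by auto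
  have oneQ: "\<one> \<in> carrier R - Q" using Q.I_notcarr Q.one_imp_carrier by auto
  then have S1: "\<one> \<in> S" unfolding S_def by (intro CollectI exI[of _ \<one>] exI[of _ "0::nat"]) simp
  have S2: "p \<otimes> q \<in> S" if "p \<in> S" "q \<in> S" for p q
  proof -
    obtain s and k :: nat where s: "p = s \<otimes> x [^] k" "s \<in> carrier R - Q" using \<open>p \<in> S\<close> unfolding S_def by blast
    obtain t and l :: nat where t: "q = t \<otimes> x [^] l" "t \<in> carrier R - Q" using \<open>q \<in> S\<close> unfolding S_def by blast
    have "p \<otimes> q = (s \<otimes> t) \<otimes> (x [^] k \<otimes> x [^] l)" unfolding s(1) t(1) using s(2) t(2) xc by (simp add: m_ac)
    also have "x [^] k \<otimes> x [^] l = x [^] (k + l)" by (rule nat_pow_mult[OF xc])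
    finally show ?thesis unfolding S_def using Q.I_prime[of s t] s(2) t(2) by blast
  qed
  have S3: "K \<inter> S = {}"
  proof (rule ccontr)
    assume "K \<inter> S \<noteq> {}"
    then obtain s and k :: nat where s: "s \<otimes> x [^] k \<in> K" "s \<in> carrier R - Q" unfolding S_def by blast
    then have "x [^] k \<otimes> s \<in> K" using m_comm xc by simp
    then have "s \<in> K" using nonzerodiv_mod_pow[OF x(2) xc] s(2) unfolding nonzerodiv_mod_def by blast
    then show False using s(2) K(2) by blast
  qed
  obtain P where P: "primeideal P R" "K \<subseteq> P" "P \<inter> S = {}" using prime_avoiding[OF K(1) S S1 S2 S3] .
  have "P \<subseteq> Q"
  proof
    fix s assume s: "s \<in> P"
    have sc: "s \<in> carrier R" using s ideal_closed(3) P(1) primeideal.axioms(1) by blast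
    show "s \<in> Q"
    proof (rule ccontr)
      assume "s \<notin> Q"
      then have "s \<otimes> x [^] (0::nat) \<in> S" unfolding S_def using sc by blast
      then show False using P(3) s sc by auto
    qed
  qed
  moreover have "x \<notin> P"
  proof
    assume "x \<in> P"
    moreover have "\<one> \<otimes> x [^] (1::nat) \<in> S" unfolding S_def using oneQ by blast
    ultimately show False using P(3) xc by auto
  qed
  ultimately show ?thesis using that P by blast
qed

primrec adjoin :: "'a list \<Rightarrow> 'a set \<Rightarrow> 'a set" where
  "adjoin [] K = K"
| "adjoin (x # xs) K = adjoin xs (K <+> PIdl x)"

lemma adjoin_Idl:
  "set xs \<subseteq> carrier R \<Longrightarrow> S \<subseteq> carrier R \<Longrightarrow> adjoin xs (Idl S) = Idl (S \<union> set xs)"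
proof (induction xs arbitrary: S)
  case (Cons x xs)
  then show ?case using Idl_insert[of S x] Cons.IH[of "insert x S"] by simp
qed simp

text \<open>Descend from Q: each member is a nonzerodivisor modulo its predecessors and so permits a
  strictly smaller prime that still contains those predecessors.\<close>

lemma prime_chain_above_regular:
  assumes "regular_mod xs K" "ideal K R" "set xs \<subseteq> carrier R" "primeideal Q R" "adjoin xs K \<subseteq> Q"
  shows "\<exists>P :: nat \<Rightarrow> 'a set. (\<forall>i\<le>length xs. primeideal (P i) R) \<and> (\<forall>i<length xs. P i \<subset> P (Suc i))
    \<and> K \<subseteq> P 0 \<and> P (length xs) = Q"
  using assms
proof (induction xs arbitrary: K)
  case Nil
  then show ?case by (intro exI[of _ "\<lambda>_. Q"]) simp
next
  case (Cons x xs)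
  have x: "x \<in> carrier R" using Cons.prems by simp
  have K': "ideal (K <+> PIdl x) R" by (rule ideal_sum_PIdl[OF Cons.prems(2) x])
  obtain P where P: "\<forall>i\<le>length xs. primeideal (P i) R" "\<forall>i<length xs. P i \<subset> P (Suc i)"
    "K <+> PIdl x \<subseteq> P 0" "P (length xs) = Q"
    using Cons.IH[OF _ K'] Cons.prems by auto
  have sub: "K \<subseteq> P 0" "x \<in> P 0" using P(3) sum_PIdl_upper[OF Cons.prems(2) x] by auto
  have nz: "nonzerodiv_mod K x" using Cons.prems(1) by simp
  have P0: "primeideal (P 0) R" using P(1) by simp
  obtain P' where P': "primeideal P' R" "K \<subseteq> P'" "P' \<subseteq> P 0" "x \<notin> P'"
    using prime_below_nonzerodivisor[OF P0 Cons.prems(2) sub nz] .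
  have less: "P' \<subset> P 0" using P' sub(2) by blast
  let ?P = "\<lambda>i. case i of 0 \<Rightarrow> P' | Suc j \<Rightarrow> P j"
  have "primeideal (?P i) R" if "i \<le> length (x # xs)" for i using that P(1) P'(1) by (cases i) auto
  moreover have "?P i \<subset> ?P (Suc i)" if "i < length (x # xs)" for i using that P(2) less by (cases i) auto
  ultimately show ?case using P'(2) P(4) by (intro exI[of _ ?P]) auto
qed

text \<open>A prime over the sequence other than \<mm> would be the top of a chain as long as the
  sequence, and \<mm> would make the chain longer than the dimension.\<close>

lemma regular_mod_mm_primary:
  assumes dim: "krull_dim R = enat (length xs)" and xs: "regular_mod xs {\<zero>}" "set xs \<subseteq> carrier R"
  shows "mm_primary (Idl (set xs))"
proof (rule mm_primary_if_primes)
  show "ideal (Idl (set xs)) R" by (rule genideal_ideal[OF xs(2)])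
  fix Q assume Q: "primeideal Q R" "Idl (set xs) \<subseteq> Q"
  have "adjoin xs {\<zero>} = Idl (set xs)" using adjoin_Idl[OF xs(2), of "{}"] by (simp add: Idl_empty)
  then obtain P where P: "\<forall>i\<le>length xs. primeideal (P i) R" "\<forall>i<length xs. P i \<subset> P (Suc i)" "P (length xs) = Q"
    using prime_chain_above_regular[OF xs(1) zeroideal xs(2) Q(1)] Q(2) by auto
  show "Q = \<mm>"
  proof (rule ccontr)
    assume "Q \<noteq> \<mm>"
    moreover have "Q \<subseteq> \<mm>"
      using proper_ideal_subset[of Q] primeideal.axioms(1)[OF Q(1)] primeideal.I_notcarr[OF Q(1)] by auto
    ultimately have less: "Q \<subset> \<mm>" by blast
    let ?P = "\<lambda>i. if i \<le> length xs then P i else \<mm>"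
    have "\<forall>i\<le>Suc (length xs). primeideal (?P i) R"
      using P(1) maximalideal_prime[OF is_maximalideal] by auto
    moreover have "\<forall>i<Suc (length xs). ?P i \<subset> ?P (Suc i)"
      using P(2,3) less by (auto simp: less_Suc_eq)
    ultimately have "enat (Suc (length xs)) \<le> krull_dim R"
      unfolding krull_dim_def
      by (intro Sup_upper CollectI exI[of _ "Suc (length xs)"] conjI refl exI[of _ ?P]) assumption+
    then show False using dim by simp
  qed
qed

end

section \<open>Exchange of the members of a regular sequence for general elements\<close>

context generic_elements
begin

text \<open>A general element enters at the front and the last member of \<open>ys\<close> leaves,
  so the length is kept. It takes the place of the last member and moves forward by swaps; for these
  it must be a nonzerodivisor modulo each initial part of the sequence, which excludes finitely many
  u every time.\<close>

lemma finite_not_regular_exchange: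
  assumes "regular_mod ys K" "ys \<noteq> []" "set ys \<subseteq> \<mm>" "ideal K R"
  shows "finite {u \<in> U. \<not> (nonzerodiv_mod K (gen u) \<and> regular_mod (butlast ys) (K <+> PIdl (gen u)))}"
  using assms
proof (induction ys arbitrary: K)
  case (Cons y ys)
  have y: "y \<in> carrier R" using Cons.prems ideal_closed(3)[OF \<mm>_ideal] by auto
  have f1: "finite {u \<in> U. \<not> nonzerodiv_mod K (gen u)}"
    using Cons.prems by (intro finite_zerodivisors_mod[of K y]) auto
  show ?case
  proof (cases "ys = []")
    case True
    then show ?thesis using f1 by simp
  next
    case False
    have K': "ideal (K <+> PIdl y) R" by (rule ideal_sum_PIdl[OF Cons.prems(4) y])
    have f2: "finite {u \<in> U. \<not> (nonzerodiv_mod (K <+> PIdl y) (gen u) \<and>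
        regular_mod (butlast ys) ((K <+> PIdl y) <+> PIdl (gen u)))}"
      using Cons.prems False by (intro Cons.IH K') auto
    have "regular_mod (butlast (y # ys)) (K <+> PIdl (gen u))"
      if u: "u \<in> U" and h: "nonzerodiv_mod (K <+> PIdl y) (gen u)"
        "regular_mod (butlast ys) ((K <+> PIdl y) <+> PIdl (gen u))" for u
    proof -
      have g: "gen u \<in> carrier R" by (rule gen_closed[OF u])
      have "(K <+> PIdl y) <+> PIdl (gen u) = K <+> (PIdl y <+> PIdl (gen u))"
        by (intro sum_assoc cgenideal_ideal Cons.prems y g)
      also have "PIdl y <+> PIdl (gen u) = PIdl (gen u) <+> PIdl y"
        by (intro sum_comm cgenideal_ideal y g)
      also have "K <+> (PIdl (gen u) <+> PIdl y) = (K <+> PIdl (gen u)) <+> PIdl y"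
        by (intro sum_assoc[symmetric] cgenideal_ideal Cons.prems y g)
      finally have "regular_mod (butlast ys) ((K <+> PIdl (gen u)) <+> PIdl y)" using h(2) by simp
      moreover have "nonzerodiv_mod (K <+> PIdl (gen u)) y"
        by (rule nonzerodiv_mod_swap[OF Cons.prems(4) g y _ h(1)]) (use Cons.prems(1) in simp)
      ultimately show ?thesis using False by simp
    qed
    then show ?thesis by (intro finite_subset[OF _ finite_UnI[OF f1 f2]]) blast
  qed
qed simp

text \<open>For x \<in> I: multiplication by x is injective from degree m to degree m + 1 of the
  associated graded ring of R/K with respect to I, for all large m.\<close>

definition superficial_mod :: "'a set \<Rightarrow> 'a \<Rightarrow> bool" where
  "superficial_mod K x \<longleftrightarrow>
    (\<exists>c. \<forall>m\<ge>c. \<forall>z\<in>pow m. x \<otimes> z \<in> pow (Suc (Suc m)) <+> K \<longrightarrow> z \<in> pow (Suc m) <+> K)"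

text \<open>The family I^m \<inter> (I^(m+1) + K) is the kernel of the map from the Rees algebra
  onto the associated graded ring of R/K, so superficiality is regularity modulo this homogeneous
  ideal in large degrees.\<close>

lemma finite_not_superficial_mod:
  assumes K: "ideal K R"
  shows "finite {u \<in> U. \<not> superficial_mod K (gen u)}"
proof -
  define N where "N m = pow m \<inter> (pow (Suc m) <+> K)" for m
  have i: "ideal (pow m <+> K) R" for m by (intro add_ideals pow_ideal K)
  have N: "rees_ideal N"
    unfolding rees_ideal_def
  proof (intro allI conjI ballI)
    show "ideal (N m) R" for m unfolding N_def by (intro i_intersect pow_ideal i)
    show "N m \<subseteq> pow m" for m unfolding N_def by blast
    fix m a z assume az: "a \<in> I" "z \<in> N m"
    have ac: "a \<in> carrier R" using az(1) ideal_closed(3)[OF I_ideal] by blast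
    have "z \<in> pow (Suc m) <+> K" using az(2) unfolding N_def by blast
    then obtain w k where w: "w \<in> pow (Suc m)" "k \<in> K" "z = w \<oplus> k" unfolding mem_sum_iff by blast
    have "a \<otimes> z = a \<otimes> w \<oplus> a \<otimes> k"
      unfolding w(3) using ac w(1,2) ideal_closed(3)[OF K] ideal_closed(3)[OF pow_ideal] by (intro r_distr) blast+
    then have "a \<otimes> z \<in> pow (Suc (Suc m)) <+> K"
      unfolding mem_sum_iff using mult_pow[OF az(1) w(1)] ideal_closed(7)[OF K ac w(2)] by blast
    then show "a \<otimes> z \<in> N (Suc m)" unfolding N_def using mult_pow[of a z m] az unfolding N_def by blast
  qed
  have sup: "superficial_mod K (gen u)"
    if u: "u \<in> U" and ex: "\<exists>c. \<forall>m\<ge>c. \<forall>z\<in>pow m. gen u \<otimes> z \<in> N (Suc m) \<longrightarrow> z \<in> N m" for u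
  proof -
    obtain c where c: "\<forall>m\<ge>c. \<forall>z\<in>pow m. gen u \<otimes> z \<in> N (Suc m) \<longrightarrow> z \<in> N m" using ex by blast
    show ?thesis
      unfolding superficial_mod_def
    proof (intro exI[of _ c] allI impI ballI)
      fix m z assume *: "m \<ge> c" "z \<in> pow m" "gen u \<otimes> z \<in> pow (Suc (Suc m)) <+> K"
      then have "gen u \<otimes> z \<in> N (Suc m)" unfolding N_def using mult_pow[OF gen_mem[OF u] *(2)] by blast
      then have "z \<in> N m" using c * by blast
      then show "z \<in> pow (Suc m) <+> K" unfolding N_def by blast
    qed
  qed
  show ?thesis
  proof (rule finite_subset[OF _ finite_not_superficial[OF N]], rule subsetI)
    fix u assume "u \<in> {u \<in> U. \<not> superficial_mod K (gen u)}"
    then have u: "u \<in> U" "\<not> superficial_mod K (gen u)" by auto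
    have "\<not> (\<exists>c. \<forall>m\<ge>c. \<forall>z\<in>pow m. gen u \<otimes> z \<in> N (Suc m) \<longrightarrow> z \<in> N m)"
      using sup[OF u(1)] u(2) by (rule contrapos_nn[rotated])
    then show "u \<in> {u \<in> U. \<not> (\<exists>c. \<forall>m\<ge>c. \<forall>z\<in>pow m. gen u \<otimes> z \<in> N (Suc m) \<longrightarrow> z \<in> N m)}"
      using u(1) by simp
  qed
qed

primrec superficial_seq :: "'a list \<Rightarrow> 'a set \<Rightarrow> bool" where
  "superficial_seq [] K = True"
| "superficial_seq (x # xs) K \<longleftrightarrow> superficial_mod K x \<and> superficial_seq xs (K <+> PIdl x)"

text \<open>U is infinite and each requirement excludes finitely many u, so the next general element
  can always be chosen, at the price of the last remaining member of the given sequence.\<close>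

lemma superficial_seq_exists:
  assumes "regular_mod ys K" "set ys \<subseteq> \<mm>" "ideal K R"
  shows "\<exists>us. length us = length ys \<and> set us \<subseteq> U \<and> regular_mod (map gen us) K \<and> superficial_seq (map gen us) K"
  using assms
proof (induction "length ys" arbitrary: ys K)
  case 0
  then show ?case by (intro exI[of _ "[]"]) simp
next
  case (Suc n)
  have "finite ({u \<in> U. \<not> (nonzerodiv_mod K (gen u) \<and> regular_mod (butlast ys) (K <+> PIdl (gen u)))}
    \<union> {u \<in> U. \<not> superficial_mod K (gen u)})"
    using Suc by (intro finite_UnI finite_not_regular_exchange finite_not_superficial_mod) auto
  then have "\<not> U \<subseteq> {u \<in> U. \<not> (nonzerodiv_mod K (gen u) \<and> regular_mod (butlast ys) (K <+> PIdl (gen u)))}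
    \<union> {u \<in> U. \<not> superficial_mod K (gen u)}"
    using U_infinite finite_subset by blast
  then obtain u where u: "u \<in> U" "nonzerodiv_mod K (gen u)" "regular_mod (butlast ys) (K <+> PIdl (gen u))"
    "superficial_mod K (gen u)" by blast
  have "ideal (K <+> PIdl (gen u)) R" by (rule ideal_sum_PIdl[OF Suc.prems(3) gen_closed[OF u(1)]])
  moreover have "set (butlast ys) \<subseteq> \<mm>" using Suc.prems(2) in_set_butlastD by fastforce
  moreover have "n = length (butlast ys)" using Suc.hyps(2) by simp
  ultimately obtain us where "length us = n" "set us \<subseteq> U" "regular_mod (map gen us) (K <+> PIdl (gen u))"
    "superficial_seq (map gen us) (K <+> PIdl (gen u))"
    using Suc.hyps(1)[OF _ u(3)] by metis
  then show ?case using u Suc.hyps(2) by (intro exI[of _ "u # us"]) auto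
qed

text \<open>The ideals A + I^m decrease while their colengths stay at most l(R/A), so two
  consecutive ones agree; then A + I^m \<subseteq> A + \<mm> (A + I^m), and Nakayama gives I^m
  \<subseteq> A.\<close>

lemma pow_subset_mm_primary:
  assumes A: "mm_primary A"
  shows "\<exists>b. pow b \<subseteq> A"
proof -
  have iA: "ideal A R" using A mm_primaryD by blast
  define B where "B m = A <+> pow m" for m
  have B: "ideal (B m) R" "A \<subseteq> B m" "mm_primary (B m)" for m
    unfolding B_def using add_ideals[OF iA pow_ideal] sum_upper1[OF iA pow_ideal] mm_primary_sum[OF A pow_ideal] by auto
  have anti: "B (Suc m) \<subseteq> B m" for m
    unfolding B_def by (intro sum_mono ideal_power_antimono I_ideal) auto
  have "\<exists>m. B (Suc m) = B m"
  proof (rule ccontr)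
    assume "\<not> ?thesis"
    then have lt: "colength R (B m) < colength R (B (Suc m))" for m
      using colength_strict[OF B(3) B(1), of "Suc m" m] anti[of m] by blast
    have "m \<le> colength R (B m)" for m
    proof (induction m)
      case (Suc m)
      then show ?case using lt[of m] by simp
    qed simp
    then have "Suc (colength R A) \<le> colength R (B (Suc (colength R A)))" by blast
    moreover have "colength R (B m) \<le> colength R A" for m using colength_mono[OF A B(1,2)] .
    ultimately show False by (metis not_less_eq_eq order_trans)
  qed
  then obtain m where m: "B (Suc m) = B m" by blast
  have "pow (Suc m) = I \<cdot> pow m" unfolding ideal_power_Suc by (rule ideal_prod_commute[OF pow_ideal I_ideal])
  also have "\<dots> \<subseteq> \<mm> \<cdot> B m"
    using I_subset sum_upper2[OF iA pow_ideal, of m] unfolding B_def by (rule prod_mono)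
  finally have "B (Suc m) \<subseteq> A <+> (\<mm> \<cdot> B m)" unfolding B_def[of "Suc m"] by (intro sum_mono order_refl)
  then have "B m = A" using m by (intro nakayama B iA) simp
  then show ?thesis using sum_upper2[OF iA pow_ideal, of m] unfolding B_def by blast
qed

section \<open>Hilbert-Samuel functions of the quotients R/K\<close>

definition hilb :: "'a set \<Rightarrow> nat \<Rightarrow> nat" where
  "hilb K m = colength R (pow m <+> K)"

lemma pow_sum_primary: "ideal K R \<Longrightarrow> mm_primary (pow m <+> K)"
  by (intro mm_primary_sum pow_primary)

lemma pow_sum_ideal: "ideal K R \<Longrightarrow> ideal (pow m <+> K) R"
  by (intro add_ideals pow_ideal)

lemma pow_sum_antimono: "m \<le> k \<Longrightarrow> pow k <+> K \<subseteq> pow m <+> K"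
  by (intro sum_mono ideal_power_antimono I_ideal) auto

lemma hilb_mono: "ideal K R \<Longrightarrow> m \<le> k \<Longrightarrow> hilb K m \<le> hilb K k"
  unfolding hilb_def by (intro colength_mono pow_sum_primary pow_sum_ideal pow_sum_antimono)

text \<open>Let T = (I^(k+1) + K) : x. The exact sequence gives hilb of K at k+1 as hilb of K + (x)
  at k+1 plus l(R/T), and superficiality gives T \<inter> (I^c + K) \<subseteq> I^k + K for k \<ge>
  c. So l(R/T) is at least \<open>hilb K k\<close> up to the constant \<open>hilb K c\<close>, and
  without error once T lies in I^c + K.\<close>

lemma hilb_step:
  assumes K: "ideal K R" and x: "x \<in> I" "superficial_mod K x"
  obtains c where "\<And>k. hilb (K <+> PIdl x) (Suc k) + hilb K k \<le> hilb K (Suc k) + hilb K c"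
    "\<And>k. k \<ge> c \<Longrightarrow> colon (pow (Suc k) <+> K) x \<subseteq> pow c <+> K \<Longrightarrow>
      hilb (K <+> PIdl x) (Suc k) + hilb K k \<le> hilb K (Suc k)"
proof -
  have xc: "x \<in> carrier R" using x ideal_closed(3)[OF I_ideal] by blast
  obtain c where c: "\<And>m z. m \<ge> c \<Longrightarrow> z \<in> pow m \<Longrightarrow> x \<otimes> z \<in> pow (Suc (Suc m)) <+> K \<Longrightarrow> z \<in> pow (Suc m) <+> K"
    using x(2) unfolding superficial_mod_def by blast
  define T where "T k = colon (pow (Suc k) <+> K) x" for k
  have T: "mm_primary (T k)" "ideal (T k) R" for k
    unfolding T_def by (rule mm_primary_colon[OF pow_sum_primary[OF K] xc],
      rule mm_primaryD[OF mm_primary_colon[OF pow_sum_primary[OF K] xc]])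
  have Tle: "T k \<inter> (pow c <+> K) \<subseteq> pow k <+> K" if "k \<ge> c" for k
  proof
    fix z assume z: "z \<in> T k \<inter> (pow c <+> K)"
    then have zc: "z \<in> carrier R" using ideal_closed(3)[OF T(2)] by blast
    have xz: "z \<otimes> x \<in> pow (Suc k) <+> K" using z by (auto simp: T_def colon_def)
    \<comment> \<open>Superficiality moves z up by one power of I at a time; the summand in K is
      split off first because the condition concerns elements of I^j.\<close>
    have "z \<in> pow j <+> K" if "c \<le> j" "j \<le> k" for j
      using that
    proof (induction rule: dec_induct)
      case base
      then show ?case using z by blast
    next
      case (step j)
      then obtain w l where w: "w \<in> pow j" "l \<in> K" "z = w \<oplus> l" unfolding mem_sum_iff by auto
      have wc: "w \<in> carrier R" "l \<in> carrier R"
        using w ideal_closed(3)[OF pow_ideal] ideal_closed(3)[OF K] by auto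
      have "z \<otimes> x \<in> pow (Suc (Suc j)) <+> K" using xz pow_sum_antimono[of "Suc (Suc j)" "Suc k" K] step by auto
      moreover have "x \<otimes> l \<in> pow (Suc (Suc j)) <+> K"
        using ideal_closed(7)[OF K xc w(2)] sum_upper2[OF pow_ideal K] by blast
      ultimately have "z \<otimes> x \<ominus> x \<otimes> l \<in> pow (Suc (Suc j)) <+> K" by (rule ideal_closed(5)[OF pow_sum_ideal[OF K]])
      moreover have "z \<otimes> x \<ominus> x \<otimes> l = x \<otimes> w" unfolding w(3) using wc xc by algebra
      ultimately have "w \<in> pow (Suc j) <+> K" using c[OF step(1) w(1)] by simp
      moreover have "l \<in> pow (Suc j) <+> K" using w(2) sum_upper2[OF pow_ideal K] by blast
      ultimately show ?case unfolding w(3) by (rule ideal_closed(4)[OF pow_sum_ideal[OF K]])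
    qed
    then show "z \<in> pow k <+> K" using \<open>c \<le> k\<close> by blast
  qed
  have eq: "hilb K (Suc k) = hilb (K <+> PIdl x) (Suc k) + colength R (T k)" for k
    unfolding hilb_def T_def mm_primary_colength_sum_PIdl[OF pow_sum_primary[OF K] xc]
      sum_assoc[OF pow_ideal K cgenideal_ideal[OF xc]] ..
  have le: "hilb K k \<le> colength R (T k) + hilb K c" for k
  proof (cases "k \<ge> c")
    case True
    have "hilb K k \<le> colength R (T k \<inter> (pow c <+> K))"
      unfolding hilb_def
      using finite_colength_mono(2)[OF colength_inter_le(1)[OF mm_primary_finite_colength[OF T(1)]
            mm_primary_finite_colength[OF pow_sum_primary[OF K]]] pow_sum_ideal[OF K] Tle[OF True]] .
    also have "\<dots> \<le> colength R (T k) + hilb K c"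
      unfolding hilb_def
      by (intro colength_inter_le(2) mm_primary_finite_colength T pow_sum_primary K)
    finally show ?thesis .
  next
    case False
    then show ?thesis using hilb_mono[OF K, of k c] by simp
  qed
  have le': "hilb K k \<le> colength R (T k)" if "k \<ge> c" "T k \<subseteq> pow c <+> K" for k
    unfolding hilb_def using Tle[OF that(1)] that(2) by (intro colength_mono T pow_sum_ideal K) blast
  show ?thesis
  proof (rule that)
    show "hilb (K <+> PIdl x) (Suc k) + hilb K k \<le> hilb K (Suc k) + hilb K c" for k
      using eq[of k] le[of k] by simp
    show "hilb (K <+> PIdl x) (Suc k) + hilb K k \<le> hilb K (Suc k)"
      if "k \<ge> c" "colon (pow (Suc k) <+> K) x \<subseteq> pow c <+> K" for k
      using eq[of k] le'[of k] that unfolding T_def by simp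
  qed
qed

text \<open>When \<open>K + (x)\<close> is \<open>\<mm>\<close>-primary, this replaces the Artin-Rees lemma.\<close>

lemma colon_pow_subset:
  assumes K: "ideal K R" and x: "x \<in> carrier R" "nonzerodiv_mod K x" and b: "pow b \<subseteq> K <+> PIdl x"
  shows "colon (pow (p + b) <+> K) x \<subseteq> pow p <+> K"
proof
  have X: "ideal (PIdl x) R" by (rule cgenideal_ideal[OF x(1)])
  have pX: "ideal (pow p \<cdot> (PIdl x)) R" by (rule ideal_prod_is_ideal[OF pow_ideal X])
  have E: "ideal (K <+> (pow p \<cdot> (PIdl x))) R" by (rule add_ideals[OF K pX])
  \<comment> \<open>I^(p+b) lies in I^p (K + (x)), hence in K + I^p x; cancelling x modulo K then
    leaves I^p + K.\<close>
  have "pow (p + b) \<subseteq> pow p \<cdot> (K <+> PIdl x)"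
    unfolding ideal_power_add[OF I_ideal] by (intro prod_mono order_refl b)
  also have "\<dots> = pow p \<cdot> K <+> pow p \<cdot> (PIdl x)" by (rule ideal_prod_distr(1)[OF pow_ideal K X])
  also have "\<dots> \<subseteq> K <+> (pow p \<cdot> (PIdl x))" by (intro sum_mono order_refl prod_subset2 pow_ideal K)
  finally have sub: "pow (p + b) <+> K \<subseteq> K <+> (pow p \<cdot> (PIdl x))"
    by (intro sum_least[OF E] sum_upper1 K pX)
  fix z assume "z \<in> colon (pow (p + b) <+> K) x"
  then have z: "z \<in> carrier R" "z \<otimes> x \<in> K <+> (pow p \<cdot> (PIdl x))" using sub by (auto simp: colon_def)
  then obtain k w where k: "k \<in> K" "w \<in> pow p" "z \<otimes> x = k \<oplus> w \<otimes> x"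
    unfolding mem_sum_iff using mem_prod_PIdl[OF pow_ideal x(1)] by metis
  have c: "w \<in> carrier R" "k \<in> carrier R" using k ideal_closed(3)[OF pow_ideal] ideal_closed(3)[OF K] by auto
  have "x \<otimes> (z \<ominus> w) = z \<otimes> x \<ominus> w \<otimes> x" using c z(1) x by algebra
  also have "\<dots> = k" unfolding k(3) using c x by algebra
  finally have "z \<ominus> w \<in> K" using x(2) c z(1) k(1) unfolding nonzerodiv_mod_def by simp
  moreover have "z = w \<oplus> (z \<ominus> w)" using c z(1) by algebra
  ultimately show "z \<in> pow p <+> K" unfolding mem_sum_iff using k(2) by blast
qed

text \<open>Summing \<open>hilb_step\<close> raises the degree by one per member. For length s \<ge>
  2 the accumulated constant errors stay within order m^(s-1), but for a single element they would
  compete with the leading term; there the error-free form applies for large k, because K + (x) is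
  \<mm>-primary.\<close>

lemma hilb_lower_bound:
  assumes "regular_mod xs K" "superficial_seq xs K" "set xs \<subseteq> I" "ideal K R" "mm_primary (adjoin xs K)"
    and "xs \<noteq> []"
  shows "\<exists>C\<ge>0. \<forall>m. real (hilb K m) \<ge>
    real (colength R (adjoin xs K)) * real (hbinom (length xs) m) - C * real (m + 1) ^ (length xs - 1)"
  using assms
proof (induction xs arbitrary: K)
  case (Cons x xs)
  have x: "x \<in> I" "superficial_mod K x" "nonzerodiv_mod K x" and K: "ideal K R" using Cons.prems by auto
  have xc: "x \<in> carrier R" using x ideal_closed(3)[OF I_ideal] by blast
  have K': "ideal (K <+> PIdl x) R" by (rule ideal_sum_PIdl[OF K xc])
  define e where "e = real (colength R (adjoin (x # xs) K))"
  obtain c where c: "\<And>k. hilb (K <+> PIdl x) (Suc k) + hilb K k \<le> hilb K (Suc k) + hilb K c"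
    "\<And>k. k \<ge> c \<Longrightarrow> colon (pow (Suc k) <+> K) x \<subseteq> pow c <+> K \<Longrightarrow>
      hilb (K <+> PIdl x) (Suc k) + hilb K k \<le> hilb K (Suc k)"
    using hilb_step[OF K x(1,2)] by blast
  show ?case
  proof (cases "xs = []")
    case True
    then have pr: "mm_primary (K <+> PIdl x)" and e: "e = real (colength R (K <+> PIdl x))"
      using Cons.prems by (auto simp: e_def)
    obtain b where b: "pow b \<subseteq> K <+> PIdl x" using pow_subset_mm_primary[OF pr] by blast
    \<comment> \<open>For k \<ge> c + b the colon lies in I^c + K, and K + (x) already contains
      I^(k+1), so the step adds at least the full colength e.\<close>
    have step: "real (hilb K (Suc k)) \<ge> e + real (hilb K k)" if k: "k \<ge> c + b" for k
    proof -
      have "Suc k = (Suc k - b) + b" using k by simp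
      then have "colon (pow (Suc k) <+> K) x \<subseteq> pow (Suc k - b) <+> K"
        using colon_pow_subset[OF K xc x(3) b, of "Suc k - b"] by simp
      also have "\<dots> \<subseteq> pow c <+> K" using k by (intro pow_sum_antimono) simp
      finally have "hilb (K <+> PIdl x) (Suc k) + hilb K k \<le> hilb K (Suc k)" using c(2) k by simp
      moreover have "pow (Suc k) <+> (K <+> PIdl x) = K <+> PIdl x"
        unfolding sum_comm[OF pow_ideal K']
      proof (rule sum_absorb[OF K' pow_ideal])
        have "pow (Suc k) \<subseteq> pow b" by (rule ideal_power_antimono[OF I_ideal]) (use k in simp)
        then show "pow (Suc k) \<subseteq> K <+> PIdl x" using b by (rule subset_trans)
      qed
      ultimately show ?thesis unfolding e hilb_def by simp
    qed
    have "real (hilb K m) \<ge> e * real m - e * real (c + b)" for m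
    proof (cases "m \<ge> c + b")
      case True
      then show ?thesis
      proof (induction rule: dec_induct)
        case (step m)
        then show ?case using \<open>\<And>k. k \<ge> c + b \<Longrightarrow> _\<close>[of m] by (simp add: algebra_simps)
      qed simp
    next
      case False
      then have "e * real m \<le> e * real (c + b)" by (intro mult_left_mono) (auto simp: e)
      then show ?thesis by (smt (verit) of_nat_0_le_iff)
    qed
    then show ?thesis using True by (intro exI[of _ "e * real (c + b)"]) (auto simp: e hbinom_def)
  next
    case False
    define s where "s = length xs - 1"
    have s: "length xs = Suc s" using False by (simp add: s_def)
    obtain C where C: "C \<ge> 0" "\<And>m. real (hilb (K <+> PIdl x) m) \<ge> e * real (hbinom (Suc s) m) - C * real (m + 1) ^ s"
      using Cons.IH[OF _ _ _ K' _ False] Cons.prems s unfolding e_def by auto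
    define B where "B = real (hilb K c)"
    have B: "B \<ge> 0" unfolding B_def by simp
    \<comment> \<open>B is the error of one step and C that of the shorter sequence; both are
      absorbed because (m+2)^(s+1) exceeds (m+1)^(s+1) by at least (m+2)^s.\<close>
    have "real (hilb K m) \<ge> e * real (hbinom (Suc (Suc s)) m) - (C + B) * real (m + 1) ^ Suc s" for m
    proof (induction m)
      case 0
      then show ?case using B C(1) by (simp add: hbinom_Suc_0)
    next
      case (Suc m)
      have 1: "real (hilb K (Suc m)) + B \<ge> real (hilb (K <+> PIdl x) (Suc m)) + real (hilb K m)"
        unfolding B_def using c(1)[of m] by linarith
      have 2: "real (hilb (K <+> PIdl x) (Suc m)) \<ge> e * real (hbinom (Suc s) (Suc m)) - C * real (m + 2) ^ s"
        using C(2)[of "Suc m"] by simp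
      have 3: "e * real (hbinom (Suc (Suc s)) (Suc m)) = e * real (hbinom (Suc (Suc s)) m) + e * real (hbinom (Suc s) (Suc m))"
        by (simp add: hbinom_Suc_Suc algebra_simps)
      have p: "real (m + 2) ^ Suc s \<ge> real (m + 1) ^ Suc s + real (m + 2) ^ s"
      proof -
        have "real (m + 1) * real (m + 1) ^ s \<le> real (m + 1) * real (m + 2) ^ s"
          by (intro mult_left_mono power_mono) auto
        then show ?thesis by (simp add: algebra_simps)
      qed
      have "B * 1 \<le> B * real (m + 2) ^ s" by (intro mult_left_mono B one_le_power) simp
      moreover have "(C + B) * (real (m + 1) ^ Suc s + real (m + 2) ^ s) \<le> (C + B) * real (m + 2) ^ Suc s"
        by (intro mult_left_mono p) (use B C in simp)
      ultimately have "(C + B) * real (m + 1) ^ Suc s + C * real (m + 2) ^ s + B \<le> (C + B) * real (Suc m + 1) ^ Suc s"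
        by (simp add: algebra_simps)
      then show ?case using 1 2 3 Suc by linarith
    qed
    then show ?thesis using B C(1) s unfolding e_def by (intro exI[of _ "C + B"]) auto
  qed
qed simp

end

section \<open>The multiplicity of the special fiber ring\<close>

context noetherian_local_ring
begin

text \<open>Otherwise 1 would lie in the ideal of the predecessors, which is contained in \<mm>.
  This yields that the general elements are distinct and that I has at least d generators.\<close>

lemma regular_mod_notin:
  assumes "regular_mod xs K" "ideal K R" "K \<subseteq> \<mm>" "set xs \<subseteq> \<mm>" "i < length xs"
  shows "xs ! i \<notin> adjoin (take i xs) K"
  using assms
proof (induction xs arbitrary: K i)
  case (Cons x xs)
  have x: "x \<in> carrier R" using Cons.prems ideal_closed(3)[OF \<mm>_ideal] by auto
  show ?case
  proof (cases i)
    case 0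
    have "x \<notin> K"
    proof
      assume "x \<in> K"
      then have "x \<otimes> \<one> \<in> K" using x by simp
      then have "\<one> \<in> K" using Cons.prems(1) one_closed unfolding regular_mod.simps nonzerodiv_mod_def by blast
      then show False using Cons.prems(3) one_notin_\<mm> by blast
    qed
    then show ?thesis using 0 by simp
  next
    case (Suc j)
    have "xs ! j \<notin> adjoin (take j xs) (K <+> PIdl x)"
      using Cons.prems Suc by (intro Cons.IH ideal_sum_PIdl x sum_PIdl_least \<mm>_ideal) auto
    then show ?thesis using Suc by simp
  qed
qed simp

end

context generic_elements
begin

text \<open>The bound for a given regular sequence and a given generating list, whose length stands
  in the place of mu(I).\<close>

lemma fiber_multiplicity_le:
  assumes ys: "regular_mod ys {\<zero>}" "set ys \<subseteq> \<mm>" and d: "length ys = Suc j"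
    and dim: "krull_dim R = enat (Suc j)"
  shows "special_fiber_multiplicity R (Suc j) I \<le>
    hilbert_coeff R (Suc j) I 1 - hilbert_coeff R (Suc j) I 0 + int (colength R I) + int (length as)
      - int (Suc j) + 1"
proof -
  obtain us where us: "length us = Suc j" "set us \<subseteq> U" "regular_mod (map gen us) {\<zero>}"
    "superficial_seq (map gen us) {\<zero>}"
    using superficial_seq_exists[OF ys zeroideal] d by auto
  define xs where "xs = map gen us"
  define J where "J = Idl (set xs)"
  have xs: "set xs \<subseteq> I" "set xs \<subseteq> carrier R" "set xs \<subseteq> \<mm>" "length xs = Suc j" "regular_mod xs {\<zero>}"
    "superficial_seq xs {\<zero>}"
    using us gen_mem gen_closed I_subset by (auto simp: xs_def)
  have J: "mm_primary J" unfolding J_def by (rule regular_mod_mm_primary) (use xs dim in auto)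
  have iJ: "ideal J R" and JI: "J \<subseteq> I" using J mm_primaryD genideal_minimal[OF I_ideal xs(1)] by (auto simp: J_def)
  have adj: "adjoin xs {\<zero>} = J" using adjoin_Idl[OF xs(2), of "{}"] by (simp add: Idl_empty J_def)
  have zero\<mm>: "{\<zero>} \<subseteq> \<mm>" using ideal_closed(2)[OF \<mm>_ideal] by simp
  have notin: "xs ! i \<notin> Idl (set (take i xs))" if "i < Suc j" for i
  proof -
    have "set (take i xs) \<subseteq> carrier R" using xs(2) set_take_subset by fast
    then have eq: "adjoin (take i xs) {\<zero>} = Idl (set (take i xs))"
      using adjoin_Idl[of "take i xs" "{}"] by (simp add: Idl_empty)
    show ?thesis
      using regular_mod_notin[OF xs(5) zeroideal zero\<mm> xs(3), of i] that xs(4) unfolding eq by simp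
  qed
  have dist: "distinct xs"
  proof -
    have "xs ! i \<noteq> xs ! k" if "k < i" "i < Suc j" for i k
    proof -
      have "set (take i xs) \<subseteq> carrier R" using xs(2) set_take_subset by fast
      then have "set (take i xs) \<subseteq> Idl (set (take i xs))" by (rule genideal_self)
      moreover have "xs ! k \<in> set (take i xs)" using that xs(4) by (auto simp: in_set_conv_nth intro!: exI[of _ k])
      ultimately show ?thesis using notin[OF that(2)] by auto
    qed
    then show ?thesis unfolding distinct_conv_nth xs(4) by (metis nat_neq_iff)
  qed
  then have dist_us: "distinct us" unfolding xs_def by (simp add: distinct_map)
  \<comment> \<open>With fewer than d generators, that many initial members of \<open>xs\<close>
    would already generate I, and the next member would lie in their ideal.\<close>
  have n: "Suc j \<le> length as"
  proof (rule ccontr)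
    assume "\<not> Suc j \<le> length as"
    then have lt: "length as < Suc j" by simp
    define S where "S = set (take (length as) us)"
    have "card S = length as" unfolding S_def using lt us(1) dist_us by (simp add: distinct_card)
    moreover have "S \<subseteq> U" unfolding S_def using us(2) set_take_subset by fast
    ultimately have "I = Idl (gen ` S)" by (intro I_eq_Idl_gen) (auto simp: S_def)
    moreover have "gen ` S = set (take (length as) xs)" unfolding S_def xs_def by (simp add: take_map)
    moreover have "xs ! length as \<in> I" using xs(1,4) lt by auto
    ultimately show False using notin[OF lt] by simp
  qed
  \<comment> \<open>Further nodes complete the d chosen ones to \<open>length as\<close> many, so
    that the elements belonging to all of them generate I; L is spanned by the new ones.\<close>
  have "infinite (U - set us)" using U_infinite by simp
  then obtain T where T: "T \<subseteq> U - set us" "finite T" "card T = length as - Suc j"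
    using infinite_arbitrarily_large by blast
  have "card (set us \<union> T) = length as"
    using T n us(1) distinct_card[OF dist_us] by (subst card_Un_disjoint) auto
  then have I_un: "I = Idl (gen ` (set us \<union> T))"
    using us(2) T by (intro I_eq_Idl_gen) auto
  define L where "L = Idl (gen ` T)"
  have Tc: "gen ` T \<subseteq> carrier R" using gen_closed T(1) by blast
  have iL: "ideal L R" unfolding L_def by (rule genideal_ideal[OF Tc])
  have I_sum: "I = J <+> L"
    unfolding I_un J_def L_def image_Un using Idl_Un[OF _ Tc, of "gen ` set us"] xs(2) by (simp add: xs_def)
  have genL: "generated_by (length as - Suc j) L"
    unfolding generated_by_def L_def using Tc T card_image_le[OF T(2), of gen] by (intro exI[of _ "gen ` T"]) auto
  define n' where "n' = length as - Suc j"
  have pJ: "ideal (ideal_power R J m) R" "mm_primary (ideal_power R J m)" for m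
    using ideal_ideal_power[OF iJ] mm_primary_power[OF J] by auto
  have genJ: "generated_by (hbinom j (Suc m)) (ideal_power R J m)" for m
    unfolding J_def by (rule generated_by_ideal_power[OF xs(2,4)])
  have colJ: "colength R (ideal_power R J m) \<le> colength R J * hbinom (Suc j) m" for m
    unfolding J_def by (rule colength_ideal_power_le[OF xs(2,4) J[unfolded J_def]])
  \<comment> \<open>Take J^m I inside I^(m+1). Its generators come from J^(m+1) and J^m L, and its
    colength is that of J^m plus at most l(R/I) for each generator of J^m.\<close>
  have upper: "min_gens R (pow (Suc m)) + colength R (pow (Suc m)) \<le>
      (hbinom j (Suc (Suc m)) + hbinom j (Suc m) * n') + (colength R J * hbinom (Suc j) m + hbinom j (Suc m) * colength R I)" for m
  proof -
    have "ideal_power R J m \<cdot> I = ideal_power R J m \<cdot> J <+> ideal_power R J m \<cdot> L"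
      unfolding I_sum by (rule ideal_prod_distr(1)[OF pJ(1) iJ iL])
    then have "generated_by (hbinom j (Suc (Suc m)) + hbinom j (Suc m) * n') (ideal_power R J m \<cdot> I)"
      using generated_by_sum[OF genJ[of "Suc m", unfolded ideal_power_Suc] generated_by_prod[OF genJ[of m] genL]]
      unfolding n'_def by simp
    then have "min_gens R (pow (Suc m)) + colength R (pow (Suc m)) \<le>
        (hbinom j (Suc (Suc m)) + hbinom j (Suc m) * n') + colength R (ideal_power R J m \<cdot> I)"
      unfolding ideal_power_Suc
      by (intro min_gens_le_colength mm_primary_prod pow_primary I_primary pJ prod_mono ideal_power_mono JI order_refl)
    also have "colength R (ideal_power R J m \<cdot> I) \<le> colength R (ideal_power R J m) + hbinom j (Suc m) * colength R I"
      by (rule colength_prod_le[OF pJ(2) I_primary genJ])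
    finally show ?thesis using colJ[of m] by linarith
  qed
  obtain g0 where g0: "\<forall>\<^sub>F m in sequentially. int (colength R (pow m)) = (\<Sum>i<Suc (length as). g0 i * int (hbinom i m))"
    using ev_poly_expansion[OF ev_poly_colength_pow] by blast
  \<comment> \<open>J^m \<subseteq> I^m limits l(R/I^m) to order m^d and so removes the coefficients
    of degree above d that \<open>length as\<close> had left open.\<close>
  have bound: "\<bar>real_of_int (int (colength R (pow m)))\<bar> \<le> real (colength R J) * real (hbinom (Suc j) m)" for m
  proof -
    have "colength R (pow m) \<le> colength R (ideal_power R J m)"
      by (rule colength_mono[OF pJ(2) pow_ideal ideal_power_mono[OF JI]])
    then show ?thesis using colJ[of m] by (simp flip: of_nat_mult)
  qed
  obtain g where g: "\<forall>\<^sub>F m in sequentially. int (colength R (pow m)) = (\<Sum>i\<le>Suc j. g i * int (hbinom i m))"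
    using hbinom_sum_truncate[OF g0 bound] by blast
  obtain f0 where f0: "\<forall>\<^sub>F m in sequentially. int (min_gens R (pow m)) = (\<Sum>i<length as. f0 i * int (hbinom i m))"
    using ev_poly_expansion[OF ev_poly_min_gens_pow] by blast
  have "ev_poly (Suc j) (\<lambda>m. int (colength R (pow (Suc m))) - int (colength R (pow m)))"
    using ev_poly_hbinom_sum[OF g] by (simp only: ev_poly.simps)
  then obtain h where h: "\<forall>\<^sub>F m in sequentially.
      int (colength R (pow (Suc m))) - int (colength R (pow m)) = (\<Sum>i<Suc j. h i * int (hbinom i m))"
    using ev_poly_expansion by blast
  \<comment> \<open>Since I \<subseteq> \<mm>, mu(I^m) is at most l(I^m / I^(m+1)), a function of
    order at most m^(d-1); this bounds the degree of the fiber polynomial.\<close>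
  have \<mu>_le: "min_gens R (pow m) + colength R (pow m) \<le> colength R (pow (Suc m))" for m
  proof -
    have "pow (Suc m) = I \<cdot> pow m" unfolding ideal_power_Suc by (rule ideal_prod_commute[OF pow_ideal I_ideal])
    also have "\<dots> \<subseteq> \<mm> \<cdot> pow m" by (intro prod_mono I_subset order_refl)
    finally have "colength R (\<mm> \<cdot> pow m) \<le> colength R (pow (Suc m))"
      by (intro colength_mono pow_primary ideal_prod_is_ideal \<mm>_ideal pow_ideal)
    then show ?thesis using min_gens_eq[OF pow_primary] by simp
  qed
  obtain f where f: "\<forall>\<^sub>F m in sequentially. int (min_gens R (pow m)) = (\<Sum>i\<le>j. f i * int (hbinom i m))"
  proof -
    have "(\<lambda>m. real_of_int (int (min_gens R (pow m))) / real m ^ N) \<longlonglongrightarrow> 0" if "j < N" for N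
    proof (rule tendsto_sandwich[OF always_eventually always_eventually tendsto_const
          hbinom_sum_asymp_less[OF h, of N]])
      show "\<forall>m. 0 \<le> real_of_int (int (min_gens R (pow m))) / real m ^ N" by simp
      have "real (min_gens R (pow m)) \<le> real_of_int (int (colength R (pow (Suc m))) - int (colength R (pow m)))" for m
        using \<mu>_le[of m] by simp
      then show "\<forall>m. real_of_int (int (min_gens R (pow m))) / real m ^ N
          \<le> real_of_int (int (colength R (pow (Suc m))) - int (colength R (pow m))) / real m ^ N"
        by (intro allI divide_right_mono) simp_all
    qed (use that in simp)
    then show ?thesis using that hbinom_sum_truncate_tendsto[OF f0] by blast
  qed
  \<comment> \<open>At K = 0 the lower bound has l(R/J) as leading coefficient and an error of order
    m^j, negligible against m^(j+1); comparing limits gives l(R/J) \<le> e_0.\<close>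
  have e_le: "int (colength R J) \<le> g (Suc j)"
  proof -
    obtain C where C: "C \<ge> 0" "\<And>m. real (hilb {\<zero>} m) \<ge>
        real (colength R J) * real (hbinom (Suc j) m) - C * real (m + 1) ^ j"
      using hilb_lower_bound[OF xs(5,6,1) zeroideal] J xs(4) unfolding adj by fastforce
    have hilb: "hilb {\<zero>} m = colength R (pow m)" for m
      unfolding hilb_def using sum_absorb[OF pow_ideal zeroideal] ideal_closed(2)[OF pow_ideal] by simp
    have lim: "(\<lambda>m. real (colength R J) * (real (hbinom (Suc j) m) / real m ^ Suc j)
        - C * ((1 + inverse (real m)) ^ j * inverse (real m))) \<longlonglongrightarrow>
        real (colength R J) * (1 / fact (Suc j)) - C * ((1 + 0) ^ j * 0)"
      by (intro tendsto_diff tendsto_mult tendsto_power tendsto_add tendsto_const hbinom_asymp lim_inverse_n)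
    have "\<forall>\<^sub>F m in sequentially. real (colength R J) * (real (hbinom (Suc j) m) / real m ^ Suc j)
        - C * ((1 + inverse (real m)) ^ j * inverse (real m)) \<le> real_of_int (int (colength R (pow m))) / real m ^ Suc j"
      using eventually_gt_at_top[of 0]
    proof eventually_elim
      case (elim m)
      have "(1 + inverse (real m)) ^ j * inverse (real m) = real (m + 1) ^ j / real m ^ Suc j"
      proof -
        have "1 + inverse (real m) = real (m + 1) / real m" using elim by (simp add: field_simps)
        then have "(1 + inverse (real m)) ^ j = real (m + 1) ^ j / real m ^ j" by (simp only: power_divide)
        then show ?thesis by (simp add: divide_inverse mult_ac)
      qed
      moreover have "(real (colength R J) * real (hbinom (Suc j) m) - C * real (m + 1) ^ j) / real m ^ Suc j
          \<le> real (colength R (pow m)) / real m ^ Suc j"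
        using C(2)[of m] unfolding hilb by (intro divide_right_mono) simp_all
      ultimately show ?case by (simp add: diff_divide_distrib)
    qed
    from tendsto_le[OF sequentially_bot hbinom_sum_asymp[OF g] lim this]
    have "real (colength R J) / fact (Suc j) \<le> real_of_int (g (Suc j)) / fact (Suc j)" by simp
    then have "real (colength R J) \<le> real_of_int (g (Suc j))"
      by (simp add: divide_le_cancel del: fact_Suc)
    then show ?thesis by linarith
  qed
  \<comment> \<open>The coefficients of right side minus left side. The 1 in every degree comes from
    \<open>hbinom j (Suc m)\<close>, and the summand \<open>- g (Suc j)\<close>, that is -e_0, from
    rewriting the binomial of degree d at k = m - 1 in terms of m.\<close>
  define q where "q i = 1 + (if i = j then int n' - g (Suc j) + int (colength R I) else 0) - f i - g i" for i
  have ev: "\<forall>\<^sub>F m in sequentially. 0 \<le> (\<Sum>i\<le>j. q i * int (hbinom i m))"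
    using f g eventually_gt_at_top[of 0]
  proof eventually_elim
    case (elim m)
    then obtain k where k: "m = Suc k" using gr0_conv_Suc by blast
    have "int (min_gens R (pow m)) + int (colength R (pow m)) \<le>
      int (hbinom j (Suc m)) + int (hbinom j m) * int n' + int (colength R J) * int (hbinom (Suc j) k)
        + int (hbinom j m) * int (colength R I)"
      using upper[of k] unfolding k by (simp flip: of_nat_add of_nat_mult)
    \<comment> \<open>Replacing l(R/J) by e_0 lets the terms of degree d on both sides
      cancel.\<close>
    also have "int (colength R J) * int (hbinom (Suc j) k) \<le> g (Suc j) * int (hbinom (Suc j) k)"
      using e_le by (intro mult_right_mono) simp_all
    also have "int (hbinom (Suc j) k) = int (hbinom (Suc j) m) - int (hbinom j m)"
      unfolding k by (simp add: hbinom_Suc_Suc)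
    finally have le: "(\<Sum>i\<le>j. f i * int (hbinom i m)) + (\<Sum>i\<le>j. g i * int (hbinom i m)) \<le>
      (\<Sum>i\<le>j. int (hbinom i m)) + int (hbinom j m) * (int n' - g (Suc j) + int (colength R I))"
      unfolding elim(1,2) hbinom_Suc_arg by (simp add: algebra_simps)
    have "(\<Sum>i\<le>j. q i * int (hbinom i m)) = (\<Sum>i\<le>j. int (hbinom i m))
      + (\<Sum>i\<le>j. (if i = j then int n' - g (Suc j) + int (colength R I) else 0) * int (hbinom i m))
      - (\<Sum>i\<le>j. f i * int (hbinom i m)) - (\<Sum>i\<le>j. g i * int (hbinom i m))"
      unfolding q_def by (simp add: algebra_simps sum.distrib sum_subtractf)
    also have "(\<Sum>i\<le>j. (if i = j then int n' - g (Suc j) + int (colength R I) else 0) * int (hbinom i m))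
      = (\<Sum>i\<in>{j}. (int n' - g (Suc j) + int (colength R I)) * int (hbinom i m))"
      by (intro sum.mono_neutral_cong_right) auto
    finally show ?case using le by (simp add: mult.commute)
  qed
  have "0 \<le> q j" by (rule leading_coeff_nonneg[OF ev])
  then have "f j \<le> 1 + int n' - g (Suc j) + int (colength R I) - g j" by (simp add: q_def)
  moreover have "special_fiber_multiplicity R (Suc j) I = f j" by (rule special_fiber_multiplicity_eq[OF f])
  moreover have "hilbert_coeff R (Suc j) I 0 = g (Suc j)" "hilbert_coeff R (Suc j) I 1 = - g j"
    using hilbert_coeff_eq[OF g, of 0] hilbert_coeff_eq[OF g, of 1] by simp_all
  moreover have "int n' = int (length as) - int (Suc j)" unfolding n'_def using n by simp
  ultimately show ?thesis by simp
qed

end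

theorem theorem2p1:
  fixes R :: "('a, 'b) ring_scheme" (structure) and \<mm> I :: "'a set" and d :: nat
  assumes "cohen_macaulay_local_ring R \<mm>"
    and "krull_dim R = enat d" and "d > 0"
    and "infinite (carrier (R Quot \<mm>))"
    and "primary_to R \<mm> I"
  shows "special_fiber_multiplicity R d I \<le>
    hilbert_coeff R d I 1 - hilbert_coeff R d I 0 + int (colength R I) + int (min_gens R I)
      - int d + 1"
proof -
  interpret cohen_macaulay_local_ring R \<mm> by fact
  interpret P: primary_ideal I R using assms(5) by (simp add: primary_to_def)
  have I: "ideal I R" by (rule P.is_ideal)
  have rad: "ideal_radical R I = \<mm>" using assms(5) by (simp add: primary_to_def)
  obtain j where j: "d = Suc j" using assms(3) gr0_conv_Suc by blast
  \<comment> \<open>The depth is a supremum of extended naturals; being the positive finite number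
    d, it is attained.\<close>
  have "\<exists>ys. regular_sequence R ys \<and> set ys \<subseteq> \<mm> \<and> length ys = d"
  proof (rule ccontr)
    assume n: "\<not> ?thesis"
    have "depth R \<mm> \<le> enat j"
      unfolding depth_def
    proof (rule Sup_least)
      fix l assume "l \<in> {enat (length xs) | xs. regular_sequence R xs \<and> set xs \<subseteq> \<mm>}"
      then obtain xs where xs: "l = enat (length xs)" "regular_sequence R xs" "set xs \<subseteq> \<mm>" by blast
      have "l \<le> depth R \<mm>" unfolding depth_def by (rule Sup_upper) (use xs in blast)
      then have "length xs \<le> d" using depth_eq_dim assms(2) xs(1) by simp
      moreover have "length xs \<noteq> d" using n xs(2,3) by blast
      ultimately show "l \<le> enat j" using xs(1) j by simp
    qed
    then show False using depth_eq_dim assms(2) j by simp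
  qed
  then obtain ys where ys: "regular_sequence R ys" "set ys \<subseteq> \<mm>" "length ys = d" by blast
  have Ipr: "mm_primary I"
    unfolding mm_primary_def using I rad by (auto simp: ideal_radical_def)
  have Isub: "I \<subseteq> \<mm>" using proper_ideal_subset[OF I] P.I_notcarr by blast
  obtain A where A: "A \<subseteq> carrier R" "finite A" "card A \<le> min_gens R I" "I = Idl A"
    using min_gens_generated[OF I] unfolding generated_by_def by blast
  \<comment> \<open>Fewer elements than mu(I) cannot generate I, so the bound on the cardinality is
    an equality and the list has exactly mu(I) entries.\<close>
  have "generated_by (card A) I" unfolding generated_by_def using A by blast
  then have card: "card A = min_gens R I" using A(3) min_gens_le by fastforce
  obtain as where as: "set as = A" "distinct as" using finite_distinct_list[OF A(2)] by blast
  \<comment> \<open>One representative of each residue class: infinitely many by hypothesis, and the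
    difference of two distinct ones lies outside \<mm>.\<close>
  obtain U where U: "U \<subseteq> carrier R" "inj_on ((+>) \<mm>) U" "carrier (R Quot \<mm>) = (+>) \<mm> ` U"
  proof -
    have "carrier (R Quot \<mm>) \<subseteq> (+>) \<mm> ` carrier R"
      unfolding FactRing_def A_RCOSETS_def' partial_object.simps by blast
    then obtain V where "V \<subseteq> carrier R" "inj_on ((+>) \<mm>) V" "carrier (R Quot \<mm>) = (+>) \<mm> ` V"
      unfolding subset_image_inj by blast
    then show ?thesis by (rule that)
  qed
  interpret generic_elements R \<mm> as I U
  proof unfold_locales
    show "set as \<subseteq> carrier R" "I = Idl (set as)" using A as by auto
    show "infinite U" using U(3) assms(4) by auto
    show "u \<ominus> v \<notin> \<mm>" if "u \<in> U" "v \<in> U" "u \<noteq> v" for u v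
    proof
      assume "u \<ominus> v \<in> \<mm>"
      then have "\<mm> +> u = \<mm> +> v"
        using quotient_eq_iff_same_a_r_cos[OF \<mm>_ideal, of u v] U(1) that by blast
      then have "u = v" by (rule inj_onD[OF U(2) _ that(1,2)])
      then show False using that(3) by simp
    qed
  qed (use Ipr Isub U in auto)
  have "length as = min_gens R I" using card as distinct_card by fastforce
  then show ?thesis
    using fiber_multiplicity_le[OF regular_mod_regular_sequence[OF ys(1)] ys(2), of j] ys(3) assms(2)
    unfolding j by simp
qed

end
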